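(* Let $r, m, \ell$ be positive integers, let $X$ be an $n$-dimensional $C^r$ manifold with $n\ge\ell$, let $V$ be an open subset of $\mathbb{R}^m$, let $f:X\to V$ be an injective $C^r$ mapping, and let $g:V\to\mathbb{R}^\ell$ be a $C^r$ mapping. Let $\Sigma$ be the set of $\pi\in\mathcal{L}(\mathbb{R}^m,\mathbb{R}^\ell)$ for which there exists an integer $d$ satisfying $2\le d\le d_f$ such that $((g+\pi)\circ f)^{(d)}:X^{(d)}\to(\mathbb{R}^\ell)^d$ is not transverse to $\Delta_d$. Then, for any real number $s$ satisfying $$s\ge m\ell-1+\frac{d_f(n-\ell)+\ell+1}{r},$$ the set $\Sigma$ has $s$-dimensional Hausdorff measure zero in $\mathcal{L}(\mathbb{R}^m,\mathbb{R}^\ell)$. Moreover, if $\pi\in\mathcal{L}(\mathbb{R}^m,\mathbb{R}^\ell)\setminus\Sigma$ and $(g+\pi)\circ f:X\to\mathbb{R}^\ell$ has the property that $|((g+\pi)\circ f)^{-1}(y)|\le d_f$ for every $y\in\mathbb{R}^\ell$, then $(g+\pi)\circ f$ is a $C^r$ mapping with normal crossings.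
   Context: All manifolds are without boundary and second countable. $|S|$ denotes the cardinality of a set $S$. $\mathcal{L}(\mathbb{R}^m,\mathbb{R}^\ell)$ is the space of all linear mappings $\mathbb{R}^m\to\mathbb{R}^\ell$, identified with the Euclidean space $(\mathbb{R}^m)^\ell=\mathbb{R}^{m\ell}$ via matrix entries. In $g+\pi$, the linear map $\pi$ is restricted to $V$. For a $C^r$ manifold $X$ and an integer $d$, $X^{(d)}=\{(q_1,\ldots,q_d)\in X^d\mid q_i\ne q_j \text{ if } i\neq j\}$, an open submanifold of $X^d$. For $h:X\to\mathbb{R}^\ell$, the mapping $h^{(d)}:X^{(d)}\to(\mathbb{R}^\ell)^d$ is $h^{(d)}(q_1,\ldots,q_d)=(h(q_1),\ldots,h(q_d))$. Also $\Delta_d=\{(y,\ldots,y)\in(\mathbb{R}^\ell)^d\mid y\in\mathbb{R}^\ell\}$, a submanifold of $(\mathbb{R}^\ell)^d$. For an injection $f:X\to\mathbb{R}^m$, $$d_f=\max\Big\{d \;\Big|\; \forall (q_1,\ldots,q_d)\in X^{(d)},\ \dim\sum_{i=2}^d\mathbb{R}\,\overrightarrow{f(q_1)f(q_i)}=d-1\Big\},$$ where $d$ ranges over positive integers, $\overrightarrow{f(q_1)f(q_i)}=f(q_i)-f(q_1)$, and the sum is the linear span of these vectors. It is assumed that this maximum exists; one has $2\le d_f\le m+1$. A $C^1$ mapping $h:X\to Y$ is transverse to a submanifold $Z\subset Y$ if for every $x\in X$ either $h(x)\notin Z$, or $h(x)\in Z$ and $dh_x(T_xX)+T_{h(x)}Z=T_{h(x)}Y$.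 A $C^1$ mapping $h:X\to\mathbb{R}^\ell$ is a mapping with normal crossings if for every integer $d\ge2$ the mapping $h^{(d)}:X^{(d)}\to(\mathbb{R}^\ell)^d$ is transverse to $\Delta_d$. For $s>0$, the $s$-dimensional Hausdorff outer measure of $B\subset\mathbb{R}^N$ is $\lim_{\delta\to0}\inf\{\sum_{j=1}^\infty(\operatorname{diam}C_j)^s\mid B\subset\bigcup_{j=1}^\infty C_j,\ \operatorname{diam}C_j\le\delta\}$ (Euclidean diameter, arbitrary subsets $C_j$ of $\mathbb{R}^N$); for $s=0$ it is the counting measure. A subset of $\mathcal{L}(\mathbb{R}^m,\mathbb{R}^\ell)$ has $s$-dimensional Hausdorff measure zero if its $s$-dimensional Hausdorff outer measure in $\mathbb{R}^{m\ell}$ is zero. *)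

theory Defs
  imports "HOL-Analysis.Analysis"
begin

section \<open>Mappings of class C^k\<close>

text \<open>
  The domain \<open>S\<close> is meant to be a relatively open subset of a finite-dimensional linear subspace
  \<open>E\<close> of a normed space. The derivative of \<open>f\<close> within such an \<open>S\<close> is determined exactly on \<open>E\<close>,
  which is why only directions \<open>v \<in> E\<close> occur. If all directional derivatives are again of class
  C^k then so is the derivative itself, because \<open>E\<close> has finite dimension.
\<close>

primrec Ck_on ::
  "nat \<Rightarrow> 'e::real_normed_vector set \<Rightarrow> 'e set \<Rightarrow> ('e \<Rightarrow> 'f::real_normed_vector) \<Rightarrow> bool"
where
  "Ck_on 0 E S f \<longleftrightarrow> continuous_on S f"
| "Ck_on (Suc k) E S f \<longleftrightarrow>
     (\<forall>x\<in>S. f differentiable (at x within S)) \<and>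
     (\<forall>v\<in>E. Ck_on k E S (\<lambda>x. frechet_derivative f (at x within S) v))"

section \<open>Manifolds\<close>

text \<open>
  A manifold is modelled on a finite-dimensional linear subspace of a normed space. An
  \<open>n\<close>-dimensional manifold has model \<open>UNIV :: (real^'n) set\<close>; proper subspaces are
  needed for the configuration spaces below, whose dimension depends on a number \<open>d\<close> that is
  quantified inside formulas. A chart is a pair of its domain and its coordinate map, of which only
  the values on the domain matter.
\<close>

record ('a, 'e) manifold =
  mtop :: "'a topology"
  model :: "'e set"
  atlas :: "('a set \<times> ('a \<Rightarrow> 'e)) set"

abbreviation points :: "('a, 'e) manifold \<Rightarrow> 'a set"
  where "points M \<equiv> topspace (mtop M)"

definition Ck_manifold :: "nat \<Rightarrow> ('a, 'e::real_normed_vector) manifold \<Rightarrow> bool"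
where
  "Ck_manifold r M \<longleftrightarrow>
     Hausdorff_space (mtop M) \<and> second_countable (mtop M) \<and>
     subspace (model M) \<and>
     points M = (\<Union>(U, \<phi>)\<in>atlas M. U) \<and>
     (\<forall>(U, \<phi>)\<in>atlas M.
        openin (mtop M) U \<and> openin (top_of_set (model M)) (\<phi> ` U) \<and>
        homeomorphic_map (subtopology (mtop M) U) (top_of_set (\<phi> ` U)) \<phi>) \<and>
     (\<forall>(U, \<phi>)\<in>atlas M. \<forall>(W, \<psi>)\<in>atlas M.
        Ck_on r (model M) (\<phi> ` (U \<inter> W)) (\<psi> \<circ> inv_into U \<phi>))"

definition Ck_map ::
  "nat \<Rightarrow> ('a, 'e::real_normed_vector) manifold \<Rightarrow> ('a \<Rightarrow> 'f::real_normed_vector) \<Rightarrow> bool"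
where
  "Ck_map r M h \<longleftrightarrow> (\<forall>(U, \<phi>)\<in>atlas M. Ck_on r (model M) (\<phi> ` U) (h \<circ> inv_into U \<phi>))"

section \<open>Transversality\<close>

text \<open>
  The image \<open>dh_x(T_x M)\<close>. For a \<open>C^1\<close> mapping on a \<open>C^1\<close> manifold all charts around \<open>x\<close> give the
  same linear subspace.
\<close>

definition differential_image ::
  "('a, 'e::real_normed_vector) manifold \<Rightarrow> ('a \<Rightarrow> 'f::real_normed_vector) \<Rightarrow> 'a \<Rightarrow> 'f set"
where
  "differential_image M h x =
     {frechet_derivative (h \<circ> inv_into U \<phi>) (at (\<phi> x) within \<phi> ` U) v | U \<phi> v.
        (U, \<phi>) \<in> atlas M \<and> x \<in> U \<and> v \<in> model M}"

text \<open>
  The tangent space at \<open>z\<close> of a submanifold of a normed space, as the set of velocities of curves.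
\<close>

definition tangent_vectors :: "'f::real_normed_vector set \<Rightarrow> 'f \<Rightarrow> 'f set"
where
  "tangent_vectors Z z =
     {v. \<exists>\<gamma> \<epsilon>. 0 < \<epsilon> \<and> \<gamma> ` {-\<epsilon><..<\<epsilon>} \<subseteq> Z \<and> \<gamma> 0 = z \<and> (\<gamma> has_vector_derivative v) (at (0::real))}"

text \<open>Here \<open>Y\<close> is a submanifold of a normed space (below: a linear subspace) and \<open>Z \<subseteq> Y\<close>.\<close>

definition transverse ::
  "('a, 'e::real_normed_vector) manifold \<Rightarrow> ('a \<Rightarrow> 'f::real_normed_vector) \<Rightarrow> 'f set \<Rightarrow> 'f set \<Rightarrow> bool"
where
  "transverse M h Y Z \<longleftrightarrow>
     (\<forall>x\<in>points M. h x \<notin> Z \<or>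
        (h x \<in> Z \<and>
         {u + w | u w. u \<in> differential_image M h x \<and> w \<in> tangent_vectors Z (h x)} =
           tangent_vectors Y (h x)))"

section \<open>Tuples of vectors and configuration spaces\<close>

text \<open>
  Since \<open>d\<close> is a variable, \<open>E^d\<close> is realised inside one normed space for all \<open>d\<close>: it consists of
  the functions \<open>nat \<Rightarrow> 'e\<close> that take values in \<open>E\<close> on \<open>{1..d}\<close> and vanish elsewhere. Every bounded
  function on the discrete space \<open>nat\<close> is an element of \<open>nat \<Rightarrow>\<^sub>C 'e\<close>, and on the finite-dimensional
  subspace \<open>E^d\<close> the supremum norm is equivalent to the Euclidean one, so it yields the usual
  topology and derivatives.
\<close>

definition tuple :: "nat \<Rightarrow> (nat \<Rightarrow> 'e::real_normed_vector) \<Rightarrow> (nat \<Rightarrow>\<^sub>C 'e)"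
  where "tuple d x = Bcontfun (\<lambda>i. if i \<in> {1..d} then x i else 0)"

lemma apply_tuple: "apply_bcontfun (tuple d x) i = (if i \<in> {1..d} then x i else 0)"
proof -
  have "range (\<lambda>i. if i \<in> {1..d} then x i else 0) \<subseteq> insert 0 (x ` {1..d})"
    by auto
  then have "bounded (range (\<lambda>i. if i \<in> {1..d} then x i else 0))"
    by (meson bounded_subset finite_atLeastAtMost finite_imageI finite_imp_bounded finite_insert)
  then have "(\<lambda>i. if i \<in> {1..d} then x i else 0) \<in> bcontfun"
    by (auto simp: bcontfun_def)
  then show ?thesis
    by (simp add: tuple_def Bcontfun_inverse)
qed

definition tuple_space :: "nat \<Rightarrow> 'e::real_normed_vector set \<Rightarrow> (nat \<Rightarrow>\<^sub>C 'e) set"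
  where "tuple_space d E = {tuple d x | x. \<forall>i\<in>{1..d}. x i \<in> E}"

definition diagonal :: "nat \<Rightarrow> (nat \<Rightarrow>\<^sub>C 'f::real_normed_vector) set"
  where "diagonal d = {tuple d (\<lambda>i. y) | y. True}"

text \<open>
  \<open>X^(d)\<close> as an open submanifold of the product manifold \<open>X^d\<close>. A point is a \<open>q\<close> in
  \<open>{1..d} \<rightarrow>\<^sub>E points X\<close>, and a chart is a product of \<open>d\<close> charts, restricted to injective tuples.
\<close>

definition config :: "nat \<Rightarrow> ('a, 'e::real_normed_vector) manifold \<Rightarrow> (nat \<Rightarrow> 'a, nat \<Rightarrow>\<^sub>C 'e) manifold"
where
  "config d X =
     \<lparr> mtop = subtopology (product_topology (\<lambda>_. mtop X) {1..d}) {q. inj_on q {1..d}},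
       model = tuple_space d (model X),
       atlas = {({q \<in> (\<Pi>\<^sub>E i\<in>{1..d}. fst (c i)). inj_on q {1..d}},
                 \<lambda>q. tuple d (\<lambda>i. snd (c i) (q i))) | c. \<forall>i\<in>{1..d}. c i \<in> atlas X} \<rparr>"

definition multi :: "nat \<Rightarrow> ('a \<Rightarrow> 'f::real_normed_vector) \<Rightarrow> (nat \<Rightarrow> 'a) \<Rightarrow> (nat \<Rightarrow>\<^sub>C 'f)"
  where "multi d h q = tuple d (\<lambda>i. h (q i))"

definition multi_transverse ::
  "nat \<Rightarrow> ('a, 'e::real_normed_vector) manifold \<Rightarrow> ('a \<Rightarrow> 'f::real_normed_vector) \<Rightarrow> bool"
where
  "multi_transverse d X h \<longleftrightarrow>
     transverse (config d X) (multi d h) (tuple_space d UNIV) (diagonal d)"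

definition normal_crossings ::
  "('a, 'e::real_normed_vector) manifold \<Rightarrow> ('a \<Rightarrow> 'f::real_normed_vector) \<Rightarrow> bool"
where
  "normal_crossings X h \<longleftrightarrow> Ck_map 1 X h \<and> (\<forall>d\<ge>2. multi_transverse d X h)"

section \<open>The number d_f\<close>

definition general_position_degrees ::
  "('a, 'e::real_normed_vector) manifold \<Rightarrow> ('a \<Rightarrow> 'v::euclidean_space) \<Rightarrow> nat set"
where
  "general_position_degrees X f =
     {d. d \<ge> 1 \<and> (\<forall>q\<in>points (config d X). dim (span ((\<lambda>i. f (q i) - f (q 1)) ` {2..d})) = d - 1)}"

definition df :: "('a, 'e::real_normed_vector) manifold \<Rightarrow> ('a \<Rightarrow> 'v::euclidean_space) \<Rightarrow> nat"
  where "df X f = Max (general_position_degrees X f)"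

section \<open>Hausdorff measure\<close>

text \<open>
  \<open>diameter\<close> has no meaningful value on unbounded sets, hence the condition \<open>bounded (C j)\<close>. No
  normalising constant is used.
\<close>

definition hausdorff_outer :: "real \<Rightarrow> 'v::euclidean_space set \<Rightarrow> ennreal"
where
  "hausdorff_outer s B =
     (if s = 0 then emeasure (count_space UNIV) B
      else Lim (at_right 0) (\<lambda>\<delta>::real.
             INF C\<in>{C :: nat \<Rightarrow> 'v set.
                      B \<subseteq> (\<Union>j. C j) \<and> (\<forall>j. bounded (C j) \<and> diameter (C j) \<le> \<delta>)}.
               (\<Sum>j. ennreal (diameter (C j) powr s))))"

text \<open>
  Linear mappings are identified with their matrices; the norm of \<open>real^'m^'l\<close> is the Euclidean norm
  of the vector of all matrix entries.
\<close>

definition hausdorff_null :: "real \<Rightarrow> (real^'m \<Rightarrow> real^'l) set \<Rightarrow> bool"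
  where "hausdorff_null s B \<longleftrightarrow> hausdorff_outer s (matrix ` B) = 0"

definition bad_perturbations ::
  "('a, 'e::real_normed_vector) manifold \<Rightarrow> ('a \<Rightarrow> real^'m) \<Rightarrow> (real^'m \<Rightarrow> real^'l)
     \<Rightarrow> (real^'m \<Rightarrow> real^'l) set"
where
  "bad_perturbations X f g =
     {\<pi>. linear \<pi> \<and>
          (\<exists>d. 2 \<le> d \<and> d \<le> df X f \<and> \<not> multi_transverse d X ((\<lambda>x. g x + \<pi> x) \<circ> f))}"

end

theory Submission
  imports Defs
begin

text \<open>Fix \<open>2 \<le> d \<le> d_f\<close> and write \<open>h = (g + \<pi>) \<circ> f\<close>. In charts around \<open>q_1, \<dots>, q_d\<close> the mapping \<open>h^(d)\<close> meets
  the diagonal where the \<open>(d - 1) l\<close> equations \<open>h(x_i) = h(x_1)\<close>, \<open>2 \<le> i \<le> d\<close>, hold. As equations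
  in \<open>(x, \<pi>)\<close> they have independent differentials: the vectors \<open>f(q_i) - f(q_1)\<close> are linearly
  independent because \<open>d \<le> d_f\<close>, so the derivative in \<open>\<pi>\<close> alone is onto. Hence the solutions form a
  \<open>C^r\<close> manifold of dimension \<open>N = d n + m l - (d - 1) l\<close>, and \<open>h^(d)\<close> fails to be transverse to the
  diagonal at a solution exactly if the solution is a critical point of the projection to \<open>\<pi>\<close>
  (\<open>degenerate_crossings_null\<close>, \<open>multi_transverseI\<close>). By Federer's form of the Morse-Sard theorem the
  critical values of a \<open>C^r\<close> mapping from dimension \<open>N\<close> to dimension \<open>p \<le> N\<close> are a null set for the
  Hausdorff measure of dimension \<open>p - 1 + (N - p + 1) / r\<close>. For \<open>p = m l\<close> this is the bound of the
  theorem with \<open>d\<close> in place of \<open>d_f\<close>; it grows with \<open>d\<close> as \<open>n \<ge> l\<close>, and countably many charts suffice.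

  Most of the text proves that theorem (\<open>sard_straightened\<close>, and \<open>sard_constrained\<close> for mappings
  restricted to a zero set). Taking components of the mapping as new coordinates, one at a time,
  leads to \<open>F(y, z) = (y, \<phi>(y, z))\<close> with \<open>D_z \<phi> = 0\<close> on the set \<open>A\<close> in question, where \<open>y\<close> has some
  dimension \<open>\<nu> < p\<close>. Boxes with sides of order \<open>\<rho>^r\<close> in \<open>y\<close> and \<open>\<rho>\<close> in \<open>z\<close> have images of diameter
  \<open>O(\<rho>^r)\<close> if \<open>\<phi>\<close> varies by \<open>O(\<rho>^r)\<close> over \<open>z\<close>-distance \<open>\<rho>\<close> from \<open>A\<close>, and the exponent
  \<open>\<nu> + (N - \<nu>) / r\<close> is the one for which the number of boxes just compensates the diameters. That \<open>\<phi>\<close>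
  is so flat, and the small gain that turns a finite measure into measure zero, come from a lemma of
  A. P. Morse (\<open>flat_decomposition\<close>): \<open>A\<close> is a countable union of pieces of \<open>C^1\<close> surfaces along which
  all \<open>C^k\<close> functions vanishing on \<open>A\<close> grow at most like the \<open>k\<close>-th power of the \<open>z\<close>-distance. Either
  the surface has smaller dimension, so that fewer boxes are needed, or the constant in this
  estimate is arbitrarily small.

  As to the second assertion, transversality holds for \<open>d \<le> d_f\<close> by the choice of \<open>\<pi>\<close>, and for \<open>d > d_f\<close>
  because the fibres are too small for \<open>d\<close> distinct points with the same image, so that \<open>h^(d)\<close> misses the diagonal.

  The number \<open>d\<close> and all dimensions in the inductions are variables, so every dimension is realised
  inside one Euclidean space, as the subspace \<open>coords S\<close> spanned by a set \<open>S\<close> of basis vectors.\<close>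

section \<open>Mappings of class C^k on open sets\<close>

abbreviation Ck :: "nat \<Rightarrow> 'a::real_normed_vector set \<Rightarrow> ('a \<Rightarrow> 'b::real_normed_vector) \<Rightarrow> bool"
  where "Ck k U f \<equiv> Ck_on k UNIV U f"

declare Ck_on.simps(2) [simp del]

abbreviation deriv_at :: "('a::real_normed_vector \<Rightarrow> 'b::real_normed_vector) \<Rightarrow> 'a \<Rightarrow> 'a \<Rightarrow> 'b"
  where "deriv_at f x \<equiv> frechet_derivative f (at x)"

lemma Ck_on_cong:
  assumes "\<And>x. x \<in> U \<Longrightarrow> f x = g x"
  shows "Ck_on k E U f = Ck_on k E U g"
  using assms
proof (induction k arbitrary: f g)
  case 0
  then show ?case by (auto cong: continuous_on_cong)
next
  case (Suc k)
  have d: "(f has_derivative f') (at x within U) = (g has_derivative f') (at x within U)" if "x \<in> U" for x f'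
    using Suc.prems that has_derivative_transform by metis
  then have "frechet_derivative f (at x within U) = frechet_derivative g (at x within U)"
      "f differentiable (at x within U) \<longleftrightarrow> g differentiable (at x within U)" if "x \<in> U" for x
    using that by (simp_all add: frechet_derivative_def differentiable_def)
  with Suc.IH[of "\<lambda>x. frechet_derivative f (at x within U) v" "\<lambda>x. frechet_derivative g (at x within U) v" for v]
  show ?case by (auto simp: Ck_on.simps(2))
qed

lemma Ck_Suc:
  assumes "open U"
  shows "Ck (Suc k) U f \<longleftrightarrow>
    (\<forall>x\<in>U. f differentiable (at x)) \<and> (\<forall>v. Ck k U (\<lambda>x. deriv_at f x v))"
proof -
  have "Ck_on k UNIV U (\<lambda>x. frechet_derivative f (at x within U) v) = Ck k U (\<lambda>x. deriv_at f x v)" for v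
    by (rule Ck_on_cong) (simp add: at_within_open[OF _ assms])
  then show ?thesis
    by (simp add: at_within_open[OF _ assms] Ck_on.simps(2))
qed

lemma Ck_SucI:
  assumes "open U" "\<And>x. x \<in> U \<Longrightarrow> (f has_derivative f' x) (at x)"
    and "\<And>v. Ck k U (\<lambda>x. f' x v)"
  shows "Ck (Suc k) U f"
proof -
  have "Ck k U (\<lambda>x. deriv_at f x v) = Ck k U (\<lambda>x. f' x v)" for v
    by (rule Ck_on_cong) (metis assms(2) frechet_derivative_at)
  then show ?thesis
    using assms Ck_Suc differentiable_def by metis
qed

lemma Ck_SucD:
  assumes "open U" "Ck (Suc k) U f"
  shows "x \<in> U \<Longrightarrow> (f has_derivative deriv_at f x) (at x)"
    and "Ck k U (\<lambda>x. deriv_at f x v)"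
  using assms by (auto simp: Ck_Suc frechet_derivative_works)

lemma Ck_has_derivative:
  assumes "open U" "Ck k U f" "1 \<le> k" "x \<in> U"
  shows "(f has_derivative deriv_at f x) (at x)"
  using assms Ck_SucD(1) by (cases k) auto

lemma Ck_imp_continuous_on:
  assumes "open U" "Ck k U f"
  shows "continuous_on U f"
proof (cases k)
  case 0
  then show ?thesis using assms by simp
next
  case (Suc j)
  then show ?thesis
    using assms by (auto simp: Ck_Suc intro!: continuous_at_imp_continuous_on differentiable_imp_continuous_within)
qed

lemma Ck_Suc_imp_Ck: "open U \<Longrightarrow> Ck (Suc k) U f \<Longrightarrow> Ck k U f"
proof (induction k arbitrary: f)
  case 0
  then show ?case using Ck_imp_continuous_on by auto
next
  case (Suc k)
  then show ?case using Ck_Suc by blast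
qed

lemma Ck_mono: "open U \<Longrightarrow> Ck k U f \<Longrightarrow> j \<le> k \<Longrightarrow> Ck j U f"
  by (induction k) (auto simp: le_Suc_eq dest: Ck_Suc_imp_Ck)

lemma Ck_subset: "open U \<Longrightarrow> Ck k U f \<Longrightarrow> open V \<Longrightarrow> V \<subseteq> U \<Longrightarrow> Ck k V f"
proof (induction k arbitrary: f)
  case 0
  then show ?case using continuous_on_subset by auto
next
  case (Suc k)
  then show ?case using Ck_Suc subsetD by metis
qed

lemma Ck_const: "open U \<Longrightarrow> Ck k U (\<lambda>x. c)"
  by (induction k arbitrary: c) (auto intro!: Ck_SucI[where f' = "\<lambda>x v. 0"])

lemma Ck_bounded_linear: "open U \<Longrightarrow> bounded_linear L \<Longrightarrow> Ck k U f \<Longrightarrow> Ck k U (\<lambda>x. L (f x))"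
proof (induction k arbitrary: f)
  case 0
  then show ?case by (auto intro: bounded_linear.continuous_on)
next
  case (Suc k)
  show ?case
  proof (rule Ck_SucI[where f' = "\<lambda>x v. L (deriv_at f x v)", OF Suc.prems(1)])
    show "((\<lambda>x. L (f x)) has_derivative (\<lambda>v. L (deriv_at f x v))) (at x)" if "x \<in> U" for x
      using Ck_SucD(1)[OF Suc.prems(1,3) that] Suc.prems(2) bounded_linear.has_derivative by blast
    show "Ck k U (\<lambda>x. L (deriv_at f x v))" for v
      by (rule Suc.IH[OF Suc.prems(1,2) Ck_SucD(2)[OF Suc.prems(1,3)]])
  qed
qed

lemma Ck_ident: "open U \<Longrightarrow> Ck k U (\<lambda>x. x)"
proof (induction k)
  case (Suc k)
  then show ?case by (auto intro!: Ck_SucI[where f' = "\<lambda>x v. v"] Ck_const)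
qed (auto simp: continuous_on_id)

lemma Ck_add:
  "open U \<Longrightarrow> Ck k U f \<Longrightarrow> Ck k U g \<Longrightarrow> Ck k U (\<lambda>x. f x + g x)"
proof (induction k arbitrary: f g)
  case 0
  then show ?case by (auto intro: continuous_on_add)
next
  case (Suc k)
  note D = Ck_SucD[OF Suc.prems(1,2)] Ck_SucD[OF Suc.prems(1,3)]
  show ?case
    by (rule Ck_SucI[where f' = "\<lambda>x v. deriv_at f x v + deriv_at g x v", OF Suc.prems(1)])
       (auto intro!: has_derivative_add D Suc.IH[OF Suc.prems(1)])
qed

lemma Ck_sum:
  "open U \<Longrightarrow> (\<And>i. i \<in> I \<Longrightarrow> Ck k U (f i)) \<Longrightarrow> Ck k U (\<lambda>x. \<Sum>i\<in>I. f i x)"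
  by (induction I rule: infinite_finite_induct) (auto intro: Ck_const Ck_add)

lemma Ck_bilinear:
  assumes "bounded_bilinear pr"
  shows "open U \<Longrightarrow> Ck k U f \<Longrightarrow> Ck k U g \<Longrightarrow> Ck k U (\<lambda>x. pr (f x) (g x))"
proof (induction k arbitrary: f g)
  case 0
  then show ?case using assms by (auto intro: bounded_bilinear.continuous_on)
next
  case (Suc k)
  show ?case
  proof (rule Ck_SucI[where f' = "\<lambda>x v. pr (f x) (deriv_at g x v) + pr (deriv_at f x v) (g x)", OF Suc.prems(1)])
    show "((\<lambda>x. pr (f x) (g x)) has_derivative (\<lambda>v. pr (f x) (deriv_at g x v) + pr (deriv_at f x v) (g x))) (at x)"
      if "x \<in> U" for x
      using bounded_bilinear.FDERIV[OF assms Ck_SucD(1)[OF Suc.prems(1,2) that] Ck_SucD(1)[OF Suc.prems(1,3) that]] .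
    show "Ck k U (\<lambda>x. pr (f x) (deriv_at g x v) + pr (deriv_at f x v) (g x))" for v
      by (intro Ck_add Suc.IH Suc.prems(1) Ck_SucD(2)[OF Suc.prems(1,2)] Ck_SucD(2)[OF Suc.prems(1,3)]
          Ck_Suc_imp_Ck[OF Suc.prems(1,2)] Ck_Suc_imp_Ck[OF Suc.prems(1,3)])
  qed
qed

lemmas Ck_mult = Ck_bilinear[OF bounded_bilinear_mult]
lemmas Ck_scaleR = Ck_bilinear[OF bounded_bilinear_scaleR]

lemma Ck_diff:
  assumes "open U" "Ck k U f" "Ck k U g" shows "Ck k U (\<lambda>x. f x - g x)"
  using Ck_add[OF assms(1,2) Ck_bounded_linear[OF assms(1) _ assms(3), of uminus]]
  by (simp add: bounded_linear_minus bounded_linear_ident)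

lemma Ck_inner_left: "open U \<Longrightarrow> Ck k U f \<Longrightarrow> Ck k U (\<lambda>x. f x \<bullet> c)"
  by (rule Ck_bounded_linear[OF _ bounded_linear_inner_left])

lemma Ck_inverse:
  fixes u :: "'a::real_normed_vector \<Rightarrow> real"
  shows "open U \<Longrightarrow> Ck k U u \<Longrightarrow> (\<And>x. x \<in> U \<Longrightarrow> u x \<noteq> 0) \<Longrightarrow> Ck k U (\<lambda>x. inverse (u x))"
proof (induction k arbitrary: u)
  case 0
  then show ?case by (auto intro: continuous_on_inverse)
next
  case (Suc k)
  show ?case
  proof (rule Ck_SucI[where f' = "\<lambda>x v. - (inverse (u x) * deriv_at u x v * inverse (u x))", OF Suc.prems(1)])
    show "((\<lambda>x. inverse (u x)) has_derivative (\<lambda>v. - (inverse (u x) * deriv_at u x v * inverse (u x)))) (at x)"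
      if "x \<in> U" for x
      using Deriv.has_derivative_inverse[OF Suc.prems(3)[OF that] Ck_SucD(1)[OF Suc.prems(1,2) that]] .
    have "Ck k U (\<lambda>x. inverse (u x))"
      by (rule Suc.IH[OF Suc.prems(1) Ck_Suc_imp_Ck[OF Suc.prems(1,2)] Suc.prems(3)])
    then have "Ck k U (\<lambda>x. inverse (u x) * deriv_at u x v * inverse (u x))" for v
      by (intro Ck_mult Suc.prems(1) Ck_SucD(2)[OF Suc.prems(1,2)])
    from Ck_bounded_linear[OF Suc.prems(1) _ this, of uminus]
    show "Ck k U (\<lambda>x. - (inverse (u x) * deriv_at u x v * inverse (u x)))" for v
      by (simp add: bounded_linear_minus bounded_linear_ident)
  qed
qed

lemma linear_expand_Basis:
  fixes L :: "'a::euclidean_space \<Rightarrow> 'b::real_vector"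
  assumes "linear L"
  shows "L v = (\<Sum>b\<in>Basis. (v \<bullet> b) *\<^sub>R L b)"
proof -
  have "L v = L (\<Sum>b\<in>Basis. (v \<bullet> b) *\<^sub>R b)" by (simp add: euclidean_representation)
  also have "\<dots> = (\<Sum>b\<in>Basis. (v \<bullet> b) *\<^sub>R L b)"
    using assms by (simp add: linear_sum linear_scale)
  finally show ?thesis .
qed

text \<open>The chain rule, differentiated again: in coordinates the derivative of a composite is a sum of
  products of a partial derivative of the outer function, composed with the inner one, and a
  coordinate of the derivative of the inner function.\<close>

lemma Ck_compose:
  fixes f :: "'a::real_normed_vector \<Rightarrow> 'b::euclidean_space"
  shows "open U \<Longrightarrow> open W \<Longrightarrow> Ck k U f \<Longrightarrow> Ck k W g \<Longrightarrow> f ` U \<subseteq> W \<Longrightarrow> Ck k U (\<lambda>x. g (f x))"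
proof (induction k arbitrary: g)
  case 0
  then show ?case using continuous_on_compose2 by auto
next
  case (Suc k)
  let ?D = "\<lambda>x v. \<Sum>b\<in>Basis. (deriv_at f x v \<bullet> b) *\<^sub>R deriv_at g (f x) b"
  show ?case
  proof (rule Ck_SucI[where f' = ?D, OF Suc.prems(1)])
    fix x assume x: "x \<in> U"
    have f: "(f has_derivative deriv_at f x) (at x)" using Ck_SucD(1)[OF Suc.prems(1,3) x] .
    have g: "(g has_derivative deriv_at g (f x)) (at (f x))"
      using Ck_SucD(1)[OF Suc.prems(2,4)] Suc.prems(5) x by blast
    have "deriv_at g (f x) v = (\<Sum>b\<in>Basis. (v \<bullet> b) *\<^sub>R deriv_at g (f x) b)" for v
      by (rule linear_expand_Basis[OF has_derivative_linear[OF g]])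
    then have "(\<lambda>v. deriv_at g (f x) (deriv_at f x v)) = ?D x" by (rule ext)
    then show "((\<lambda>x. g (f x)) has_derivative ?D x) (at x)"
      using has_derivative_compose[OF f g] by simp
  next
    fix v
    have "Ck k U (\<lambda>x. deriv_at g (f x) b)" for b
      using Suc.IH[OF Suc.prems(1,2) Ck_Suc_imp_Ck[OF Suc.prems(1,3)] Ck_SucD(2)[OF Suc.prems(2,4)] Suc.prems(5)] .
    moreover have "Ck k U (\<lambda>x. deriv_at f x v \<bullet> b)" for b
      by (rule Ck_inner_left[OF Suc.prems(1) Ck_SucD(2)[OF Suc.prems(1,3)]])
    ultimately show "Ck k U (\<lambda>x. ?D x v)"
      by (intro Ck_sum Ck_scaleR Suc.prems(1))
  qed
qed

section \<open>Straightening a function\<close>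

text \<open>The change of coordinates with \<open>u\<close> in place of the coordinate \<open>c\<close>. Inverting it near a point
  where \<open>u\<close> has a nonzero derivative in the direction \<open>c\<close> is the implicit function theorem for \<open>u\<close>.\<close>

definition replace_coord :: "('a::euclidean_space \<Rightarrow> real) \<Rightarrow> 'a \<Rightarrow> 'a \<Rightarrow> 'a"
  where "replace_coord u c x = x + (u x - x \<bullet> c) *\<^sub>R c"

lemma replace_coord_inner:
  assumes "c \<in> Basis" "b \<in> Basis"
  shows "replace_coord u c x \<bullet> b = (if b = c then u x else x \<bullet> b)"
  using assms by (auto simp: replace_coord_def inner_add_left inner_Basis algebra_simps)

definition coords :: "'a::euclidean_space set \<Rightarrow> 'a set"
  where "coords S = {x. \<forall>b\<in>Basis - S. x \<bullet> b = 0}"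

lemma derivative_inner_eq:
  fixes b :: "'a::euclidean_space"
  assumes "open W" "w \<in> W" "(\<psi> has_derivative \<psi>') (at w)" "\<And>x. x \<in> W \<Longrightarrow> \<psi> x \<bullet> b = x \<bullet> b'"
  shows "\<psi>' v \<bullet> b = v \<bullet> b'"
proof -
  have "((\<lambda>x. \<psi> x \<bullet> b) has_derivative (\<lambda>v. \<psi>' v \<bullet> b)) (at w)"
    using has_derivative_inner_left[OF assms(3)] .
  moreover have "((\<lambda>x. \<psi> x \<bullet> b) has_derivative (\<lambda>v. v \<bullet> b')) (at w)"
    by (rule has_derivative_transform_within_open[OF _ assms(1,2), of "\<lambda>x. x \<bullet> b'"])
       (auto simp: assms(4) intro!: derivative_eq_intros)
  ultimately show ?thesis using has_derivative_unique by metis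
qed

text \<open>Old coordinates live on \<open>V\<close>, new ones on \<open>W\<close>, and \<open>\<psi>\<close> leads back from the new to the old ones.
  Only one coordinate changes, so everything known about the other coordinates survives; all
  reductions of dimension below consist of steps of this kind.\<close>

locale straightening =
  fixes k :: nat and U :: "'a::euclidean_space set" and u :: "'a \<Rightarrow> real" and c :: 'a
    and V W :: "'a set" and \<psi> :: "'a \<Rightarrow> 'a"
  assumes open_U: "open U" and Ck_u: "Ck k U u" and k1: "1 \<le> k" and c_Basis: "c \<in> Basis"
    and open_V: "open V" and V_sub: "V \<subseteq> U"
    and open_W: "open W" and Ck_psi: "Ck k W \<psi>" and psi_V: "\<psi> ` W \<subseteq> V"
    and psi_replace: "\<And>x. x \<in> V \<Longrightarrow> replace_coord u c x \<in> W \<and> \<psi> (replace_coord u c x) = x"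
    and replace_psi: "\<And>w. w \<in> W \<Longrightarrow> replace_coord u c (\<psi> w) = w"
begin

text \<open>The part of \<open>A\<close> inside \<open>V\<close>, seen in the new coordinates.\<close>

definition push :: "'a set \<Rightarrow> 'a set"
  where "push A = replace_coord u c ` (A \<inter> V)"

lemma psi_U: "\<psi> ` W \<subseteq> U"
  using psi_V V_sub by blast

lemma psi_inner: "w \<in> W \<Longrightarrow> b \<in> Basis \<Longrightarrow> b \<noteq> c \<Longrightarrow> \<psi> w \<bullet> b = w \<bullet> b"
  using replace_coord_inner[OF c_Basis, of b u "\<psi> w"] replace_psi by simp

lemma u_psi: "w \<in> W \<Longrightarrow> u (\<psi> w) = w \<bullet> c"
  using replace_coord_inner[OF c_Basis c_Basis, of u "\<psi> w"] replace_psi by simp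

lemma push_sub: "push A \<subseteq> W"
  unfolding push_def using psi_replace by blast

lemma psi_push: "\<psi> ` push A = A \<inter> V"
  unfolding push_def using psi_replace by force

lemma pushD: "w \<in> push A \<Longrightarrow> \<psi> w \<in> A"
  using psi_push by blast

lemma push_coords: "A \<subseteq> coords S \<Longrightarrow> c \<in> S \<Longrightarrow> push A \<subseteq> coords S"
  unfolding push_def by (auto simp: coords_def replace_coord_inner[OF c_Basis])

lemma push_coords_zero:
  assumes "A \<subseteq> coords S" "\<And>a. a \<in> A \<Longrightarrow> u a = 0"
  shows "push A \<subseteq> coords (S - {c})"
proof
  fix w assume "w \<in> push A"
  then obtain x where x: "x \<in> A" "w = replace_coord u c x" unfolding push_def by blast
  have "w \<bullet> b = 0" if "b \<in> Basis - (S - {c})" for b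
    using x assms(2)[OF x(1)] subsetD[OF assms(1) x(1)] that
    by (cases "b = c") (auto simp: coords_def replace_coord_inner[OF c_Basis])
  then show "w \<in> coords (S - {c})" by (simp add: coords_def)
qed

lemma Ck_comp: "Ck k U g \<Longrightarrow> Ck k W (\<lambda>w. g (\<psi> w))"
  using Ck_compose[OF open_W open_U Ck_psi _ psi_U] .

lemma psi_derivative: "w \<in> W \<Longrightarrow> (\<psi> has_derivative deriv_at \<psi> w) (at w)"
  using Ck_has_derivative[OF open_W Ck_psi k1] .

lemma deriv_comp:
  assumes "Ck k U g" "w \<in> W"
  shows "deriv_at (\<lambda>w. g (\<psi> w)) w v = deriv_at g (\<psi> w) (deriv_at \<psi> w v)"
proof -
  have "\<psi> w \<in> U" using psi_U assms(2) by blast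
  from has_derivative_compose[OF psi_derivative[OF assms(2)] Ck_has_derivative[OF open_U assms(1) k1 this]]
  show ?thesis using frechet_derivative_at by metis
qed

lemma deriv_psi_inner:
  assumes "w \<in> W" "b \<in> Basis" "b \<noteq> c"
  shows "deriv_at \<psi> w v \<bullet> b = v \<bullet> b"
  by (rule derivative_inner_eq[OF open_W assms(1) psi_derivative[OF assms(1)]])
     (rule psi_inner[OF _ assms(2,3)])

lemma deriv_u_psi:
  assumes "w \<in> W"
  shows "deriv_at u (\<psi> w) (deriv_at \<psi> w v) = v \<bullet> c"
proof -
  have "((\<lambda>w. w \<bullet> c) has_derivative (\<lambda>v. v \<bullet> c)) (at w)"
    by (auto intro!: derivative_eq_intros)
  then have "((\<lambda>w. u (\<psi> w)) has_derivative (\<lambda>v. v \<bullet> c)) (at w)"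
    by (rule has_derivative_transform_within_open[OF _ open_W assms]) (simp add: u_psi)
  then have "deriv_at (\<lambda>w. u (\<psi> w)) w v = v \<bullet> c" using frechet_derivative_at by metis
  then show ?thesis using deriv_comp[OF Ck_u assms] by simp
qed

lemma deriv_psi_coords:
  assumes "w \<in> W" "v \<in> coords S" "c \<in> S"
  shows "deriv_at \<psi> w v \<in> coords S"
proof -
  have "deriv_at \<psi> w v \<bullet> b = 0" if "b \<in> Basis - S" for b
  proof -
    have "b \<noteq> c" using that assms(3) by blast
    then show ?thesis using deriv_psi_inner[OF assms(1), of b v] that assms(2) by (simp add: coords_def)
  qed
  then show ?thesis by (simp add: coords_def)
qed

text \<open>A direction tangent to the level sets of \<open>u\<close> becomes, in the new coordinates, the same direction
  with its \<open>c\<close>-coordinate deleted.\<close>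

lemma deriv_psi_tangent:
  assumes "w \<in> W" "deriv_at u (\<psi> w) v = 0"
  shows "deriv_at \<psi> w (v - (v \<bullet> c) *\<^sub>R c) = v"
proof -
  let ?x = "\<psi> w"
  have xV: "?x \<in> V" using psi_V assms(1) by blast
  have ux: "(u has_derivative deriv_at u ?x) (at ?x)"
    using Ck_has_derivative[OF open_U Ck_u k1] xV V_sub by blast
  have R: "(replace_coord u c has_derivative (\<lambda>v. v + (deriv_at u ?x v - v \<bullet> c) *\<^sub>R c)) (at ?x)"
    unfolding replace_coord_def
    by (auto intro!: derivative_eq_intros ux simp: fun_eq_iff algebra_simps)
  have "(\<psi> has_derivative deriv_at \<psi> w) (at (replace_coord u c ?x))"
    using psi_derivative[OF assms(1)] replace_psi[OF assms(1)] by simp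
  from has_derivative_compose[OF R this]
  have "((\<lambda>x. \<psi> (replace_coord u c x)) has_derivative
      (\<lambda>v. deriv_at \<psi> w (v + (deriv_at u ?x v - v \<bullet> c) *\<^sub>R c))) (at ?x)" .
  then have "((\<lambda>x. x) has_derivative (\<lambda>v. deriv_at \<psi> w (v + (deriv_at u ?x v - v \<bullet> c) *\<^sub>R c))) (at ?x)"
    by (rule has_derivative_transform_within_open[OF _ open_V xV]) (use psi_replace in simp)
  then have "(\<lambda>v. deriv_at \<psi> w (v + (deriv_at u ?x v - v \<bullet> c) *\<^sub>R c)) = (\<lambda>v. v)"
    by (rule has_derivative_unique) (rule has_derivative_ident)
  from fun_cong[OF this, of v] show ?thesis using assms(2) by simp
qed

end

text \<open>The inverse function theorem yields an inverse \<open>\<psi>\<close> with a derivative at each point. This derivative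
  is \<open>E\<close> at \<open>\<psi> w\<close>, a rational expression in the first derivatives of \<open>u\<close>, which are of class \<open>C^(k-1)\<close>.
  So if \<open>\<psi>\<close> is of class \<open>C^j\<close> with \<open>j < k\<close> then so is its derivative, and \<open>\<psi>\<close> reaches class \<open>C^k\<close>.\<close>

lemma straightening_exists:
  fixes u :: "'a::euclidean_space \<Rightarrow> real"
  assumes "open U" "Ck k U u" "1 \<le> k" "a \<in> U" "c \<in> Basis" "deriv_at u a c \<noteq> 0"
  obtains V W \<psi> where "a \<in> V" "straightening k U u c V W \<psi>"
proof -
  define U0 where "U0 = {x \<in> U. deriv_at u x c \<noteq> 0}"
  obtain k' where k': "k = Suc k'" using assms(3) by (cases k) auto
  have cont: "continuous_on U (\<lambda>x. deriv_at u x v)" for v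
    using Ck_imp_continuous_on[OF assms(1) Ck_SucD(2)[OF assms(1)]] assms(2) unfolding k' .
  have oU0: "open U0"
    unfolding U0_def
    using continuous_open_preimage[OF cont assms(1), of "- {0}"]
    by (auto simp: vimage_def Int_def open_Compl)
  have ud: "(u has_derivative deriv_at u x) (at x)" if "x \<in> U" for x
    using Ck_has_derivative assms that by blast
  define F where "F = replace_coord u c"
  define D where "D x v = v + (deriv_at u x v - v \<bullet> c) *\<^sub>R c" for x v
  define E where "E x v = v + ((v \<bullet> c - deriv_at u x v) * inverse (deriv_at u x c)) *\<^sub>R c" for x v
  have Fd: "(F has_derivative D x) (at x)" if "x \<in> U" for x
    unfolding F_def replace_coord_def D_def
    by (auto intro!: derivative_eq_intros ud[OF that] simp: fun_eq_iff algebra_simps)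
  have blu: "linear (deriv_at u x)" if "x \<in> U" for x
    using has_derivative_linear[OF ud[OF that]] .
  have blD: "bounded_linear (D x)" if "x \<in> U" for x
    using has_derivative_bounded_linear[OF Fd[OF that]] .
  have cc: "c \<bullet> c = 1" using assms(5) by simp
  have ED: "E x (D x v) = v" if "x \<in> U0" for x v
  proof -
    have "x \<in> U" "deriv_at u x c \<noteq> 0" using that by (auto simp: U0_def)
    moreover have "deriv_at u x (D x v) = deriv_at u x v + (deriv_at u x v - v \<bullet> c) * deriv_at u x c"
      using blu[OF \<open>x \<in> U\<close>] by (simp add: D_def linear_add linear_scale)
    moreover have "D x v \<bullet> c = deriv_at u x v" by (simp add: D_def inner_add_left cc)
    ultimately have "(D x v \<bullet> c - deriv_at u x (D x v)) * inverse (deriv_at u x c) = - (deriv_at u x v - v \<bullet> c)"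
      by (simp add: field_simps)
    then have "E x (D x v) = D x v + (- (deriv_at u x v - v \<bullet> c)) *\<^sub>R c" unfolding E_def by presburger
    then show ?thesis by (simp add: D_def scaleR_left_diff_distrib)
  qed
  have DE: "D x (E x v) = v" if "x \<in> U0" for x v
  proof -
    have "x \<in> U" "deriv_at u x c \<noteq> 0" using that by (auto simp: U0_def)
    moreover have "deriv_at u x (E x v) = deriv_at u x v + (v \<bullet> c - deriv_at u x v) * inverse (deriv_at u x c) * deriv_at u x c"
      using blu[OF \<open>x \<in> U\<close>] by (simp add: E_def linear_add linear_scale)
    ultimately have 1: "deriv_at u x (E x v) = v \<bullet> c" by (simp add: field_simps)
    have "E x v \<bullet> c = v \<bullet> c + (v \<bullet> c - deriv_at u x v) * inverse (deriv_at u x c)"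
      by (simp add: E_def inner_add_left cc)
    then have "deriv_at u x (E x v) - E x v \<bullet> c = - ((v \<bullet> c - deriv_at u x v) * inverse (deriv_at u x c))"
      by (simp add: 1)
    then have "D x (E x v) = E x v - ((v \<bullet> c - deriv_at u x v) * inverse (deriv_at u x c)) *\<^sub>R c"
      unfolding D_def by simp
    then show ?thesis by (simp add: E_def)
  qed
  have aU0: "a \<in> U0" using assms by (simp add: U0_def)
  have blE: "bounded_linear (E a)"
    unfolding E_def using has_derivative_bounded_linear[OF ud[OF assms(4)]]
    by (intro bounded_linear_intros) 
  define F' where "F' x = Blinfun (D x)" for x
  have F': "blinfun_apply (F' x) = D x" if "x \<in> U0" for x
    using that blD unfolding F'_def by (intro bounded_linear_Blinfun_apply) (auto simp: U0_def)
  have contF': "continuous_on U0 F'"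
  proof (rule continuous_on_blinfun_componentwise)
    fix i :: 'a assume "i \<in> Basis"
    have "continuous_on U0 (\<lambda>x. D x i)"
      unfolding D_def by (intro continuous_intros continuous_on_subset[OF cont]) (auto simp: U0_def)
    then show "continuous_on U0 (\<lambda>x. F' x i)" using F' by (simp cong: continuous_on_cong)
  qed
  have inv: "Blinfun (E a) o\<^sub>L F' a = id_blinfun"
    by (rule blinfun_eqI) (simp add: F'[OF aU0] bounded_linear_Blinfun_apply[OF blE] ED[OF aU0])
  obtain V W \<psi> \<psi>' where *: "open V" "V \<subseteq> U0" "a \<in> V" "open W" "F a \<in> W" "homeomorphism V W F \<psi>"
    "\<And>y. y \<in> W \<Longrightarrow> (\<psi> has_derivative (\<psi>' y)) (at y)"
    "\<And>y. y \<in> W \<Longrightarrow> \<psi>' y = inv (blinfun_apply (F' (\<psi> y)))"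
  proof (rule inverse_function_theorem[OF oU0 _ contF' aU0 inv])
    show "(F has_derivative blinfun_apply (F' x)) (at x)" if "x \<in> U0" for x
      using Fd[of x] F'[OF that] that by (simp add: U0_def)
  qed (rule that)
  have \<psi>W: "\<psi> w \<in> V" "F (\<psi> w) = w" if "w \<in> W" for w
    using *(6) that by (auto simp: homeomorphism_def)
  have \<psi>d: "(\<psi> has_derivative E (\<psi> w)) (at w)" if "w \<in> W" for w
  proof -
    have "\<psi> w \<in> U0" using \<psi>W that *(2) by blast
    then have "inv (D (\<psi> w)) = E (\<psi> w)"
      by (intro inv_unique_comp) (auto simp: fun_eq_iff DE ED)
    then show ?thesis using *(7,8)[OF that] F'[OF \<open>\<psi> w \<in> U0\<close>] by simp
  qed
  have "Ck j W \<psi>" if "j \<le> k" for j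
    using that
  proof (induction j)
    case 0
    have "continuous_on W \<psi>" using *(6) by (simp add: homeomorphism_def)
    then show ?case by simp
  next
    case (Suc j)
    then have IH: "Ck j W \<psi>" by simp
    have comp: "Ck j W (\<lambda>w. deriv_at u (\<psi> w) v)" for v
    proof (rule Ck_compose[OF *(4) oU0 IH])
      have "Ck k' U (\<lambda>x. deriv_at u x v)" using assms(1,2) k' Ck_SucD(2) by blast
      then show "Ck j U0 (\<lambda>x. deriv_at u x v)"
        using Ck_mono[OF assms(1), of k'] Suc.prems k' Ck_subset[OF assms(1) _ oU0] by (auto simp: U0_def)
      show "\<psi> ` W \<subseteq> U0" using \<psi>W *(2) by blast
    qed
    have "Ck j W (\<lambda>w. E (\<psi> w) v)" for v
      unfolding E_def
      using \<psi>W(1) *(2)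
      by (intro Ck_add Ck_const Ck_scaleR Ck_mult Ck_diff Ck_inverse comp *(4)) (auto simp: U0_def)
    then show ?case using \<psi>d *(4) by (intro Ck_SucI[of W \<psi> "\<lambda>w. E (\<psi> w)"])
  qed
  then have "Ck k W \<psi>" by simp
  moreover have "replace_coord u c x \<in> W \<and> \<psi> (replace_coord u c x) = x" if "x \<in> V" for x
    using *(6) that by (auto simp: homeomorphism_def F_def)
  moreover have "V \<subseteq> U" using *(2) by (auto simp: U0_def)
  ultimately show thesis
    using that[of V W \<psi>] *(1,3,4) \<psi>W assms(1,2,3,5)
    by (simp add: F_def image_subset_iff straightening_def)
qed

section \<open>Countable covers by pieces\<close>

definition covered_by :: "('a set \<Rightarrow> bool) \<Rightarrow> 'a set \<Rightarrow> bool"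
  where "covered_by P A \<longleftrightarrow> (\<exists>\<A>. countable \<A> \<and> A \<subseteq> \<Union>\<A> \<and> (\<forall>A'\<in>\<A>. P A'))"

lemma covered_byI: "countable \<A> \<Longrightarrow> A \<subseteq> \<Union>\<A> \<Longrightarrow> (\<And>A'. A' \<in> \<A> \<Longrightarrow> P A') \<Longrightarrow> covered_by P A"
  unfolding covered_by_def by blast

lemma covered_by_mono:
  "covered_by P A \<Longrightarrow> B \<subseteq> A \<Longrightarrow> (\<And>A'. P A' \<Longrightarrow> Q A') \<Longrightarrow> covered_by Q B"
  unfolding covered_by_def by (meson subset_trans)

lemma covered_by_UN:
  assumes "countable I" "\<And>i. i \<in> I \<Longrightarrow> covered_by P (A i)"
  shows "covered_by P (\<Union>i\<in>I. A i)"
proof -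
  have "\<forall>i\<in>I. \<exists>\<A>. countable \<A> \<and> A i \<subseteq> \<Union>\<A> \<and> (\<forall>A'\<in>\<A>. P A')"
    using assms(2) unfolding covered_by_def by blast
  from bchoice[OF this] obtain \<A> where
    *: "\<forall>i\<in>I. countable (\<A> i) \<and> A i \<subseteq> \<Union>(\<A> i) \<and> (\<forall>A'\<in>\<A> i. P A')" ..
  show ?thesis
  proof (rule covered_byI[of "\<Union>i\<in>I. \<A> i"])
    show "countable (\<Union>i\<in>I. \<A> i)" using * by (intro countable_UN assms(1)) simp
    show "(\<Union>i\<in>I. A i) \<subseteq> \<Union>(\<Union>i\<in>I. \<A> i)" using * by fastforce
  qed (use * in auto)
qed

lemma covered_by_Un:
  assumes "covered_by P A" "covered_by P B"
  shows "covered_by P (A \<union> B)"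
  using covered_by_UN[of "{True, False}" P "\<lambda>i. if i then A else B"] assms by (auto simp: Un_commute)

text \<open>Lindelof's theorem makes a countable cover out of local ones.\<close>

lemma covered_by_local:
  fixes A :: "'a::second_countable_topology set"
  assumes "\<And>a. a \<in> A \<Longrightarrow> \<exists>V. open V \<and> a \<in> V \<and> covered_by P (A \<inter> V)"
  shows "covered_by P A"
proof -
  have "\<forall>a\<in>A. \<exists>V. open V \<and> a \<in> V \<and> covered_by P (A \<inter> V)" using assms by simp
  from bchoice[OF this] obtain V
    where V: "\<forall>a\<in>A. open (V a) \<and> a \<in> V a \<and> covered_by P (A \<inter> V a)" ..
  obtain \<F> where \<F>: "\<F> \<subseteq> V ` A" "countable \<F>" "\<Union>\<F> = \<Union>(V ` A)"
    using Lindelof[of "V ` A"] V by (metis (mono_tags, lifting) imageE)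
  have "covered_by P (\<Union>F\<in>\<F>. A \<inter> F)"
  proof (intro covered_by_UN \<F>(2))
    fix F assume "F \<in> \<F>"
    then obtain a where "a \<in> A" "F = V a" using \<F>(1) by blast
    then show "covered_by P (A \<inter> F)" using V by simp
  qed
  moreover have "A \<subseteq> (\<Union>F\<in>\<F>. A \<inter> F)" using \<F>(3) V by blast
  ultimately show ?thesis by (rule covered_by_mono)
qed

section \<open>Coordinate subspaces and anisotropic estimates\<close>

text \<open>Distances are measured at two scales: \<open>\<tau>\<close> in the coordinates \<open>Y\<close>, which are parameters, and \<open>\<rho>\<close>
  in the other ones.\<close>

definition near :: "'a::euclidean_space set \<Rightarrow> real \<Rightarrow> real \<Rightarrow> 'a \<Rightarrow> 'a \<Rightarrow> bool"
  where "near Y \<tau> \<rho> x b \<longleftrightarrow>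
    (\<forall>i\<in>Y. \<bar>(x - b) \<bullet> i\<bar> \<le> \<tau>) \<and> (\<forall>i\<in>Basis - Y. \<bar>(x - b) \<bullet> i\<bar> \<le> \<rho>)"

text \<open>Along the parameters nothing better than a Lipschitz estimate can be expected, hence the first
  power of \<open>\<tau>\<close>; the flatness of order \<open>k\<close> concerns the other coordinates.\<close>

definition aniso_bound ::
  "'a::euclidean_space set \<Rightarrow> 'a set \<Rightarrow> 'a set \<Rightarrow> nat \<Rightarrow> real \<Rightarrow> real \<Rightarrow> ('a \<Rightarrow> 'b::real_normed_vector) \<Rightarrow> bool"
  where "aniso_bound Y D B k C K h \<longleftrightarrow>
    (\<exists>\<delta>>0. \<forall>b\<in>B. \<forall>x\<in>D. \<forall>\<tau> \<rho>. 0 \<le> \<tau> \<and> \<tau> \<le> \<delta> \<and> 0 \<le> \<rho> \<and> \<rho> \<le> \<delta> \<and> near Y \<tau> \<rho> x b \<longrightarrow>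
       norm (h x - h b) \<le> C * \<tau> + K * \<rho> ^ k)"

text \<open>The set \<open>T\<close> stands for the dimension of a piece, \<open>S\<close> for the full dimension. In full dimension
  \<open>K\<close> may be any positive number, so that the estimate is \<open>o(\<rho>^k)\<close>; otherwise only \<open>O(\<rho>^k)\<close> is
  demanded. It matters that \<open>C\<close> is chosen before \<open>K\<close>: the sum of the powers of the diameters in
  \<open>order_flat_image_null\<close> contains a power of \<open>C\<close>, and it has to tend to zero with \<open>K\<close>.\<close>

definition order_flat ::
  "'a::euclidean_space set \<Rightarrow> 'a set \<Rightarrow> 'a set \<Rightarrow> 'a set \<Rightarrow> 'a set \<Rightarrow> nat \<Rightarrow> ('a \<Rightarrow> 'b::real_normed_vector) \<Rightarrow> bool"
  where "order_flat Y S T D B k h \<longleftrightarrow>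
    (\<exists>C\<ge>0. \<exists>K0\<ge>0. \<forall>K>0. K0 \<le> K \<or> T = S \<longrightarrow> aniso_bound Y D B k C K h)"

lemma order_flat_proper:
  assumes "order_flat Y S' T D B k h" "T \<noteq> S"
  shows "order_flat Y S T D B k h"
  using assms unfolding order_flat_def by blast

text \<open>Finitely many functions admit common constants.\<close>

lemma order_flat_common:
  assumes "finite I" "\<And>i. i \<in> I \<Longrightarrow> order_flat Y S T D B k (h i)"
  obtains C K0 where "0 \<le> C" "0 \<le> K0"
    "\<And>K. 0 < K \<Longrightarrow> K0 \<le> K \<or> T = S \<Longrightarrow>
      \<exists>\<delta>>0. \<forall>i\<in>I. \<forall>b\<in>B. \<forall>x\<in>D. \<forall>\<tau> \<rho>. 0 \<le> \<tau> \<and> \<tau> \<le> \<delta> \<and> 0 \<le> \<rho> \<and> \<rho> \<le> \<delta> \<and> near Y \<tau> \<rho> x b \<longrightarrow>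
        norm (h i x - h i b) \<le> C * \<tau> + K * \<rho> ^ k"
proof -
  have "\<forall>i\<in>I. \<exists>p. 0 \<le> fst p \<and> 0 \<le> snd p \<and> (\<forall>K>0. snd p \<le> K \<or> T = S \<longrightarrow>
      aniso_bound Y D B k (fst p) K (h i))"
    using assms(2) unfolding order_flat_def by (metis fst_conv snd_conv)
  from bchoice[OF this] obtain p where p: "\<forall>i\<in>I. 0 \<le> fst (p i) \<and> 0 \<le> snd (p i) \<and>
      (\<forall>K>0. snd (p i) \<le> K \<or> T = S \<longrightarrow> aniso_bound Y D B k (fst (p i)) K (h i))" ..
  define C where "C = (\<Sum>i\<in>I. fst (p i))"
  define K0 where "K0 = (\<Sum>i\<in>I. snd (p i))"
  have Ci: "fst (p i) \<le> C" and K0i: "snd (p i) \<le> K0" if "i \<in> I" for i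
    unfolding C_def K0_def using p that assms(1) by (auto intro: member_le_sum)
  show thesis
  proof (rule that)
    show "0 \<le> C" "0 \<le> K0" unfolding C_def K0_def using p by (auto intro: sum_nonneg)
    fix K :: real assume K: "0 < K" "K0 \<le> K \<or> T = S"
    let ?est = "\<lambda>C \<delta> i. \<forall>b\<in>B. \<forall>x\<in>D. \<forall>\<tau> \<rho>. 0 \<le> \<tau> \<and> \<tau> \<le> \<delta> \<and> 0 \<le> \<rho> \<and> \<rho> \<le> \<delta> \<and> near Y \<tau> \<rho> x b \<longrightarrow>
      norm (h i x - h i b) \<le> C * \<tau> + K * \<rho> ^ k"
    have "\<forall>i\<in>I. aniso_bound Y D B k (fst (p i)) K (h i)" using p K K0i by (meson order_trans)
    then have "\<forall>i\<in>I. \<exists>\<delta>>0. ?est (fst (p i)) \<delta> i" unfolding aniso_bound_def .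
    from bchoice[OF this] obtain \<delta> where \<delta>: "\<forall>i\<in>I. 0 < \<delta> i \<and> ?est (fst (p i)) (\<delta> i) i" ..
    define d where "d = Min (insert 1 (\<delta> ` I))"
    have d: "0 < d" "\<And>i. i \<in> I \<Longrightarrow> d \<le> \<delta> i" using \<delta> assms(1) by (auto simp: d_def)
    have "?est C d i" if i: "i \<in> I" for i
    proof (intro ballI allI impI)
      fix b x \<tau> \<rho>
      assume *: "b \<in> B" "x \<in> D" "0 \<le> \<tau> \<and> \<tau> \<le> d \<and> 0 \<le> \<rho> \<and> \<rho> \<le> d \<and> near Y \<tau> \<rho> x b"
      then have "\<tau> \<le> \<delta> i" "\<rho> \<le> \<delta> i" using d(2)[OF i] by auto
      then have "norm (h i x - h i b) \<le> fst (p i) * \<tau> + K * \<rho> ^ k" using \<delta> i * by blast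
      also have "\<dots> \<le> C * \<tau> + K * \<rho> ^ k" using Ci[OF i] * by (intro add_right_mono mult_right_mono) auto
      finally show "norm (h i x - h i b) \<le> C * \<tau> + K * \<rho> ^ k" .
    qed
    then show "\<exists>\<delta>>0. \<forall>i\<in>I. ?est C \<delta> i" using d(1) by blast
  qed
qed

text \<open>Only the derivative in the direction of the segment enters; a bound by the norm of the derivative would
  not distinguish the two kinds of directions.\<close>

lemma mean_value_segment:
  fixes h :: "'a::euclidean_space \<Rightarrow> real"
  assumes "\<And>t. 0 \<le> t \<Longrightarrow> t \<le> 1 \<Longrightarrow> (h has_derivative h' (b + t *\<^sub>R v)) (at (b + t *\<^sub>R v))"
  obtains t where "0 \<le> t" "t \<le> 1" "\<bar>h (b + v) - h b\<bar> \<le> \<bar>h' (b + t *\<^sub>R v) v\<bar>"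
proof -
  let ?g = "\<lambda>t::real. h (b + t *\<^sub>R v)"
  have d: "(?g has_derivative (\<lambda>s. s * h' (b + t *\<^sub>R v) v)) (at t within {0..1})" if t: "0 \<le> t" "t \<le> 1" for t
  proof -
    have "((\<lambda>t. b + t *\<^sub>R v) has_derivative (\<lambda>s. s *\<^sub>R v)) (at t within {0..1})"
      by (auto intro!: derivative_eq_intros)
    from has_derivative_compose[OF this assms[OF t]]
    have "(?g has_derivative (\<lambda>s. h' (b + t *\<^sub>R v) (s *\<^sub>R v))) (at t within {0..1})" .
    moreover have "h' (b + t *\<^sub>R v) (s *\<^sub>R v) = s * h' (b + t *\<^sub>R v) v" for s
      using has_derivative_linear[OF assms[OF t]] by (simp add: linear_scale)
    ultimately show ?thesis by simp
  qed
  have "continuous_on {0..1} ?g"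
    by (intro has_derivative_continuous_on[OF d]) auto
  moreover have "(?g has_derivative (\<lambda>s. s * h' (b + t *\<^sub>R v) v)) (at t)" if "0 < t" "t < 1" for t
    using d[of t] that at_within_interior[of t "{0..1::real}"] by simp
  ultimately obtain t where "t \<in> {0<..<1}" "norm (?g 1 - ?g 0) \<le> norm ((1 - 0) * h' (b + t *\<^sub>R v) v)"
    using mvt_general[of 0 1 ?g "\<lambda>t s. s * h' (b + t *\<^sub>R v) v"] by auto
  then show thesis by (intro that[of t]) auto
qed

lemma derivative_bounded_on_compact:
  fixes h :: "'a::euclidean_space \<Rightarrow> 'b::real_normed_vector"
  assumes "open W" "Ck 1 W h" "compact X" "X \<subseteq> W"
  obtains L where "0 \<le> L" "\<And>x v. x \<in> X \<Longrightarrow> norm (deriv_at h x v) \<le> L * (\<Sum>i\<in>Basis. \<bar>v \<bullet> i\<bar>)"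
proof -
  have "\<exists>L. \<forall>x\<in>X. norm (deriv_at h x i) \<le> L" for i
  proof -
    have "continuous_on W (\<lambda>x. deriv_at h x i)"
      using Ck_SucD(2)[OF assms(1), of 0] assms(2) by simp
    then have "compact ((\<lambda>x. deriv_at h x i) ` X)"
      by (intro compact_continuous_image continuous_on_subset[OF _ assms(4)] assms(3))
    then have "bounded ((\<lambda>x. deriv_at h x i) ` X)" by (rule compact_imp_bounded)
    then show ?thesis unfolding bounded_iff by blast
  qed
  then obtain M where M: "\<And>i x. x \<in> X \<Longrightarrow> norm (deriv_at h x i) \<le> M i" by metis
  define L where "L = (\<Sum>i\<in>Basis. \<bar>M i\<bar>)"
  have "norm (deriv_at h x v) \<le> L * (\<Sum>i\<in>Basis. \<bar>v \<bullet> i\<bar>)" if x: "x \<in> X" for x v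
  proof -
    have "x \<in> W" using x assms by blast
    have "linear (deriv_at h x)"
      using has_derivative_linear[OF Ck_has_derivative[OF assms(1,2) _ \<open>x \<in> W\<close>]] by simp
    then have "norm (deriv_at h x v) = norm (\<Sum>i\<in>Basis. (v \<bullet> i) *\<^sub>R deriv_at h x i)"
      using linear_expand_Basis by metis
    also have "\<dots> \<le> (\<Sum>i\<in>Basis. \<bar>v \<bullet> i\<bar> * L)"
    proof (rule sum_norm_le)
      fix i :: 'a assume i: "i \<in> Basis"
      have "norm (deriv_at h x i) \<le> L"
        using M[OF x, of i] member_le_sum[OF i, of "\<lambda>i. \<bar>M i\<bar>"] by (simp add: L_def)
      then show "norm ((v \<bullet> i) *\<^sub>R deriv_at h x i) \<le> \<bar>v \<bullet> i\<bar> * L"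
        by (simp add: mult_left_mono)
    qed
    also have "\<dots> = L * (\<Sum>i\<in>Basis. \<bar>v \<bullet> i\<bar>)" by (simp add: sum_distrib_left mult.commute)
    finally show ?thesis .
  qed
  moreover have "0 \<le> L" by (simp add: L_def sum_nonneg)
  ultimately show thesis using that by blast
qed

section \<open>Decomposition into flat pieces\<close>

text \<open>A piece of a \<open>C^1\<close> surface, parametrised by a box in \<open>coords T\<close>. The parametrisation keeps the
  coordinates in \<open>Y\<close> and those outside \<open>S\<close>. Having \<open>\<psi>\<close> on a
  neighbourhood of the full box makes its derivatives bounded there. The set of interest is the
  image of \<open>B\<close>, but estimates are needed between points of \<open>B\<close> and arbitrary points of the box,
  since they are integrated along segments in it.\<close>

definition patch ::
  "'a::euclidean_space set \<Rightarrow> 'a set \<Rightarrow> 'a set \<Rightarrow> 'a set \<Rightarrow> 'a \<Rightarrow> 'a \<Rightarrow> ('a \<Rightarrow> 'a) \<Rightarrow> 'a set \<Rightarrow> bool"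
  where "patch U S Y T l r \<psi> B \<longleftrightarrow>
    Y \<subseteq> T \<and> T \<subseteq> S \<and> B \<subseteq> cbox l r \<inter> coords T \<and>
    (\<exists>W. open W \<and> cbox l r \<subseteq> W \<and> Ck 1 W \<psi> \<and> \<psi> ` W \<subseteq> U \<and>
       (\<forall>x\<in>W. \<forall>b\<in>Y \<union> (Basis - S). \<psi> x \<bullet> b = x \<bullet> b))"

text \<open>Walk from \<open>b\<close> to \<open>x\<close> by changing first the coordinates outside \<open>Y\<close> and then those in \<open>Y\<close>. On the
  first segment the parameters do not move, so by hypothesis the partial derivatives of \<open>f\<close> in the
  directions \<open>S - Y\<close> are at most \<open>K \<rho>^k\<close>. No other partial derivatives occur, because \<open>\<psi>\<close> keeps the
  remaining coordinates. This gives \<open>K \<rho>^(k+1)\<close> up to a constant factor. The second segment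
  contributes the Lipschitz term.\<close>

lemma order_flat_integrate:
  fixes f :: "'a::euclidean_space \<Rightarrow> real"
  assumes "open U" "Ck 1 U f" "S \<subseteq> Basis" and pt: "patch U S Y T l r \<psi> B"
    and flat: "\<And>c. c \<in> S - Y \<Longrightarrow> order_flat Y S T (cbox l r \<inter> coords T) B k (\<lambda>x. deriv_at f (\<psi> x) c)"
    and zero: "\<And>b c. b \<in> B \<Longrightarrow> c \<in> S - Y \<Longrightarrow> deriv_at f (\<psi> b) c = 0"
  shows "order_flat Y S T (cbox l r \<inter> coords T) B (Suc k) (\<lambda>x. f (\<psi> x))"
proof -
  let ?D = "cbox l r \<inter> coords T"
  have YT: "Y \<subseteq> T" "T \<subseteq> S" "B \<subseteq> ?D" using pt unfolding patch_def by auto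
  obtain W where W: "open W" "cbox l r \<subseteq> W" "Ck 1 W \<psi>" "\<psi> ` W \<subseteq> U"
    "\<And>x b. x \<in> W \<Longrightarrow> b \<in> Y \<union> (Basis - S) \<Longrightarrow> \<psi> x \<bullet> b = x \<bullet> b"
    using pt unfolding patch_def by auto
  let ?h = "\<lambda>x. f (\<psi> x)"
  have h1: "Ck 1 W ?h" using Ck_compose[OF W(1) assms(1) W(3) assms(2) W(4)] .
  obtain Lh where Lh: "0 \<le> Lh" "\<And>x v. x \<in> cbox l r \<Longrightarrow> norm (deriv_at ?h x v) \<le> Lh * (\<Sum>i\<in>Basis. \<bar>v \<bullet> i\<bar>)"
    using derivative_bounded_on_compact[OF W(1) h1 compact_cbox W(2)] by blast
  obtain L where L: "0 \<le> L" "\<And>x v. x \<in> cbox l r \<Longrightarrow> norm (deriv_at \<psi> x v) \<le> L * (\<Sum>i\<in>Basis. \<bar>v \<bullet> i\<bar>)"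
    using derivative_bounded_on_compact[OF W(1,3) compact_cbox W(2)] by blast
  have dh: "(?h has_derivative deriv_at ?h x) (at x)" if "x \<in> cbox l r" for x
    using Ck_has_derivative[OF W(1) h1] that W(2) by auto
  have d\<psi>: "(\<psi> has_derivative deriv_at \<psi> x) (at x)" if "x \<in> W" for x
    using Ck_has_derivative[OF W(1,3)] that by auto
  have df: "(f has_derivative deriv_at f x) (at x)" if "x \<in> U" for x
    using Ck_has_derivative[OF assms(1,2)] that by auto
  have keep: "deriv_at \<psi> x v \<bullet> b = v \<bullet> b" if x: "x \<in> W" and b: "b \<in> Y \<union> (Basis - S)" for x v b
    using derivative_inner_eq[OF W(1) x d\<psi>[OF x], of b b] W(5)[OF _ b] .
  have finS: "finite (S - Y)" using assms(3) finite_subset[OF _ finite_Basis] by blast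
  obtain C K1 where "0 \<le> C" and K1_0: "0 \<le> K1" and CK: "\<And>K. 0 < K \<Longrightarrow> K1 \<le> K \<or> T = S \<Longrightarrow>
      \<exists>\<delta>>0. \<forall>c\<in>S - Y. \<forall>b\<in>B. \<forall>x\<in>?D. \<forall>\<tau> \<rho>. 0 \<le> \<tau> \<and> \<tau> \<le> \<delta> \<and> 0 \<le> \<rho> \<and> \<rho> \<le> \<delta> \<and> near Y \<tau> \<rho> x b \<longrightarrow>
        norm (deriv_at f (\<psi> x) c - deriv_at f (\<psi> b) c) \<le> C * \<tau> + K * \<rho> ^ k"
    by (rule order_flat_common[of "S - Y" Y S T ?D B k "\<lambda>c x. deriv_at f (\<psi> x) c"],
        rule finS, erule flat, rule that)
  define n where "n = real DIM('a)"
  have n1: "0 \<le> n" by (simp add: n_def)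
  \<comment> \<open>\<open>n * (L * n)\<close> is the factor lost in passing from the partial derivatives to \<open>f\<close>; \<open>1\<close> is added only
    to make \<open>Q\<close> positive.\<close>
  define Q where "Q = n * (L * n) + 1"
  have Q: "Q > 0" using n1 L(1) by (simp add: Q_def add_nonneg_pos)
  have main: "aniso_bound Y ?D B (Suc k) (Lh * n) K ?h" if K: "0 < K" "Q * K1 \<le> K \<or> T = S" for K
  proof -
    define K' where "K' = K / Q"
    have K': "0 < K'" "K1 \<le> K' \<or> T = S" using K Q by (auto simp: K'_def field_simps)
    obtain d where d: "0 < d" and est: "\<And>c b x \<tau> \<rho>. c \<in> S - Y \<Longrightarrow> b \<in> B \<Longrightarrow> x \<in> ?D \<Longrightarrow>
       0 \<le> \<tau> \<and> \<tau> \<le> d \<and> 0 \<le> \<rho> \<and> \<rho> \<le> d \<and> near Y \<tau> \<rho> x b \<Longrightarrow>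
       norm (deriv_at f (\<psi> x) c - deriv_at f (\<psi> b) c) \<le> C * \<tau> + K' * \<rho> ^ k"
      using CK[OF K'] by blast
    have "norm (?h x - ?h b) \<le> Lh * n * \<tau> + K * \<rho> ^ Suc k"
      if b: "b \<in> B" and x: "x \<in> ?D" and \<tau>: "0 \<le> \<tau>" "\<tau> \<le> d" and \<rho>: "0 \<le> \<rho>" "\<rho> \<le> d"
        and nr: "near Y \<tau> \<rho> x b" for b x \<tau> \<rho>
    proof -
      have bD: "b \<in> ?D" using b YT(3) by blast
      define x1 where "x1 = (\<Sum>i\<in>Basis. (if i \<in> Y then b \<bullet> i else x \<bullet> i) *\<^sub>R i)"
      have x1i: "x1 \<bullet> i = (if i \<in> Y then b \<bullet> i else x \<bullet> i)" if "i \<in> Basis" for i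
        using that by (simp add: x1_def)
      have x1D: "x1 \<in> ?D"
        using bD x x1i by (auto simp: mem_box coords_def)
      have conv: "convex ?D"
      proof -
        have "convex (coords T)"
          by (auto simp: convex_def coords_def inner_add_left)
        then show ?thesis using convex_box(1) convex_Int by blast
      qed
      have seg: "p + t *\<^sub>R (q - p) \<in> ?D" if "p \<in> ?D" "q \<in> ?D" "0 \<le> t" "t \<le> 1" for p q and t :: real
        using convexD_alt[OF conv that] by (simp add: algebra_simps)
      have YB: "Y \<subseteq> Basis" using YT assms(3) by blast
      have nri: "i \<in> Y \<Longrightarrow> \<bar>(x - b) \<bullet> i\<bar> \<le> \<tau>" "i \<in> Basis - Y \<Longrightarrow> \<bar>(x - b) \<bullet> i\<bar> \<le> \<rho>" for i
        using nr unfolding near_def by auto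
      \<comment> \<open>moving the coordinates in \<open>Y\<close>\<close>
      obtain t where t: "0 \<le> t" "t \<le> 1" "\<bar>?h (x1 + (x - x1)) - ?h x1\<bar> \<le> \<bar>deriv_at ?h (x1 + t *\<^sub>R (x - x1)) (x - x1)\<bar>"
        using mean_value_segment[of ?h "deriv_at ?h" x1 "x - x1"] dh seg[OF x1D x] by blast
      have "\<bar>?h x - ?h x1\<bar> \<le> Lh * (\<Sum>i\<in>Basis. \<bar>(x - x1) \<bullet> i\<bar>)"
        using order_trans[OF t(3)] Lh(2) seg[OF x1D x t(1,2)] by auto
      also have "(\<Sum>i\<in>Basis. \<bar>(x - x1) \<bullet> i\<bar>) \<le> n * \<tau>"
        unfolding n_def
        by (rule sum_bounded_above) (use nri \<tau> x1i in \<open>auto simp: inner_diff_left\<close>)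
      finally have 1: "\<bar>?h x - ?h x1\<bar> \<le> Lh * n * \<tau>" using Lh(1) by (simp add: mult_left_mono mult.assoc)
      \<comment> \<open>moving the other coordinates\<close>
      obtain t where t: "0 \<le> t" "t \<le> 1" "\<bar>?h (b + (x1 - b)) - ?h b\<bar> \<le> \<bar>deriv_at ?h (b + t *\<^sub>R (x1 - b)) (x1 - b)\<bar>"
        using mean_value_segment[of ?h "deriv_at ?h" b "x1 - b"] dh seg[OF bD x1D] by blast
      define z where "z = b + t *\<^sub>R (x1 - b)"
      define w where "w = deriv_at \<psi> z (x1 - b)"
      have zD: "z \<in> ?D" using seg[OF bD x1D t(1,2)] by (simp add: z_def)
      have zW: "z \<in> W" using zD W(2) by blast
      have zU: "\<psi> z \<in> U" using zW W(4) by blast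
      have nz: "near Y 0 \<rho> z b"
      proof -
        have "\<bar>t * ((x1 - b) \<bullet> i)\<bar> \<le> \<rho>" if "i \<in> Basis - Y" for i
        proof -
          have "\<bar>t * ((x1 - b) \<bullet> i)\<bar> = t * \<bar>(x - b) \<bullet> i\<bar>"
            using that x1i t(1) by (simp add: abs_mult inner_diff_left)
          also have "\<dots> \<le> 1 * \<rho>" using nri(2)[OF that] t \<rho> by (intro mult_mono) auto
          finally show ?thesis by simp
        qed
        moreover have "(x1 - b) \<bullet> i = 0" if "i \<in> Y" for i
          using that x1i YB by (auto simp: inner_diff_left)
        ultimately show ?thesis by (simp add: near_def z_def)
      qed
      have "(?h has_derivative (\<lambda>v. deriv_at f (\<psi> z) (deriv_at \<psi> z v))) (at z)"
        using has_derivative_compose[OF d\<psi>[OF zW] df[OF zU]] .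
      then have "deriv_at ?h z = (\<lambda>v. deriv_at f (\<psi> z) (deriv_at \<psi> z v))"
        using frechet_derivative_at by metis
      then have "deriv_at ?h z (x1 - b) = deriv_at f (\<psi> z) w" by (simp add: w_def)
      also have "\<dots> = (\<Sum>c\<in>Basis. (w \<bullet> c) *\<^sub>R deriv_at f (\<psi> z) c)"
        by (rule linear_expand_Basis[OF has_derivative_linear[OF df[OF zU]]])
      also have "\<dots> = (\<Sum>c\<in>S - Y. (w \<bullet> c) *\<^sub>R deriv_at f (\<psi> z) c)"
      proof (rule sum.mono_neutral_right)
        have "w \<bullet> c = 0" if "c \<in> Basis - (S - Y)" for c
        proof -
          have c: "c \<in> Y \<union> (Basis - S)" using that by blast
          have "w \<bullet> c = (x1 - b) \<bullet> c" unfolding w_def by (rule keep[OF zW c])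
          also have "\<dots> = 0"
          proof (cases "c \<in> Y")
            case True
            then show ?thesis using YB x1i by (auto simp: inner_diff_left)
          next
            case False
            then have "c \<in> Basis - T" using c YT by blast
            then show ?thesis using x1D bD by (simp add: inner_diff_left coords_def)
          qed
          finally show ?thesis .
        qed
        then show "\<forall>c\<in>Basis - (S - Y). (w \<bullet> c) *\<^sub>R deriv_at f (\<psi> z) c = 0" by simp
      qed (use assms(3) in auto)
      finally have eq: "deriv_at ?h z (x1 - b) = (\<Sum>c\<in>S - Y. (w \<bullet> c) *\<^sub>R deriv_at f (\<psi> z) c)" .
      have "norm w \<le> L * (\<Sum>i\<in>Basis. \<bar>(x1 - b) \<bullet> i\<bar>)"
        unfolding w_def using L(2) zD by blast
      also have "(\<Sum>i\<in>Basis. \<bar>(x1 - b) \<bullet> i\<bar>) \<le> n * \<rho>"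
        unfolding n_def
        by (rule sum_bounded_above) (use nri \<rho> x1i in \<open>auto simp: inner_diff_left\<close>)
      finally have nw: "norm w \<le> L * n * \<rho>" using L(1) by (simp add: mult_left_mono mult.assoc)
      have "\<bar>deriv_at ?h z (x1 - b)\<bar> \<le> (\<Sum>c\<in>S - Y. \<bar>(w \<bullet> c) *\<^sub>R deriv_at f (\<psi> z) c\<bar>)"
        unfolding eq by (rule sum_abs)
      also have "\<dots> \<le> (\<Sum>c\<in>S - Y. (L * n * \<rho>) * (K' * \<rho> ^ k))"
      proof (rule sum_mono)
        fix c assume c: "c \<in> S - Y"
        then have "\<bar>w \<bullet> c\<bar> \<le> norm w" using assms(3) by (intro Basis_le_norm) auto
        moreover have "norm (deriv_at f (\<psi> z) c - deriv_at f (\<psi> b) c) \<le> C * 0 + K' * \<rho> ^ k"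
          by (rule est[OF c b zD]) (use nz \<rho> d in simp)
        ultimately show "\<bar>(w \<bullet> c) *\<^sub>R deriv_at f (\<psi> z) c\<bar> \<le> (L * n * \<rho>) * (K' * \<rho> ^ k)"
          using nw zero[OF b c] L(1) n1 \<rho>(1) by (auto simp: abs_mult intro!: mult_mono)
      qed
      also have "\<dots> = real (card (S - Y)) * ((L * n * \<rho>) * (K' * \<rho> ^ k))" by simp
      also have "\<dots> \<le> n * ((L * n * \<rho>) * (K' * \<rho> ^ k))"
      proof (rule mult_right_mono)
        have "card (S - Y) \<le> DIM('a)" using assms(3) by (intro card_mono) auto
        then show "real (card (S - Y)) \<le> n" by (simp add: n_def)
      qed (use L(1) n1 \<rho>(1) K'(1) in auto)
      also have "\<dots> = n * (L * n) * K' * \<rho> ^ Suc k" by simp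
      also have "\<dots> \<le> Q * K' * \<rho> ^ Suc k"
        using K'(1) \<rho>(1) by (intro mult_right_mono) (auto simp: Q_def)
      also have "\<dots> = K * \<rho> ^ Suc k" using Q by (simp add: K'_def)
      finally have "\<bar>?h x1 - ?h b\<bar> \<le> K * \<rho> ^ Suc k" using t(3) by (simp add: z_def)
      with 1 show ?thesis by simp
    qed
    then show ?thesis unfolding aniso_bound_def using d by blast
  qed
  show ?thesis unfolding order_flat_def
    by (rule exI[of _ "Lh * n"], rule conjI, simp add: Lh(1) n1, rule exI[of _ "Q * K1"])
       (use main Q K1_0 in auto)
qed

lemma near_imp_norm_le:
  fixes x b :: "'a::euclidean_space"
  assumes "near Y \<tau> \<rho> x b" "\<tau> \<le> \<delta>" "\<rho> \<le> \<delta>"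
  shows "norm (x - b) \<le> real DIM('a) * \<delta>"
proof -
  have "\<bar>(x - b) \<bullet> i\<bar> \<le> \<delta>" if "i \<in> Basis" for i
    using assms that unfolding near_def by (meson DiffI order_trans)
  then have "(\<Sum>i\<in>Basis. \<bar>(x - b) \<bullet> i\<bar>) \<le> real DIM('a) * \<delta>"
    by (intro sum_bounded_above)
  then show ?thesis using norm_le_l1 order_trans by blast
qed

text \<open>The estimate concerns all functions that vanish on \<open>A\<close>, not just on the piece \<open>A'\<close>. This is what
  makes the induction on \<open>k\<close> work: the derivatives of a function that vanishes on \<open>A\<close> vanish on
  the subset of \<open>A\<close> that is decomposed next.\<close>

definition flat_piece ::
  "nat \<Rightarrow> 'a::euclidean_space set \<Rightarrow> 'a set \<Rightarrow> 'a set \<Rightarrow> 'a set \<Rightarrow> 'a set \<Rightarrow> bool"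
  where "flat_piece k U S Y A A' \<longleftrightarrow> A' \<subseteq> A \<and>
    (\<exists>T l r \<psi> B. patch U S Y T l r \<psi> B \<and> A' = \<psi> ` B \<and>
       (\<forall>f::'a \<Rightarrow> real. Ck k U f \<and> (\<forall>a\<in>A. f a = 0) \<longrightarrow>
          order_flat Y S T (cbox l r \<inter> coords T) B k (\<lambda>x. f (\<psi> x))))"

text \<open>Order zero is uniform continuity on a compact box; it gives arbitrarily small \<open>K\<close>, as required in
  full dimension.\<close>

lemma order_flat_0:
  fixes f :: "'a::euclidean_space \<Rightarrow> real"
  assumes "continuous_on (cbox l r) f" "B \<subseteq> cbox l r"
  shows "order_flat Y S T (cbox l r \<inter> D) B 0 f"
proof -
  have "aniso_bound Y (cbox l r \<inter> D) B 0 0 K f" if K: "0 < K" for K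
  proof -
    have "uniformly_continuous_on (cbox l r) f"
      using assms(1) compact_cbox by (rule compact_uniformly_continuous)
    then obtain d where d: "0 < d" "\<And>x b. x \<in> cbox l r \<Longrightarrow> b \<in> cbox l r \<Longrightarrow> dist b x < d \<Longrightarrow> dist (f b) (f x) < K"
      using K unfolding uniformly_continuous_on_def by blast
    define n where "n = real DIM('a)"
    have n: "0 < n" by (simp add: n_def)
    have "norm (f x - f b) \<le> K"
      if "b \<in> B" "x \<in> cbox l r \<inter> D" "\<tau> \<le> d / (2 * n)" "\<rho> \<le> d / (2 * n)" "near Y \<tau> \<rho> x b" for b x \<tau> \<rho>
    proof -
      have "norm (x - b) \<le> n * (d / (2 * n))" unfolding n_def
        using near_imp_norm_le[OF that(5,3,4)] by (simp add: n_def)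
      also have "\<dots> < d" using n d(1) by simp
      finally have "dist (f b) (f x) < K"
        using d(2)[of x b] that assms(2) by (auto simp: dist_norm norm_minus_commute)
      then show ?thesis by (simp add: dist_norm norm_minus_commute)
    qed
    then show ?thesis unfolding aniso_bound_def
      by (intro exI[of _ "d / (2 * n)"]) (use n d(1) in auto)
  qed
  then show ?thesis unfolding order_flat_def by force
qed

lemma flat_pieces_0:
  assumes "open U" "Y \<subseteq> S" "A \<subseteq> U \<inter> coords S"
  shows "covered_by (flat_piece 0 U S Y A) A"
proof -
  obtain \<D> where \<D>: "countable \<D>" "\<D> \<subseteq> Pow U" "\<And>X. X \<in> \<D> \<Longrightarrow> \<exists>a b. X = cbox a b" "\<Union>\<D> = U"
    using open_countable_Union_open_cbox[OF assms(1)] by metis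
  show ?thesis
  proof (rule covered_byI[of "(\<lambda>X. A \<inter> X) ` \<D>"])
    show "A \<subseteq> \<Union>((\<lambda>X. A \<inter> X) ` \<D>)" using \<D>(4) assms(3) by blast
    fix A' assume "A' \<in> (\<lambda>X. A \<inter> X) ` \<D>"
    then obtain l r where lr: "A' = A \<inter> cbox l r" "cbox l r \<subseteq> U" using \<D>(2,3) by force
    have 1: "patch U S Y S l r (\<lambda>x. x) (A \<inter> cbox l r)"
      unfolding patch_def using assms lr(2) Ck_ident[OF assms(1)] by blast
    have 2: "order_flat Y S S (cbox l r \<inter> coords S) (A \<inter> cbox l r) 0 f" if "Ck 0 U f" for f :: "'a \<Rightarrow> real"
      using that lr(2) by (intro order_flat_0) (auto intro: continuous_on_subset)
    show "flat_piece 0 U S Y A A'"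
      unfolding flat_piece_def
      by (intro conjI exI[of _ S] exI[of _ l] exI[of _ r] exI[of _ "\<lambda>x. x"] exI[of _ A'])
         (use 1 2 lr(1) in auto)
  qed (use \<D>(1) in simp)
qed

lemma patch_compose:
  assumes "patch W (S - {c}) Y T l r \<psi>' B" "c \<in> S - Y" "Y \<subseteq> Basis" "open W" "Ck 1 W \<psi>" "\<psi> ` W \<subseteq> U"
    and keep: "\<And>w b. w \<in> W \<Longrightarrow> b \<in> Basis - {c} \<Longrightarrow> \<psi> w \<bullet> b = w \<bullet> b"
  shows "patch U S Y T l r (\<lambda>x. \<psi> (\<psi>' x)) B"
proof -
  have 1: "Y \<subseteq> T" "T \<subseteq> S - {c}" "B \<subseteq> cbox l r \<inter> coords T"
    using assms(1) unfolding patch_def by auto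
  obtain W' where W': "open W'" "cbox l r \<subseteq> W'" "Ck 1 W' \<psi>'" "\<psi>' ` W' \<subseteq> W"
    "\<And>x b. x \<in> W' \<Longrightarrow> b \<in> Y \<union> (Basis - (S - {c})) \<Longrightarrow> \<psi>' x \<bullet> b = x \<bullet> b"
    using assms(1) unfolding patch_def by auto
  have 2: "Ck 1 W' (\<lambda>x. \<psi> (\<psi>' x))"
    using Ck_compose[OF W'(1) assms(4) W'(3) assms(5) W'(4)] .
  have 3: "\<psi> (\<psi>' x) \<bullet> b = x \<bullet> b" if "x \<in> W'" "b \<in> Y \<union> (Basis - S)" for x b
  proof -
    have "\<psi>' x \<in> W" using W'(4) that(1) by blast
    moreover have "b \<in> Basis - {c}" using that(2) assms(2,3) by blast
    ultimately have "\<psi> (\<psi>' x) \<bullet> b = \<psi>' x \<bullet> b" by (rule keep)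
    also have "\<dots> = x \<bullet> b" using W'(5)[OF that(1)] that(2) by blast
    finally show ?thesis .
  qed
  show ?thesis unfolding patch_def
    using 1 2 3 W' assms(6) by (intro conjI exI[of _ W']) blast+
qed

text \<open>The lemma of A. P. Morse, in a version with parameters \<open>Y\<close>. The induction is on \<open>k\<close>, and for fixed
  \<open>k\<close> on the dimension. The points of \<open>A\<close> are of two kinds. At points of \<open>A1\<close> some \<open>C^(k+1)\<close> function
  that vanishes on \<open>A\<close> has a nonzero derivative in a direction \<open>c\<close> of \<open>S - Y\<close>; near such a point \<open>A\<close>
  lies in a hypersurface, which becomes \<open>coords (S - {c})\<close> after straightening. On \<open>A2\<close> the
  derivatives of all these functions in the directions \<open>S - Y\<close> vanish. They are of class \<open>C^k\<close>, so
  the induction hypothesis for \<open>k\<close> estimates them on suitable pieces, and \<open>order_flat_integrate\<close>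
  gains one order. The parametrisations need not be smoother than \<open>C^1\<close>, although the functions
  used for straightening lose smoothness as \<open>k\<close> decreases.\<close>

theorem flat_decomposition:
  fixes A :: "'a::euclidean_space set"
  assumes "Y \<subseteq> S" "S \<subseteq> Basis" "open U" "A \<subseteq> U \<inter> coords S"
  shows "covered_by (flat_piece k U S Y A) A"
  using assms
proof (induction k arbitrary: S U A)
  case 0
  then show ?case using flat_pieces_0 by blast
next
  case (Suc k)
  note IHk = Suc.IH
  show ?case
    using Suc.prems
  proof (induction "card S" arbitrary: S U A rule: less_induct)
    case less
    note IHS = less.hyps
    have YB: "Y \<subseteq> Basis" and finS: "finite S"
      using less.prems finite_subset[OF _ finite_Basis] by auto
    define I where "I = {u :: 'a \<Rightarrow> real. Ck (Suc k) U u \<and> (\<forall>a\<in>A. u a = 0)}"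
    define A1 where "A1 = {a \<in> A. \<exists>u\<in>I. \<exists>c\<in>S - Y. deriv_at u a c \<noteq> 0}"
    define A2 where "A2 = {a \<in> A. \<forall>u\<in>I. \<forall>c\<in>S - Y. deriv_at u a c = 0}"
    have "covered_by (flat_piece (Suc k) U S Y A) A1"
    proof (rule covered_by_local)
      fix a assume "a \<in> A1"
      then obtain u c where a: "a \<in> A" and u: "u \<in> I" and c: "c \<in> S - Y" "deriv_at u a c \<noteq> 0"
        unfolding A1_def by blast
      have cB: "c \<in> Basis" using c less.prems by blast
      have uC: "Ck (Suc k) U u" and uA: "\<And>x. x \<in> A \<Longrightarrow> u x = 0" using u by (auto simp: I_def)
      have aU: "a \<in> U" using a less.prems by blast
      obtain V W \<psi> where aV: "a \<in> V" and st: "straightening (Suc k) U u c V W \<psi>"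
        using straightening_exists[OF less.prems(3) uC _ aU cB c(2)] by auto
      interpret straightening "Suc k" U u c V W \<psi> by (rule st)
      define A' where "A' = push A"
      have "A' \<subseteq> coords (S - {c})"
        unfolding A'_def using less.prems(4) uA by (intro push_coords_zero) auto
      then have A'sub: "A' \<subseteq> W \<inter> coords (S - {c})"
        unfolding A'_def using push_sub by blast
      have psiA': "\<psi> ` A' = A \<inter> V" unfolding A'_def by (rule psi_push)
      have "card (S - {c}) < card S" using c finS by (intro psubset_card_mono) auto
      moreover have "Y \<subseteq> S - {c}" "S - {c} \<subseteq> Basis" using less.prems(1,2) c(1) by auto
      ultimately have "covered_by (flat_piece (Suc k) W (S - {c}) Y A') A'"
        using open_W A'sub by (rule IHS)
      then obtain \<A> where \<A>: "countable \<A>" "A' \<subseteq> \<Union>\<A>"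
        "\<And>P. P \<in> \<A> \<Longrightarrow> flat_piece (Suc k) W (S - {c}) Y A' P"
        unfolding covered_by_def by blast
      have "covered_by (flat_piece (Suc k) U S Y A) (A \<inter> V)"
      proof (rule covered_byI[of "(\<lambda>P. \<psi> ` P) ` \<A>"])
        show "countable ((\<lambda>P. \<psi> ` P) ` \<A>)" using \<A>(1) by simp
        have "A \<inter> V \<subseteq> \<psi> ` \<Union>\<A>" using image_mono[OF \<A>(2), of \<psi>] psiA' by simp
        then show "A \<inter> V \<subseteq> \<Union>((\<lambda>P. \<psi> ` P) ` \<A>)" unfolding image_Union .
        fix Q assume "Q \<in> (\<lambda>P. \<psi> ` P) ` \<A>"
        then obtain P where P: "P \<in> \<A>" "Q = \<psi> ` P" by blast
        obtain T l r \<psi>' B where B: "P \<subseteq> A'" "patch W (S - {c}) Y T l r \<psi>' B" "P = \<psi>' ` B"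
          and flat: "\<And>f::'a \<Rightarrow> real. Ck (Suc k) W f \<and> (\<forall>a\<in>A'. f a = 0) \<Longrightarrow>
            order_flat Y (S - {c}) T (cbox l r \<inter> coords T) B (Suc k) (\<lambda>x. f (\<psi>' x))"
          using \<A>(3)[OF P(1)] unfolding flat_piece_def by blast
        have \<psi>1: "Ck 1 W \<psi>" using Ck_mono[OF open_W Ck_psi] by simp
        have pt: "patch U S Y T l r (\<lambda>x. \<psi> (\<psi>' x)) B"
          by (rule patch_compose[OF B(2) c(1) YB open_W \<psi>1 psi_U]) (use psi_inner in auto)
        have "T \<noteq> S" using B(2) c unfolding patch_def by blast
        have fl: "order_flat Y S T (cbox l r \<inter> coords T) B (Suc k) (\<lambda>x. f (\<psi> (\<psi>' x)))"
          if "Ck (Suc k) U f" "\<forall>a\<in>A. f a = 0" for f :: "'a \<Rightarrow> real"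
        proof (rule order_flat_proper[OF _ \<open>T \<noteq> S\<close>])
          have "Ck (Suc k) W (\<lambda>w. f (\<psi> w))"
            by (rule Ck_comp[OF that(1)])
          moreover have "\<forall>a\<in>A'. f (\<psi> a) = 0" using psiA' that(2) by blast
          ultimately show "order_flat Y (S - {c}) T (cbox l r \<inter> coords T) B (Suc k) (\<lambda>x. f (\<psi> (\<psi>' x)))"
            using flat by blast
        qed
        have "Q \<subseteq> A" using P(2) B(1) psiA' by blast
        moreover have "Q = (\<lambda>x. \<psi> (\<psi>' x)) ` B" using P(2) B(3) by (simp add: image_image)
        ultimately show "flat_piece (Suc k) U S Y A Q"
          unfolding flat_piece_def using pt fl by blast
      qed
      then have "covered_by (flat_piece (Suc k) U S Y A) (A1 \<inter> V)"
        by (rule covered_by_mono) (auto simp: A1_def)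
      then show "\<exists>V. open V \<and> a \<in> V \<and> covered_by (flat_piece (Suc k) U S Y A) (A1 \<inter> V)"
        using open_V aV by blast
    qed
    moreover have "covered_by (flat_piece (Suc k) U S Y A) A2"
    proof -
      have "covered_by (flat_piece k U S Y A2) A2"
        using IHk[OF less.prems(1,2,3), of A2] less.prems(4) unfolding A2_def by blast
      then show ?thesis
      proof (rule covered_by_mono)
        fix P assume "flat_piece k U S Y A2 P"
        then obtain T l r \<psi> B where B: "P \<subseteq> A2" "patch U S Y T l r \<psi> B" "P = \<psi> ` B"
          and flat: "\<And>f::'a \<Rightarrow> real. Ck k U f \<and> (\<forall>a\<in>A2. f a = 0) \<Longrightarrow>
            order_flat Y S T (cbox l r \<inter> coords T) B k (\<lambda>x. f (\<psi> x))"
          unfolding flat_piece_def by blast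
        have fl: "order_flat Y S T (cbox l r \<inter> coords T) B (Suc k) (\<lambda>x. f (\<psi> x))"
          if f: "Ck (Suc k) U f" "\<forall>a\<in>A. f a = 0" for f :: "'a \<Rightarrow> real"
        proof (rule order_flat_integrate[OF less.prems(3) _ less.prems(2) B(2)])
          have fI: "f \<in> I" using f by (simp add: I_def)
          show "Ck 1 U f" using Ck_mono[OF less.prems(3) f(1)] by simp
          show "order_flat Y S T (cbox l r \<inter> coords T) B k (\<lambda>x. deriv_at f (\<psi> x) c)" if "c \<in> S - Y" for c
            using flat[of "\<lambda>x. deriv_at f x c"] Ck_SucD(2)[OF less.prems(3) f(1)] fI that
            by (auto simp: A2_def)
          show "deriv_at f (\<psi> b) c = 0" if "b \<in> B" "c \<in> S - Y" for b c
            using B(1,3) that fI by (auto simp: A2_def)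
        qed
        have "P \<subseteq> A" using B(1) by (auto simp: A2_def)
        then show "flat_piece (Suc k) U S Y A P"
          unfolding flat_piece_def using B fl by blast
      qed auto
    qed
    moreover have "A = A1 \<union> A2" by (auto simp: A1_def A2_def)
    ultimately show ?case using covered_by_Un by metis
  qed
qed

section \<open>Sets of Hausdorff measure zero\<close>

abbreviation cover_of_content :: "real \<Rightarrow> real \<Rightarrow> 'b::euclidean_space set \<Rightarrow> (nat \<Rightarrow> 'b set) \<Rightarrow> bool"
  where "cover_of_content s \<epsilon> B C \<equiv> B \<subseteq> (\<Union>j. C j) \<and> (\<forall>j. bounded (C j)) \<and>
    (\<Sum>j. ennreal (diameter (C j) powr s)) \<le> ennreal \<epsilon>"

text \<open>If the sum is at most \<open>\<epsilon>\<close> then every diameter is at most \<open>\<epsilon>^(1/s)\<close>, so small \<open>\<epsilon>\<close> forces the covering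
  sets to be small, and the limit over \<open>\<delta>\<close> in the Hausdorff measure can be avoided.\<close>

definition hnull :: "real \<Rightarrow> 'b::euclidean_space set \<Rightarrow> bool"
  where "hnull s B \<longleftrightarrow> (\<forall>\<epsilon>>0. \<exists>C. cover_of_content s \<epsilon> B C)"

lemma hnullD:
  fixes B :: "'b::euclidean_space set"
  assumes "hnull s B" "0 < \<epsilon>"
  obtains C :: "nat \<Rightarrow> 'b set" where "B \<subseteq> (\<Union>j. C j)" "\<And>j. bounded (C j)"
    "(\<Sum>j. ennreal (diameter (C j) powr s)) \<le> ennreal \<epsilon>"
    "\<And>j. diameter (C j) powr s \<le> \<epsilon>"
proof -
  obtain C :: "nat \<Rightarrow> 'b set" where C: "B \<subseteq> (\<Union>j. C j)" "\<And>j. bounded (C j)"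
    "(\<Sum>j. ennreal (diameter (C j) powr s)) \<le> ennreal \<epsilon>"
    using assms unfolding hnull_def by blast
  have "diameter (C j) powr s \<le> \<epsilon>" for j
  proof -
    have "(\<Sum>i\<in>{j}. ennreal (diameter (C i) powr s)) \<le> (\<Sum>i. ennreal (diameter (C i) powr s))"
      by (rule sum_le_suminf) auto
    then have "ennreal (diameter (C j) powr s) \<le> (\<Sum>i. ennreal (diameter (C i) powr s))" by simp
    also note C(3)
    finally have "ennreal (diameter (C j) powr s) \<le> ennreal \<epsilon>" .
    then show ?thesis using assms(2) by (simp add: ennreal_le_iff)
  qed
  then show thesis using that C by blast
qed

lemma hnull_subset: "hnull s B \<Longrightarrow> A \<subseteq> B \<Longrightarrow> hnull s A"
  unfolding hnull_def by (meson subset_trans)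

text \<open>Covers of total \<open>s\<close>-content at most \<open>1\<close> consist of sets of diameter at most \<open>1\<close>, for which larger
  exponents give smaller powers.\<close>

lemma hnull_mono_exponent:
  assumes "hnull s B" "0 < s" "s \<le> t"
  shows "hnull t B"
  unfolding hnull_def
proof (intro allI impI)
  fix \<epsilon> :: real assume "0 < \<epsilon>"
  then have "0 < min \<epsilon> 1" by simp
  from hnullD[OF assms(1) this] obtain C where C: "B \<subseteq> (\<Union>j. C j)" "\<And>j. bounded (C j)"
    "(\<Sum>j. ennreal (diameter (C j) powr s)) \<le> ennreal (min \<epsilon> 1)"
    "\<And>j. diameter (C j) powr s \<le> min \<epsilon> 1" by blast
  have "diameter (C j) powr t \<le> diameter (C j) powr s" for j
  proof -
    have d0: "0 \<le> diameter (C j)" using C(2) diameter_ge_0 by blast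
    have "diameter (C j) \<le> 1"
    proof (rule ccontr)
      assume "\<not> diameter (C j) \<le> 1"
      then have "1 < diameter (C j) powr s" using powr_less_mono2[of s 1 "diameter (C j)"] assms(2) by simp
      with C(4)[of j] show False by simp
    qed
    then show ?thesis by (intro powr_mono' d0 assms(3))
  qed
  then have "(\<Sum>j. ennreal (diameter (C j) powr t)) \<le> (\<Sum>j. ennreal (diameter (C j) powr s))"
    by (intro suminf_le) (auto simp: ennreal_leI)
  also have "\<dots> \<le> ennreal \<epsilon>" using C(3) by (rule order_trans) (simp add: ennreal_leI)
  finally show "\<exists>C. cover_of_content t \<epsilon> B C" using C by blast
qed

lemma hnull_UN_nat:
  fixes B :: "nat \<Rightarrow> 'b::euclidean_space set"
  assumes "\<And>n. hnull s (B n)"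
  shows "hnull s (\<Union>n. B n)"
  unfolding hnull_def
proof (intro allI impI)
  fix \<epsilon> :: real assume \<epsilon>: "0 < \<epsilon>"
  have "\<exists>C. cover_of_content s (\<epsilon> * (1/2)^Suc n) (B n) C" for n
    using assms[of n] \<epsilon> unfolding hnull_def by simp
  then have "\<forall>n. \<exists>C. cover_of_content s (\<epsilon> * (1/2)^Suc n) (B n) C" ..
  from choice[OF this] obtain C :: "nat \<Rightarrow> nat \<Rightarrow> 'b set" where
    C: "\<forall>n. cover_of_content s (\<epsilon> * (1/2)^Suc n) (B n) (C n)" ..
  define D where "D i = C (fst (prod_decode i)) (snd (prod_decode i))" for i
  have "(\<Sum>i. ennreal (diameter (D i) powr s)) = (\<Sum>n. \<Sum>j. ennreal (diameter (C n j) powr s))"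
    unfolding D_def
    by (rule suminf_ennreal_2dimen[of _ "\<lambda>p. ennreal (diameter (C (fst p) (snd p)) powr s)"]) simp
  also have "\<dots> \<le> (\<Sum>n. ennreal (\<epsilon> * (1/2)^Suc n))"
    using C by (intro suminf_le) auto
  also have "\<dots> = ennreal (\<epsilon> * 1)"
    by (rule suminf_ennreal_eq[OF _ sums_mult[OF power_half_series]]) (use \<epsilon> in auto)
  finally have "(\<Sum>i. ennreal (diameter (D i) powr s)) \<le> ennreal \<epsilon>" by simp
  moreover have "(\<Union>n. B n) \<subseteq> (\<Union>i. D i)"
  proof
    fix x assume "x \<in> (\<Union>n. B n)"
    then obtain n j where "x \<in> C n j" using C by blast
    then have "x \<in> D (prod_encode (n, j))" by (simp add: D_def)
    then show "x \<in> (\<Union>i. D i)" by blast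
  qed
  ultimately show "\<exists>C. cover_of_content s \<epsilon> (\<Union>n. B n) C"
    using C by (intro exI[of _ D]) (auto simp: D_def)
qed

lemma hnull_empty: "hnull s {}"
  unfolding hnull_def by (intro allI impI exI[of _ "\<lambda>j. {}"]) auto

lemma hnull_UN:
  assumes "countable I" "\<And>i. i \<in> I \<Longrightarrow> hnull s (B i)"
  shows "hnull s (\<Union>i\<in>I. B i)"
proof (cases "I = {}")
  case True
  then show ?thesis by (simp add: hnull_empty)
next
  case False
  have "hnull s (\<Union>n. B (from_nat_into I n))"
    using assms(2) from_nat_into[OF False] by (intro hnull_UN_nat) blast
  moreover have "(\<Union>i\<in>I. B i) \<subseteq> (\<Union>n. B (from_nat_into I n))"
    using from_nat_into_surj[OF assms(1)] by blast
  ultimately show ?thesis by (rule hnull_subset)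
qed

lemma hnull_covered_by:
  assumes "covered_by P A" "\<And>A'. P A' \<Longrightarrow> hnull s (f ` A')"
  shows "hnull s (f ` A)"
proof -
  obtain \<A> where \<A>: "countable \<A>" "A \<subseteq> \<Union>\<A>" "\<forall>A'\<in>\<A>. P A'"
    using assms(1) unfolding covered_by_def by blast
  have "hnull s (\<Union>A'\<in>\<A>. f ` A')" using \<A> assms(2) by (intro hnull_UN) auto
  moreover have "f ` A \<subseteq> (\<Union>A'\<in>\<A>. f ` A')" using \<A>(2) by blast
  ultimately show ?thesis by (rule hnull_subset)
qed

lemma hnull_imp_hausdorff_outer:
  fixes B :: "'b::euclidean_space set"
  assumes "hnull s B" "0 < s"
  shows "hausdorff_outer s B = 0"
proof -
  define F where "F \<delta> = (INF C\<in>{C :: nat \<Rightarrow> 'b set. B \<subseteq> (\<Union>j. C j) \<and> (\<forall>j. bounded (C j) \<and> diameter (C j) \<le> \<delta>)}.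
     (\<Sum>j. ennreal (diameter (C j) powr s)))" for \<delta> :: real
  have F0: "F \<delta> = 0" if \<delta>: "0 < \<delta>" for \<delta>
  proof -
    have "F \<delta> \<le> 0 + ennreal \<epsilon>" if \<epsilon>: "0 < \<epsilon>" for \<epsilon>
    proof -
      have "0 < min \<epsilon> (\<delta> powr s)" using \<epsilon> \<delta> by simp
      from hnullD[OF assms(1) this] obtain C :: "nat \<Rightarrow> 'b set" where C: "B \<subseteq> (\<Union>j. C j)" "\<And>j. bounded (C j)"
        "(\<Sum>j. ennreal (diameter (C j) powr s)) \<le> ennreal (min \<epsilon> (\<delta> powr s))"
        "\<And>j. diameter (C j) powr s \<le> min \<epsilon> (\<delta> powr s)" by blast
      have "diameter (C j) \<le> \<delta>" for j
      proof (rule ccontr)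
        assume "\<not> diameter (C j) \<le> \<delta>"
        then have "\<delta> powr s < diameter (C j) powr s" using assms(2) \<delta> by (intro powr_less_mono2) auto
        with C(4)[of j] show False by simp
      qed
      then have "F \<delta> \<le> (\<Sum>j. ennreal (diameter (C j) powr s))"
        unfolding F_def using C by (intro INF_lower) auto
      also have "\<dots> \<le> ennreal \<epsilon>" using C(3) by (rule order_trans) (simp add: ennreal_leI)
      finally show ?thesis by simp
    qed
    then have "F \<delta> \<le> 0" by (rule ennreal_le_epsilon)
    then show ?thesis by simp
  qed
  have "(F \<longlongrightarrow> 0) (at_right 0)"
    by (rule tendsto_eventually) (use F0 in \<open>auto simp: eventually_at_filter\<close>)
  then have "Lim (at_right 0) F = 0" by (intro tendsto_Lim) auto
  moreover have "hausdorff_outer s B = Lim (at_right 0) F"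
    unfolding hausdorff_outer_def F_def using assms(2) by simp
  ultimately show ?thesis by simp
qed

lemma hnull_finite_covers:
  fixes B :: "'b::euclidean_space set"
  assumes "0 < s"
    and "\<And>\<epsilon>. 0 < \<epsilon> \<Longrightarrow> \<exists>\<C> d. finite \<C> \<and> B \<subseteq> \<Union>\<C> \<and> (\<forall>C\<in>\<C>. bounded C \<and> diameter C \<le> d) \<and>
      0 \<le> d \<and> real (card \<C>) * d powr s \<le> \<epsilon>"
  shows "hnull s B"
  unfolding hnull_def
proof (intro allI impI)
  fix \<epsilon> :: real assume "0 < \<epsilon>"
  from assms(2)[OF this] obtain \<C> d where
    "finite \<C> \<and> B \<subseteq> \<Union>\<C> \<and> (\<forall>C\<in>\<C>. bounded C \<and> diameter C \<le> d) \<and>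
      0 \<le> d \<and> real (card \<C>) * d powr s \<le> \<epsilon>"
    by (elim exE)
  then have \<C>: "finite \<C>" "B \<subseteq> \<Union>\<C>" "\<And>C. C \<in> \<C> \<Longrightarrow> bounded C \<and> diameter C \<le> d" "0 \<le> d"
    "real (card \<C>) * d powr s \<le> \<epsilon>" by simp_all
  obtain g where g: "bij_betw g {0..<card \<C>} \<C>" using ex_bij_betw_nat_finite[OF \<C>(1)] by blast
  define C where "C j = (if j < card \<C> then g j else {})" for j
  have gC: "g j \<in> \<C>" if "j < card \<C>" for j using g that by (auto simp: bij_betw_def)
  have "(\<Sum>j. ennreal (diameter (C j) powr s)) = (\<Sum>j\<in>{0..<card \<C>}. ennreal (diameter (C j) powr s))"
    by (rule suminf_finite) (auto simp: C_def)
  also have "\<dots> \<le> (\<Sum>j\<in>{0..<card \<C>}. ennreal (d powr s))"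
    using \<C>(3)[OF gC] assms(1) diameter_ge_0
    by (intro sum_mono ennreal_leI) (auto simp: C_def intro!: powr_mono2)
  also have "\<dots> = ennreal (real (card \<C>) * d powr s)"
    by (simp add: ennreal_mult ennreal_of_nat_eq_real_of_nat)
  also have "\<dots> \<le> ennreal \<epsilon>" using \<C>(5) by (rule ennreal_leI)
  finally have "(\<Sum>j. ennreal (diameter (C j) powr s)) \<le> ennreal \<epsilon>" .
  moreover have "B \<subseteq> (\<Union>j. C j)"
  proof
    fix x assume "x \<in> B"
    then obtain D where "D \<in> \<C>" "x \<in> D" using \<C>(2) by blast
    moreover have "D \<in> g ` {0..<card \<C>}" using g \<open>D \<in> \<C>\<close> by (simp add: bij_betw_def)
    then obtain j where "j < card \<C>" "g j = D" by auto
    ultimately have "x \<in> C j" by (simp add: C_def)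
    then show "x \<in> (\<Union>j. C j)" by blast
  qed
  moreover have "bounded (C j)" for j using \<C>(3)[OF gC] by (simp add: C_def)
  ultimately show "\<exists>C. cover_of_content s \<epsilon> B C" by blast
qed

section \<open>Images of flat mappings\<close>

text \<open>The covering sets are the images of the cells of a grid with mesh \<open>\<tau>\<close> in the coordinates \<open>Y\<close> and
  \<open>\<rho>\<close> in the coordinates \<open>T - Y\<close>.\<close>

lemma box_cover:
  fixes h :: "'a::euclidean_space \<Rightarrow> 'b::euclidean_space"
  assumes "Y \<subseteq> T" "T \<subseteq> Basis" "B \<subseteq> cbox l r \<inter> coords T" "0 < \<tau>" "0 < \<rho>" "\<tau> \<le> R" "\<rho> \<le> R"
    and R: "\<And>i. i \<in> Basis \<Longrightarrow> (r - l) \<bullet> i \<le> R"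
    and close: "\<And>x b. x \<in> B \<Longrightarrow> b \<in> B \<Longrightarrow> near Y \<tau> \<rho> x b \<Longrightarrow> norm (h x - h b) \<le> d" and "0 \<le> d"
  shows "\<exists>\<C>. finite \<C> \<and> h ` B \<subseteq> \<Union>\<C> \<and> (\<forall>C\<in>\<C>. bounded C \<and> diameter C \<le> d) \<and>
    real (card \<C>) \<le> (2 * R / \<tau>) ^ card Y * (2 * R / \<rho>) ^ card (T - Y)"
proof -
  define \<sigma> where "\<sigma> i = (if i \<in> Y then \<tau> else \<rho>)" for i :: 'a
  have \<sigma>: "0 < \<sigma> i" "\<sigma> i \<le> R" for i using assms by (auto simp: \<sigma>_def)
  define cell where "cell x = (\<lambda>i\<in>T. nat \<lfloor>(x - l) \<bullet> i / \<sigma> i\<rfloor>)" for x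
  define J where "J = (\<Pi>\<^sub>E i\<in>T. {..nat \<lfloor>R / \<sigma> i\<rfloor>})"
  have finT: "finite T" using assms(2) finite_Basis finite_subset by blast
  have finJ: "finite J" unfolding J_def using finT by (intro finite_PiE) auto
  have lx: "0 \<le> (x - l) \<bullet> i" "(x - l) \<bullet> i \<le> R" if "x \<in> B" "i \<in> T" for x i
  proof -
    have i: "i \<in> Basis" using that assms(2) by blast
    have "l \<bullet> i \<le> x \<bullet> i" "x \<bullet> i \<le> r \<bullet> i" using that(1) assms(3) i by (auto simp: mem_box)
    then show "0 \<le> (x - l) \<bullet> i" "(x - l) \<bullet> i \<le> R" using R[OF i] by (auto simp: inner_diff_left)
  qed
  have cellJ: "cell x \<in> J" if "x \<in> B" for x
    unfolding cell_def J_def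
    using lx[OF that] \<sigma> by (auto intro!: nat_mono floor_mono divide_right_mono simp: less_imp_le)
  define \<C> where "\<C> = (\<lambda>j. h ` {x \<in> B. cell x = j}) ` J"
  have "finite \<C>" unfolding \<C>_def using finJ by simp
  moreover have "h ` B \<subseteq> \<Union>\<C>" unfolding \<C>_def using cellJ by blast
  moreover have "bounded C \<and> diameter C \<le> d" if "C \<in> \<C>" for C
  proof -
    obtain j where j: "C = h ` {x \<in> B. cell x = j}" using \<open>C \<in> \<C>\<close> unfolding \<C>_def by blast
    have nr: "near Y \<tau> \<rho> x b" if "x \<in> B" "b \<in> B" "cell x = cell b" for x b
    proof -
      have bnd: "\<bar>(x - b) \<bullet> i\<bar> \<le> \<sigma> i" if "i \<in> Basis" for i
      proof (cases "i \<in> T")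
        case True
        then have "nat \<lfloor>(x - l) \<bullet> i / \<sigma> i\<rfloor> = nat \<lfloor>(b - l) \<bullet> i / \<sigma> i\<rfloor>"
          using fun_cong[OF \<open>cell x = cell b\<close>, of i] by (simp add: cell_def)
        moreover have "0 \<le> \<lfloor>(x - l) \<bullet> i / \<sigma> i\<rfloor>" "0 \<le> \<lfloor>(b - l) \<bullet> i / \<sigma> i\<rfloor>"
          using lx \<sigma>(1)[of i] True \<open>x \<in> B\<close> \<open>b \<in> B\<close> by auto
        ultimately have "\<lfloor>(x - l) \<bullet> i / \<sigma> i\<rfloor> = \<lfloor>(b - l) \<bullet> i / \<sigma> i\<rfloor>" by linarith
        then have "\<bar>(x - l) \<bullet> i / \<sigma> i - (b - l) \<bullet> i / \<sigma> i\<bar> \<le> 1" by linarith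
        then have "\<bar>((x - l) \<bullet> i - (b - l) \<bullet> i) / \<sigma> i\<bar> \<le> 1" by (simp add: diff_divide_distrib)
        then have "\<bar>(x - l) \<bullet> i - (b - l) \<bullet> i\<bar> \<le> \<sigma> i" using \<sigma>(1)[of i] by (simp add: abs_divide)
        then show ?thesis by (simp add: inner_diff_left)
      next
        case False
        moreover have "x \<in> coords T" "b \<in> coords T" using \<open>x \<in> B\<close> \<open>b \<in> B\<close> assms(3) by auto
        ultimately have "x \<bullet> i = 0" "b \<bullet> i = 0" using \<open>i \<in> Basis\<close> by (auto simp: coords_def)
        then show ?thesis using \<sigma>(1)[of i] by (simp add: inner_diff_left)
      qed
      show ?thesis unfolding near_def
      proof (intro conjI ballI)
        show "\<bar>(x - b) \<bullet> i\<bar> \<le> \<tau>" if "i \<in> Y" for i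
          using bnd[of i] that assms(1,2) by (simp add: \<sigma>_def subset_iff)
        show "\<bar>(x - b) \<bullet> i\<bar> \<le> \<rho>" if "i \<in> Basis - Y" for i
          using bnd[of i] that by (simp add: \<sigma>_def)
      qed
    qed
    have dist: "norm (y - z) \<le> d" if "y \<in> C" "z \<in> C" for y z
    proof -
      have "y \<in> h ` {x \<in> B. cell x = j}" "z \<in> h ` {x \<in> B. cell x = j}" using that j by simp_all
      then obtain x b where "y = h x" "z = h b" "x \<in> B" "b \<in> B" "cell x = cell b" by auto
      then show ?thesis using close[OF _ _ nr] by simp
    qed
    have "bounded C"
    proof (cases "C = {}")
      case False
      then obtain z where "z \<in> C" by blast
      then show ?thesis unfolding bounded_any_center[where a = z]
        using dist by (intro exI[of _ d]) (simp add: dist_norm)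
    qed simp
    moreover have "diameter C \<le> d"
      using dist \<open>0 \<le> d\<close> by (intro diameter_le) auto
    ultimately show ?thesis by blast
  qed
  moreover have "real (card \<C>) \<le> (2 * R / \<tau>) ^ card Y * (2 * R / \<rho>) ^ card (T - Y)"
  proof -
    have "card \<C> \<le> card J" unfolding \<C>_def using finJ by (rule card_image_le)
    also have "\<dots> = (\<Prod>i\<in>T. Suc (nat \<lfloor>R / \<sigma> i\<rfloor>))" unfolding J_def using finT by (simp add: card_PiE)
    finally have "real (card \<C>) \<le> (\<Prod>i\<in>T. real (Suc (nat \<lfloor>R / \<sigma> i\<rfloor>)))"
      by (metis of_nat_le_iff of_nat_prod)
    also have "\<dots> \<le> (\<Prod>i\<in>T. 2 * R / \<sigma> i)"
    proof (rule prod_mono, intro conjI)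
      fix i
      have "1 \<le> R / \<sigma> i" using \<sigma>[of i] by simp
      then have "real (Suc (nat \<lfloor>R / \<sigma> i\<rfloor>)) \<le> R / \<sigma> i + R / \<sigma> i"
        by (simp add: add_mono of_nat_nat) linarith
      then show "real (Suc (nat \<lfloor>R / \<sigma> i\<rfloor>)) \<le> 2 * R / \<sigma> i" by simp
    qed simp
    also have "\<dots> = (\<Prod>i\<in>Y. 2 * R / \<sigma> i) * (\<Prod>i\<in>T - Y. 2 * R / \<sigma> i)"
      using prod.subset_diff[OF assms(1) finT] by (simp add: mult.commute)
    also have "(\<Prod>i\<in>Y. 2 * R / \<sigma> i) = (2 * R / \<tau>) ^ card Y" by (simp add: \<sigma>_def)
    also have "(\<Prod>i\<in>T - Y. 2 * R / \<sigma> i) = (2 * R / \<rho>) ^ card (T - Y)" by (simp add: \<sigma>_def)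
    finally show ?thesis .
  qed
  ultimately show ?thesis by blast
qed

text \<open>Put \<open>\<nu> = card Y\<close>, \<open>M = card (S - Y)\<close> and \<open>e = card (T - Y) \<le> M\<close>. With \<open>\<tau> = K \<rho>^k / (C + 1)\<close> the images of
  the boxes have diameter at most \<open>2 K \<rho>^k\<close>, and their number is of order \<open>\<tau>^(-\<nu>) \<rho>^(-e)\<close>. So the sum of
  the powers with exponent \<open>\<nu> + M / k\<close> is at most a constant times \<open>K^(M/k) \<rho>^(M-e)\<close>. If \<open>T\<close> is smaller
  than \<open>S\<close> then \<open>e < M\<close> and it tends to zero with \<open>\<rho>\<close>; if \<open>T = S\<close> it tends to zero with \<open>K\<close>, because \<open>Z\<close>
  does not depend on \<open>K\<close>.\<close>

lemma order_flat_image_null: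
  fixes h :: "'a::euclidean_space \<Rightarrow> 'b::euclidean_space"
  assumes "order_flat Y S T (cbox l r \<inter> coords T) B k h" "Y \<subseteq> T" "T \<subseteq> S" "S \<subseteq> Basis"
    and B: "B \<subseteq> cbox l r \<inter> coords T" and "1 \<le> k" "Y \<noteq> S"
  shows "hnull (real (card Y) + real (card (S - Y)) / real k) (h ` B)"
proof -
  let ?M = "card (S - Y)" let ?\<nu> = "card Y" let ?e = "card (T - Y)"
  let ?s = "real ?\<nu> + real ?M / real k"
  let ?cov = "\<lambda>\<epsilon>. \<exists>\<C> d. finite \<C> \<and> h ` B \<subseteq> \<Union>\<C> \<and> (\<forall>C\<in>\<C>. bounded C \<and> diameter C \<le> d) \<and>
    0 \<le> d \<and> real (card \<C>) * d powr ?s \<le> \<epsilon>"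
  have finS: "finite S" using assms(4) finite_Basis finite_subset by blast
  have M: "1 \<le> ?M" using assms finS by (metis Diff_eq_empty_iff One_nat_def Suc_leI card_gt_0_iff finite_Diff subset_antisym subset_trans)
  have s: "0 < ?s" using M assms(6) by (simp add: add_nonneg_pos)
  obtain C K0 where CK: "0 \<le> C" "0 \<le> K0"
    "\<And>K. 0 < K \<Longrightarrow> K0 \<le> K \<or> T = S \<Longrightarrow> aniso_bound Y (cbox l r \<inter> coords T) B k C K h"
    using assms(1) unfolding order_flat_def by blast
  define R where "R = 1 + (\<Sum>i\<in>Basis. \<bar>(r - l) \<bullet> i\<bar>)"
  have R1: "1 \<le> R" by (simp add: R_def sum_nonneg)
  have R: "(r - l) \<bullet> i \<le> R" if "i \<in> Basis" for i
    using member_le_sum[OF that, of "\<lambda>i. \<bar>(r - l) \<bullet> i\<bar>"] by (auto simp: R_def)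
  define Z where "Z = (4 * R * (C + 1)) ^ ?\<nu> * (2 * R) ^ ?e"
  have Z: "0 < Z" using R1 CK(1) by (simp add: Z_def)
  have covers: "\<exists>\<rho>0>0. \<forall>\<rho>. 0 < \<rho> \<and> \<rho> \<le> \<rho>0 \<longrightarrow>
      ?cov (Z * (2 * K) powr (real ?M / real k) * \<rho> ^ (?M - ?e))"
    if K: "0 < K" "K0 \<le> K \<or> T = S" for K
  proof -
    obtain \<delta> where \<delta>: "0 < \<delta>" "\<And>b x \<tau> \<rho>. b \<in> B \<Longrightarrow> x \<in> cbox l r \<inter> coords T \<Longrightarrow>
        0 \<le> \<tau> \<and> \<tau> \<le> \<delta> \<and> 0 \<le> \<rho> \<and> \<rho> \<le> \<delta> \<and> near Y \<tau> \<rho> x b \<Longrightarrow> norm (h x - h b) \<le> C * \<tau> + K * \<rho> ^ k"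
      using CK(3)[OF K] unfolding aniso_bound_def by blast
    \<comment> \<open>the last bound on \<open>\<rho>\<close> ensures \<open>\<tau> \<le> K \<rho> \<le> min \<delta> 1\<close>\<close>
    define \<rho>0 where "\<rho>0 = min 1 (min \<delta> (min \<delta> 1 / K))"
    have \<rho>0: "0 < \<rho>0" using \<delta>(1) K by (simp add: \<rho>0_def)
    have "?cov (Z * (2 * K) powr (real ?M / real k) * \<rho> ^ (?M - ?e))"
      if \<rho>: "0 < \<rho>" "\<rho> \<le> \<rho>0" for \<rho>
    proof -
      define \<tau> where "\<tau> = K * \<rho> ^ k / (C + 1)"
      define d where "d = 2 * K * \<rho> ^ k"
      have \<rho>1: "\<rho> \<le> 1" "\<rho> \<le> \<delta>" "\<rho> \<le> min \<delta> 1 / K" using \<rho> by (auto simp: \<rho>0_def)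
      have d0: "0 < d" using K \<rho> by (simp add: d_def)
      have \<tau>0: "0 < \<tau>" using K \<rho> CK(1) by (simp add: \<tau>_def)
      have "\<tau> \<le> K * \<rho> ^ k"
      proof -
        have "K * \<rho> ^ k * 1 \<le> K * \<rho> ^ k * (C + 1)"
          using K(1) \<rho>(1) CK(1) by (intro mult_left_mono) auto
        then show ?thesis unfolding \<tau>_def using CK(1) by (simp add: divide_le_eq)
      qed
      also have "\<dots> \<le> K * \<rho> ^ 1"
        using K \<rho>(1) \<rho>1(1) assms(6) by (intro mult_left_mono power_decreasing) auto
      also have "\<dots> \<le> min \<delta> 1" using \<rho>1(3) K(1) by (simp add: field_simps)
      finally have \<tau>1: "\<tau> \<le> \<delta>" "\<tau> \<le> 1" by auto
      have C\<tau>: "C * \<tau> \<le> K * \<rho> ^ k"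
      proof -
        have "C * \<tau> \<le> (C + 1) * \<tau>" using \<tau>0 by simp
        also have "\<dots> = K * \<rho> ^ k" using CK(1) by (simp add: \<tau>_def)
        finally show ?thesis .
      qed
      have close: "norm (h x - h b) \<le> d" if "x \<in> B" "b \<in> B" "near Y \<tau> \<rho> x b" for x b
      proof -
        have "norm (h x - h b) \<le> C * \<tau> + K * \<rho> ^ k"
          using \<delta>(2)[OF that(2), of x \<tau> \<rho>] that B \<tau>0 \<tau>1 \<rho>(1) \<rho>1 by auto
        then show ?thesis using C\<tau> by (simp add: d_def)
      qed
      obtain \<C> where \<C>: "finite \<C>" "h ` B \<subseteq> \<Union>\<C>" "\<forall>C\<in>\<C>. bounded C \<and> diameter C \<le> d"
        "real (card \<C>) \<le> (2 * R / \<tau>) ^ ?\<nu> * (2 * R / \<rho>) ^ ?e"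
      proof -
        have "T \<subseteq> Basis" using assms(3,4) by (rule subset_trans)
        note side = this \<tau>1(2)[THEN order_trans, OF R1] \<rho>1(1)[THEN order_trans, OF R1] less_imp_le[OF d0]
        have "\<exists>\<C>. finite \<C> \<and> h ` B \<subseteq> \<Union>\<C> \<and> (\<forall>C\<in>\<C>. bounded C \<and> diameter C \<le> d) \<and>
            real (card \<C>) \<le> (2 * R / \<tau>) ^ ?\<nu> * (2 * R / \<rho>) ^ ?e"
          by (rule box_cover[OF assms(2) side(1) B \<tau>0 \<rho>(1) side(2,3)]) (use R close side(4) in auto)
        then show thesis by (elim exE conjE) (rule that)
      qed
      have "d powr ?s = d powr real ?\<nu> * d powr (real ?M / real k)" by (rule powr_add)
      also have "d powr real ?\<nu> = d ^ ?\<nu>" using d0 by (rule powr_realpow)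
      also have "d powr (real ?M / real k) = (2 * K) powr (real ?M / real k) * (\<rho> ^ k) powr (real ?M / real k)"
        unfolding d_def using K \<rho> by (intro powr_mult) 
      also have "(\<rho> ^ k) powr (real ?M / real k) = \<rho> ^ ?M"
      proof -
        have "(\<rho> ^ k) powr (real ?M / real k) = (\<rho> powr real k) powr (real ?M / real k)"
          using \<rho>(1) by (simp add: powr_realpow)
        also have "\<dots> = \<rho> powr real ?M" using assms(6) by (simp add: powr_powr)
        also have "\<dots> = \<rho> ^ ?M" using \<rho>(1) by (rule powr_realpow)
        finally show ?thesis .
      qed
      finally have dp: "d powr ?s = d ^ ?\<nu> * ((2 * K) powr (real ?M / real k) * \<rho> ^ ?M)" .
      have "?e \<le> ?M" using assms(3) finS by (intro card_mono) auto
      then have \<rho>e: "\<rho> ^ ?M = \<rho> ^ ?e * \<rho> ^ (?M - ?e)" by (simp flip: power_add)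
      have \<tau>d: "(2 * R / \<tau>) * d = 4 * R * (C + 1)"
        using K \<rho> CK(1) by (simp add: \<tau>_def d_def field_simps)
      have "real (card \<C>) * d powr ?s \<le> ((2 * R / \<tau>) ^ ?\<nu> * (2 * R / \<rho>) ^ ?e) * d powr ?s"
        using \<C>(4) by (intro mult_right_mono) auto
      also have "\<dots> = ((2 * R / \<tau>) * d) ^ ?\<nu> * ((2 * R / \<rho>) * \<rho>) ^ ?e * (2 * K) powr (real ?M / real k) * \<rho> ^ (?M - ?e)"
        unfolding dp \<rho>e power_mult_distrib by simp
      also have "\<dots> = Z * (2 * K) powr (real ?M / real k) * \<rho> ^ (?M - ?e)"
        unfolding \<tau>d Z_def using \<rho>(1) by simp
      finally show ?thesis using \<C> d0 by (intro exI[of _ \<C>] exI[of _ d]) auto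
    qed
    then show ?thesis using \<rho>0 by blast
  qed
  show ?thesis
  proof (rule hnull_finite_covers[OF s])
    fix \<epsilon> :: real assume \<epsilon>: "0 < \<epsilon>"
    show "?cov \<epsilon>"
    proof (cases "T = S")
      case True
      \<comment> \<open>the solution of \<open>Z (2 K)^(M/k) = \<epsilon>\<close>\<close>
      define K where "K = (\<epsilon> / Z) powr (real k / real ?M) / 2"
      have K: "0 < K" using \<epsilon> Z by (simp add: K_def)
      have "(2 * K) powr (real ?M / real k) = \<epsilon> / Z"
        using \<epsilon> Z M assms(6) by (simp add: K_def powr_powr)
      then have eq: "Z * (2 * K) powr (real ?M / real k) * \<rho> ^ (?M - ?e) = \<epsilon>" for \<rho> :: real
        using Z True by simp
      obtain \<rho>0 where "\<rho>0 > 0" "?cov (Z * (2 * K) powr (real ?M / real k) * \<rho>0 ^ (?M - ?e))"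
        using covers[OF K] True by blast
      then show ?thesis unfolding eq by blast
    next
      case False
      define K where "K = K0 + 1"
      define Q where "Q = Z * (2 * K) powr (real ?M / real k)"
      have K: "0 < K" "K0 \<le> K \<or> T = S" using CK(2) by (auto simp: K_def)
      have Q: "0 < Q" using Z K by (simp add: Q_def)
      obtain \<rho>0 where \<rho>0: "\<rho>0 > 0" "\<And>\<rho>. 0 < \<rho> \<and> \<rho> \<le> \<rho>0 \<Longrightarrow> ?cov (Q * \<rho> ^ (?M - ?e))"
        using covers[OF K] unfolding Q_def by blast
      define \<rho> where "\<rho> = min \<rho>0 (min 1 (\<epsilon> / Q))"
      have \<rho>: "0 < \<rho>" "\<rho> \<le> \<rho>0" "\<rho> \<le> 1" "\<rho> \<le> \<epsilon> / Q" using \<rho>0(1) \<epsilon> Q by (auto simp: \<rho>_def)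
      have "T - Y \<subset> S - Y" using False assms(2,3) by blast
      then have "?e < ?M" using finS by (intro psubset_card_mono) auto
      then have "\<rho> ^ (?M - ?e) \<le> \<rho> ^ 1" using \<rho> by (intro power_decreasing) auto
      then have "Q * \<rho> ^ (?M - ?e) \<le> Q * (\<epsilon> / Q)" using Q \<rho>(4) by (intro mult_left_mono) auto
      then have "Q * \<rho> ^ (?M - ?e) \<le> \<epsilon>" using Q by simp
      then show ?thesis using \<rho>0(2)[of \<rho>] \<rho>(1,2) by (meson order_trans)
    qed
  qed
qed

section \<open>The Morse-Sard-Federer theorem\<close>

lemma order_flat_components:
  fixes h :: "'a::euclidean_space \<Rightarrow> 'b::euclidean_space"
  assumes "\<And>b. b \<in> Basis \<Longrightarrow> order_flat Y S T D B k (\<lambda>x. h x \<bullet> b)"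
  shows "order_flat Y S T D B k h"
proof -
  obtain C K0 where C: "0 \<le> C" and K0: "0 \<le> K0" and CK: "\<And>K. 0 < K \<Longrightarrow> K0 \<le> K \<or> T = S \<Longrightarrow>
      \<exists>\<delta>>0. \<forall>b\<in>Basis. \<forall>y\<in>B. \<forall>x\<in>D. \<forall>\<tau> \<rho>. 0 \<le> \<tau> \<and> \<tau> \<le> \<delta> \<and> 0 \<le> \<rho> \<and> \<rho> \<le> \<delta> \<and> near Y \<tau> \<rho> x y \<longrightarrow>
        norm (h x \<bullet> b - h y \<bullet> b) \<le> C * \<tau> + K * \<rho> ^ k"
    by (rule order_flat_common[of Basis Y S T D B k "\<lambda>b x. h x \<bullet> b"],
        rule finite_Basis, erule assms, rule that)
  define n where "n = real DIM('b)"
  have n: "0 < n" by (simp add: n_def)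
  have "aniso_bound Y D B k (n * C) K h" if K: "0 < K" "n * K0 \<le> K \<or> T = S" for K
  proof -
    have "0 < K / n" "K0 \<le> K / n \<or> T = S" using K n by (auto simp: field_simps)
    from CK[OF this] obtain \<delta> where \<delta>: "0 < \<delta>" "\<And>b x y \<tau> \<rho>. b \<in> Basis \<Longrightarrow> y \<in> B \<Longrightarrow> x \<in> D \<Longrightarrow>
        0 \<le> \<tau> \<and> \<tau> \<le> \<delta> \<and> 0 \<le> \<rho> \<and> \<rho> \<le> \<delta> \<and> near Y \<tau> \<rho> x y \<Longrightarrow>
        norm (h x \<bullet> b - h y \<bullet> b) \<le> C * \<tau> + K / n * \<rho> ^ k" by blast
    have "norm (h x - h y) \<le> n * C * \<tau> + K * \<rho> ^ k"
      if *: "y \<in> B" "x \<in> D" "0 \<le> \<tau> \<and> \<tau> \<le> \<delta> \<and> 0 \<le> \<rho> \<and> \<rho> \<le> \<delta> \<and> near Y \<tau> \<rho> x y" for y x \<tau> \<rho>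
    proof -
      have "norm (h x - h y) \<le> (\<Sum>b\<in>Basis. \<bar>(h x - h y) \<bullet> b\<bar>)" by (rule norm_le_l1)
      also have "\<dots> \<le> n * (C * \<tau> + K / n * \<rho> ^ k)"
        unfolding n_def using \<delta>(2)[OF _ *] by (intro sum_bounded_above) (simp add: inner_diff_left n_def)
      also have "\<dots> = n * C * \<tau> + K * \<rho> ^ k" using n by (simp add: distrib_left)
      finally show ?thesis .
    qed
    then show ?thesis unfolding aniso_bound_def using \<delta>(1) by blast
  qed
  then show ?thesis unfolding order_flat_def using C K0 n
    by (intro exI[of _ "n * C"] conjI exI[of _ "n * K0"]) auto
qed

lemma order_flat_coordinate:
  assumes "i \<in> Y" "\<And>x. x \<in> D \<union> B \<Longrightarrow> h x = x \<bullet> i"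
  shows "order_flat Y S T D B k h"
proof -
  have "aniso_bound Y D B k 1 K h" if "0 < K" for K
    unfolding aniso_bound_def
  proof (intro exI[of _ 1] conjI ballI allI impI)
    fix b x \<tau> \<rho> assume *: "b \<in> B" "x \<in> D" "0 \<le> \<tau> \<and> \<tau> \<le> 1 \<and> 0 \<le> \<rho> \<and> \<rho> \<le> 1 \<and> near Y \<tau> \<rho> x b"
    then have "\<bar>(x - b) \<bullet> i\<bar> \<le> \<tau>" using assms(1) by (simp add: near_def)
    moreover have "0 \<le> K * \<rho> ^ k" using * that by simp
    ultimately show "norm (h x - h b) \<le> 1 * \<tau> + K * \<rho> ^ k"
      using assms(2) * by (simp add: inner_diff_left)
  qed simp
  then show ?thesis unfolding order_flat_def by (intro exI[of _ 1] conjI exI[of _ 0]) auto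
qed

text \<open>The components of \<open>f\<close> in \<open>J\<close> are coordinates, those of the parameters \<open>Y\<close>. The derivatives of the
  other components in the remaining directions vanish on \<open>A\<close> and are of class \<open>C^(k-1)\<close>, so
  \<open>flat_decomposition\<close> applies to them, and integrating once yields flatness of order \<open>k\<close> for \<open>f\<close>.\<close>

lemma degenerate_image_null:
  fixes f :: "'a::euclidean_space \<Rightarrow> 'b::euclidean_space"
  assumes "open U" "Ck k U f" "1 \<le> k" "S \<subseteq> Basis" "A \<subseteq> U \<inter> coords S"
    and Y: "\<sigma> ` J \<subset> S" and straight: "\<And>x b. x \<in> U \<Longrightarrow> b \<in> J \<Longrightarrow> f x \<bullet> b = x \<bullet> \<sigma> b"
    and crit: "\<And>a b c. a \<in> A \<Longrightarrow> b \<in> Basis - J \<Longrightarrow> c \<in> S - \<sigma> ` J \<Longrightarrow> deriv_at f a c \<bullet> b = 0"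
  shows "hnull (real (card (\<sigma> ` J)) + real (card (S - \<sigma> ` J)) / real k) (f ` A)"
proof -
  let ?Y = "\<sigma> ` J"
  obtain k' where k': "k = Suc k'" using assms(3) by (cases k) auto
  have YS: "?Y \<subseteq> S" "?Y \<noteq> S" using Y by auto
  have fd: "(f has_derivative deriv_at f x) (at x)" if "x \<in> U" for x
    using Ck_has_derivative[OF assms(1-3) that] .
  have dfb: "deriv_at (\<lambda>x. f x \<bullet> b) x v = deriv_at f x v \<bullet> b" if "x \<in> U" for x v b
    using frechet_derivative_at[OF has_derivative_inner_left[OF fd[OF that]]] by metis
  show ?thesis
  proof (rule hnull_covered_by[OF flat_decomposition[OF YS(1) assms(4,1,5), of k']])
    fix P assume "flat_piece k' U S ?Y A P"
    then obtain T l r \<psi> B where B: "P \<subseteq> A" "patch U S ?Y T l r \<psi> B" "P = \<psi> ` B"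
      and flat: "\<And>g::'a \<Rightarrow> real. Ck k' U g \<and> (\<forall>a\<in>A. g a = 0) \<Longrightarrow>
        order_flat ?Y S T (cbox l r \<inter> coords T) B k' (\<lambda>x. g (\<psi> x))"
      unfolding flat_piece_def by blast
    let ?D = "cbox l r \<inter> coords T"
    obtain W where W: "open W" "cbox l r \<subseteq> W" "\<psi> ` W \<subseteq> U"
      "\<And>x b. x \<in> W \<Longrightarrow> b \<in> ?Y \<union> (Basis - S) \<Longrightarrow> \<psi> x \<bullet> b = x \<bullet> b"
    proof -
      from B(2) have "\<exists>W. open W \<and> cbox l r \<subseteq> W \<and> Ck 1 W \<psi> \<and> \<psi> ` W \<subseteq> U \<and>
          (\<forall>x\<in>W. \<forall>b\<in>?Y \<union> (Basis - S). \<psi> x \<bullet> b = x \<bullet> b)"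
        unfolding patch_def by simp
      then show thesis by (elim exE conjE) (rule that, auto)
    qed
    have T: "?Y \<subseteq> T" "T \<subseteq> S" "B \<subseteq> ?D" using B(2) unfolding patch_def by auto
    have "order_flat ?Y S T ?D B k (\<lambda>x. f (\<psi> x))"
    proof (rule order_flat_components)
      fix b :: 'b assume b: "b \<in> Basis"
      show "order_flat ?Y S T ?D B k (\<lambda>x. f (\<psi> x) \<bullet> b)"
      proof (cases "b \<in> J")
        case True
        show ?thesis
        proof (rule order_flat_coordinate[of "\<sigma> b"])
          fix x assume "x \<in> ?D \<union> B"
          then have x: "x \<in> W" using T(3) W(2) by blast
          then have "\<psi> x \<in> U" using W(3) by blast
          then show "f (\<psi> x) \<bullet> b = x \<bullet> \<sigma> b" using straight[OF _ True] W(4)[OF x] True by auto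
        qed (use True in blast)
      next
        case False
        have CB: "Ck k U (\<lambda>x. f x \<bullet> b)" using Ck_inner_left[OF assms(1,2)] .
        have "order_flat ?Y S T ?D B (Suc k') (\<lambda>x. f (\<psi> x) \<bullet> b)"
        proof (rule order_flat_integrate[OF assms(1) _ assms(4) B(2), where f = "\<lambda>x. f x \<bullet> b"])
          show "Ck 1 U (\<lambda>x. f x \<bullet> b)" using Ck_mono[OF assms(1) CB assms(3)] .
          have zero: "deriv_at (\<lambda>x. f x \<bullet> b) a c = 0" if "a \<in> A" "c \<in> S - ?Y" for a c
            using crit[OF that(1) _ that(2)] dfb[of a b c] that(1) assms(5) b False by auto
          show "order_flat ?Y S T ?D B k' (\<lambda>x. deriv_at (\<lambda>x. f x \<bullet> b) (\<psi> x) c)" if "c \<in> S - ?Y" for c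
          proof (rule flat, intro conjI ballI)
            show "Ck k' U (\<lambda>x. deriv_at (\<lambda>x. f x \<bullet> b) x c)"
              using Ck_SucD(2)[OF assms(1)] CB unfolding k' .
          qed (use zero that in blast)
          show "deriv_at (\<lambda>x. f x \<bullet> b) (\<psi> y) c = 0" if "y \<in> B" "c \<in> S - ?Y" for y c
            using zero[OF _ that(2)] B(1,3) that(1) by blast
        qed
        then show ?thesis unfolding k' .
      qed
    qed
    from order_flat_image_null[OF this T(1,2) assms(4) T(3) assms(3) YS(2)]
    show "hnull (real (card ?Y) + real (card (S - ?Y)) / real k) (f ` P)"
      unfolding B(3) image_image .
  qed
qed

lemma hnull_local:
  fixes A :: "'a::euclidean_space set"
  assumes "\<And>a. a \<in> A \<Longrightarrow> \<exists>V. open V \<and> a \<in> V \<and> hnull s (f ` (A \<inter> V))"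
  shows "hnull s (f ` A)"
proof (rule hnull_covered_by)
  show "covered_by (\<lambda>A'. hnull s (f ` A')) A"
  proof (rule covered_by_local)
    fix a assume "a \<in> A"
    then obtain V where V: "open V" "a \<in> V" "hnull s (f ` (A \<inter> V))" using assms by blast
    have "covered_by (\<lambda>A'. hnull s (f ` A')) (A \<inter> V)"
      using V(3) by (intro covered_byI[of "{A \<inter> V}"]) auto
    then show "\<exists>V. open V \<and> a \<in> V \<and> covered_by (\<lambda>A'. hnull s (f ` A')) (A \<inter> V)"
      using V by blast
  qed
qed

lemma hnull_Un: "hnull s A \<Longrightarrow> hnull s B \<Longrightarrow> hnull s (A \<union> B)"
  using hnull_UN[of "{True, False}" s "\<lambda>i. if i then A else B"] by (simp add: Un_commute)

lemma deriv_nonzero_direction: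
  fixes L :: "'a::euclidean_space \<Rightarrow> real"
  assumes "linear L" "v \<in> coords S" "L v \<noteq> 0"
  obtains c where "c \<in> S" "c \<in> Basis" "L c \<noteq> 0"
proof -
  have "L v = (\<Sum>c\<in>Basis. (v \<bullet> c) *\<^sub>R L c)" by (rule linear_expand_Basis[OF assms(1)])
  moreover have "(\<Sum>c\<in>Basis. (v \<bullet> c) *\<^sub>R L c) = 0" if "\<forall>c\<in>Basis. (v \<bullet> c) *\<^sub>R L c = 0"
    using that by (rule sum.neutral)
  ultimately have "\<not> (\<forall>c\<in>Basis. (v \<bullet> c) *\<^sub>R L c = 0)" using assms(3) by argo
  then obtain c where c: "c \<in> Basis" "(v \<bullet> c) *\<^sub>R L c \<noteq> 0" by blast
  then have "c \<in> S" using assms(2) by (auto simp: coords_def)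
  then show thesis using that c by simp
qed

text \<open>The induction is on the number of components of \<open>f\<close> that are not yet coordinates. Where all their
  derivatives in the free directions vanish, \<open>degenerate_image_null\<close> applies with \<open>\<nu> = card J\<close>. Here
  \<open>\<nu> \<le> DIM('b) - 1\<close>, since the derivative would be onto if all components were coordinates, and the
  exponent \<open>\<nu> + (card S - \<nu>) / k\<close> increases with \<open>\<nu>\<close>. Near the other points one more component is
  made a coordinate.\<close>

lemma sard_straightened:
  fixes f :: "'a::euclidean_space \<Rightarrow> 'b::euclidean_space"
  assumes "open U" "Ck k U f" "1 \<le> k" "S \<subseteq> Basis" "DIM('b) \<le> card S" "A \<subseteq> U \<inter> coords S"
    and "J \<subseteq> Basis" "inj_on \<sigma> J" "\<sigma> ` J \<subseteq> S"
    and "\<And>x b. x \<in> U \<Longrightarrow> b \<in> J \<Longrightarrow> f x \<bullet> b = x \<bullet> \<sigma> b"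
    and "\<And>a. a \<in> A \<Longrightarrow> \<exists>\<mu>. \<mu> \<noteq> 0 \<and> (\<forall>v\<in>coords S. deriv_at f a v \<bullet> \<mu> = 0)"
  shows "hnull (real DIM('b) - 1 + (real (card S) - real DIM('b) + 1) / real k) (f ` A)"
  using assms
proof (induction "card (Basis - J)" arbitrary: U f A J \<sigma> rule: less_induct)
  case less
  let ?s = "real DIM('b) - 1 + (real (card S) - real DIM('b) + 1) / real k"
  let ?Y = "\<sigma> ` J"
  note oU = less.prems(1) and Cf = less.prems(2) and SB = less.prems(4)
  have finS: "finite S" using SB finite_Basis finite_subset by blast
  have fd: "(f has_derivative deriv_at f x) (at x)" if "x \<in> U" for x
    using Ck_has_derivative[OF oU Cf less.prems(3) that] .
  define A0 where "A0 = {a \<in> A. \<forall>b\<in>Basis - J. \<forall>c\<in>S - ?Y. deriv_at f a c \<bullet> b = 0}"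
  have "hnull ?s (f ` A0)"
  proof (cases "A0 = {}")
    case True
    then show ?thesis by (simp add: hnull_empty)
  next
    case False
    then obtain a where a: "a \<in> A" unfolding A0_def by blast
    have aU: "a \<in> U" using a less.prems(6) by blast
    have "J \<noteq> Basis"
    proof
      assume J: "J = Basis"
      obtain \<mu> where \<mu>: "\<mu> \<noteq> 0" "\<forall>v\<in>coords S. deriv_at f a v \<bullet> \<mu> = 0" using less.prems(11)[OF a] by blast
      have "\<mu> \<bullet> b = 0" if b: "b \<in> Basis" for b
      proof -
        have \<sigma>b: "\<sigma> b \<in> S" "\<sigma> b \<in> Basis" using less.prems(9) b J SB by auto
        have comp: "deriv_at f a (\<sigma> b) \<bullet> b' = (if b' = b then 1 else 0)" if b': "b' \<in> Basis" for b'
        proof -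
          have "deriv_at f a (\<sigma> b) \<bullet> b' = \<sigma> b \<bullet> \<sigma> b'"
          proof -
            have "((\<lambda>x. f x \<bullet> b') has_derivative (\<lambda>v. v \<bullet> \<sigma> b')) (at a)"
              by (rule has_derivative_transform_within_open[OF _ oU aU, of "\<lambda>x. x \<bullet> \<sigma> b'"])
                 (use less.prems(10) b' J in \<open>auto intro!: derivative_eq_intros\<close>)
            then have "(\<lambda>v. deriv_at f a v \<bullet> b') = (\<lambda>v. v \<bullet> \<sigma> b')"
              by (rule has_derivative_unique[OF has_derivative_inner_left[OF fd[OF aU], of b']])
            then show ?thesis by (rule fun_cong)
          qed
          also have "\<dots> = (if b' = b then 1 else 0)"
          proof -
            have "\<sigma> b' \<in> Basis" "\<sigma> b = \<sigma> b' \<longleftrightarrow> b = b'"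
              using less.prems(8,9) SB b b' J by (auto simp: inj_on_def)
            then show ?thesis using \<sigma>b by (simp add: inner_Basis)
          qed
          finally show ?thesis .
        qed
        have "deriv_at f a (\<sigma> b) = b"
        proof (rule euclidean_eqI)
          fix b' :: 'b assume "b' \<in> Basis"
          then show "deriv_at f a (\<sigma> b) \<bullet> b' = b \<bullet> b'" using comp[of b'] b
            by (cases "b' = b") (simp_all add: inner_Basis)
        qed
        moreover have "\<sigma> b \<in> coords S" using \<sigma>b by (auto simp: coords_def inner_Basis)
        ultimately show ?thesis using \<mu>(2) by (metis inner_commute)
      qed
      then have "\<forall>b\<in>Basis. \<mu> \<bullet> b = 0" ..
      then have "\<mu> = 0" unfolding euclidean_all_zero_iff .
      then show False using \<mu>(1) by blast
    qed
    then have "J \<subset> Basis" using less.prems(7) by blast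
    then have "card J < DIM('b)" by (intro psubset_card_mono) auto
    moreover have cY: "card ?Y = card J" using less.prems(8) by (rule card_image)
    ultimately have cYb: "card ?Y < DIM('b)" by simp
    then have YS: "?Y \<subset> S" using less.prems(5,9) by auto
    have "hnull (real (card ?Y) + real (card (S - ?Y)) / real k) (f ` A0)"
    proof (rule degenerate_image_null[OF oU Cf less.prems(3) SB _ YS less.prems(10)])
      show "A0 \<subseteq> U \<inter> coords S" using less.prems(6) by (auto simp: A0_def)
    qed (auto simp: A0_def)
    then show ?thesis
    proof (rule hnull_mono_exponent)
      have k: "1 \<le> real k" using less.prems(3) by simp
      have "card ?Y < card S" using YS finS psubset_card_mono by blast
      moreover have cd: "real (card (S - ?Y)) = real (card S) - real (card ?Y)"
        using less.prems(9) finS by (simp add: card_Diff_subset finite_subset card_mono of_nat_diff)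
      ultimately have "0 < real (card (S - ?Y)) / real k" using k by simp
      then show "0 < real (card ?Y) + real (card (S - ?Y)) / real k" by simp
      have "0 \<le> (real DIM('b) - 1 - real (card ?Y)) * (1 - 1 / real k)"
        using cYb k by (intro mult_nonneg_nonneg) auto
      also have "\<dots> = ?s - (real (card ?Y) + (real (card S) - real (card ?Y)) / real k)"
        by (simp add: algebra_simps add_divide_distrib diff_divide_distrib)
      finally show "real (card ?Y) + real (card (S - ?Y)) / real k \<le> ?s" unfolding cd by simp
    qed
  qed
  moreover have "hnull ?s (f ` (A - A0))"
  proof (rule hnull_local)
    fix a assume a: "a \<in> A - A0"
    then obtain b c where b: "b \<in> Basis - J" and c: "c \<in> S - ?Y" and bc: "deriv_at f a c \<bullet> b \<noteq> 0"
      unfolding A0_def by blast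
    have aU: "a \<in> U" and cB: "c \<in> Basis" using a c less.prems(6) SB by auto
    define u where "u x = f x \<bullet> b" for x
    have Cu: "Ck k U u" unfolding u_def by (rule Ck_inner_left[OF oU Cf])
    have "deriv_at u a c = deriv_at f a c \<bullet> b"
      unfolding u_def using frechet_derivative_at[OF has_derivative_inner_left[OF fd[OF aU]]] by metis
    then have "deriv_at u a c \<noteq> 0" using bc by simp
    then obtain V W \<psi> where aV: "a \<in> V" and st: "straightening k U u c V W \<psi>"
      using straightening_exists[OF oU Cu less.prems(3) aU cB] by blast
    interpret straightening k U u c V W \<psi> by (rule st)
    let ?\<sigma> = "\<sigma>(b := c)"
    have im: "f ` (A \<inter> V) = (\<lambda>w. f (\<psi> w)) ` push A"
      using psi_push[of A] by (metis image_image)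
    have "hnull ?s ((\<lambda>w. f (\<psi> w)) ` push A)"
    proof (rule less.hyps[of "insert b J" W "\<lambda>w. f (\<psi> w)" "push A" ?\<sigma>])
      show "card (Basis - insert b J) < card (Basis - J)"
        using b by (intro psubset_card_mono) auto
      show "Ck k W (\<lambda>w. f (\<psi> w))" by (rule Ck_comp[OF Cf])
      show "push A \<subseteq> W \<inter> coords S"
        using push_sub push_coords[of A S] less.prems(6) c by blast
      show "insert b J \<subseteq> Basis" using b less.prems(7) by blast
      have J\<sigma>: "?\<sigma> j = \<sigma> j" if "j \<in> J" for j using that b by auto
      then have "?\<sigma> ` J = ?Y" by (metis image_cong)
      then show "?\<sigma> ` insert b J \<subseteq> S" using c less.prems(9) by auto
      show "inj_on ?\<sigma> (insert b J)"
        using less.prems(8) c b by (auto simp: inj_on_def)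
      show "f (\<psi> w) \<bullet> j = w \<bullet> ?\<sigma> j" if w: "w \<in> W" and j: "j \<in> insert b J" for w j
      proof (cases "j = b")
        case True
        then show ?thesis using u_psi[OF w] by (simp add: u_def)
      next
        case False
        then have jJ: "j \<in> J" using j by blast
        have "\<psi> w \<in> U" using psi_U w by blast
        then have "f (\<psi> w) \<bullet> j = \<psi> w \<bullet> \<sigma> j" using less.prems(10) jJ by blast
        also have "\<dots> = w \<bullet> \<sigma> j"
          by (rule psi_inner[OF w]) (use jJ c less.prems(9) SB in auto)
        finally show ?thesis using False by simp
      qed
      show "\<exists>\<mu>. \<mu> \<noteq> 0 \<and> (\<forall>v\<in>coords S. deriv_at (\<lambda>w. f (\<psi> w)) w v \<bullet> \<mu> = 0)" if w: "w \<in> push A" for w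
      proof -
        have wW: "w \<in> W" using w push_sub by blast
        obtain \<mu> where \<mu>: "\<mu> \<noteq> 0" "\<forall>v\<in>coords S. deriv_at f (\<psi> w) v \<bullet> \<mu> = 0"
          using less.prems(11)[OF pushD[OF w]] by blast
        then show ?thesis
          using deriv_comp[OF Cf wW] deriv_psi_coords[OF wW] c by (intro exI[of _ \<mu>]) auto
      qed
    qed (use open_W less.prems in auto)
    then have "hnull ?s (f ` (A \<inter> V))" unfolding im .
    then have "hnull ?s (f ` ((A - A0) \<inter> V))" by (rule hnull_subset) blast
    then show "\<exists>V. open V \<and> a \<in> V \<and> hnull ?s (f ` ((A - A0) \<inter> V))" using open_V aV by blast
  qed
  moreover have "f ` A = f ` A0 \<union> f ` (A - A0)" by (auto simp: A0_def)
  ultimately show ?case using hnull_Un by metis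
qed

text \<open>The Morse-Sard-Federer theorem for the restriction of \<open>f\<close> to the submanifold \<open>u_i = 0\<close>, \<open>i \<in> Q\<close>.
  Making \<open>u_i\<close> a coordinate \<open>c\<close> turns the equation \<open>u_i = 0\<close> into a restriction to \<open>coords (S - {c})\<close>;
  the tangent vectors of the submanifold correspond to each other, so the independence of the
  other equations and the criticality of the points are preserved.\<close>

theorem sard_constrained:
  fixes f :: "'a::euclidean_space \<Rightarrow> 'b::euclidean_space" and u :: "'i \<Rightarrow> 'a \<Rightarrow> real"
  assumes "finite Q" "open U" "Ck k U f" "1 \<le> k" "\<And>i. i \<in> Q \<Longrightarrow> Ck k U (u i)"
    and "S \<subseteq> Basis" "DIM('b) + card Q \<le> card S" "A \<subseteq> U \<inter> coords S"
    and "\<And>a i. a \<in> A \<Longrightarrow> i \<in> Q \<Longrightarrow> u i a = 0"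
    and "\<And>a y. a \<in> A \<Longrightarrow> \<exists>v\<in>coords S. \<forall>i\<in>Q. deriv_at (u i) a v = y i"
    and "\<And>a. a \<in> A \<Longrightarrow>
      \<exists>\<mu>. \<mu> \<noteq> 0 \<and> (\<forall>v\<in>coords S. (\<forall>i\<in>Q. deriv_at (u i) a v = 0) \<longrightarrow> deriv_at f a v \<bullet> \<mu> = 0)"
  shows "hnull (real DIM('b) - 1 + (real (card S) - real (card Q) - real DIM('b) + 1) / real k) (f ` A)"
  using assms
proof (induction Q arbitrary: U f u A S rule: finite_induct)
  case empty
  have "hnull (real DIM('b) - 1 + (real (card S) - real DIM('b) + 1) / real k) (f ` A)"
    by (rule sard_straightened[OF empty(1-3,5) _ empty(7), of "{}"]) (use empty in auto)
  then show ?case by simp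
next
  case (insert i Q)
  note oU = insert.prems(1) and Cf = insert.prems(2) and SB = insert.prems(5)
  let ?s = "real DIM('b) - 1 + (real (card S) - real (card (insert i Q)) - real DIM('b) + 1) / real k"
  have Cu: "Ck k U (u j)" if "j \<in> insert i Q" for j using insert.prems(4) that .
  have finS: "finite S" using SB finite_Basis finite_subset by blast
  show ?case
  proof (rule hnull_local)
    fix a assume a: "a \<in> A"
    have aU: "a \<in> U" using a insert.prems(7) by blast
    obtain v where v: "v \<in> coords S" "deriv_at (u i) a v = 1"
      using insert.prems(9)[OF a, of "\<lambda>_. 1"] by blast
    have "linear (deriv_at (u i) a)"
      using has_derivative_linear[OF Ck_has_derivative[OF oU Cu insert.prems(3) aU]] by blast
    then obtain c where c: "c \<in> S" "c \<in> Basis" "deriv_at (u i) a c \<noteq> 0"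
      using deriv_nonzero_direction[OF _ v(1), of "deriv_at (u i) a"] v(2) by auto
    obtain V W \<psi> where aV: "a \<in> V" and st: "straightening k U (u i) c V W \<psi>"
      using straightening_exists[OF oU Cu insert.prems(3) aU c(2,3)] by blast
    interpret straightening k U "u i" c V W \<psi> by (rule st)
    have im: "f ` (A \<inter> V) = (\<lambda>w. f (\<psi> w)) ` push A"
      using psi_push[of A] by (metis image_image)
    have card: "card (insert i Q) = Suc (card Q)" "card (S - {c}) = card S - 1" "1 \<le> card S"
      using insert.hyps c(1) finS card_gt_0_iff[of S] by (auto simp: Suc_le_eq)
    have "hnull (real DIM('b) - 1 + (real (card (S - {c})) - real (card Q) - real DIM('b) + 1) / real k)
        ((\<lambda>w. f (\<psi> w)) ` push A)"
    proof (rule insert.IH[of W "\<lambda>w. f (\<psi> w)" "\<lambda>j w. u j (\<psi> w)" "S - {c}" "push A"])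
      show "Ck k W (\<lambda>w. f (\<psi> w))" by (rule Ck_comp[OF Cf])
      show "Ck k W (\<lambda>w. u j (\<psi> w))" if "j \<in> Q" for j by (rule Ck_comp[OF Cu]) (use that in blast)
      show "DIM('b) + card Q \<le> card (S - {c})" using insert.prems(6) card by simp
      show "push A \<subseteq> W \<inter> coords (S - {c})"
        using push_sub push_coords_zero[of A S] insert.prems(7,8) by blast
      show "u j (\<psi> w) = 0" if "w \<in> push A" "j \<in> Q" for w j
        using insert.prems(8)[OF pushD[OF that(1)]] that(2) by blast
      show "\<exists>v\<in>coords (S - {c}). \<forall>j\<in>Q. deriv_at (\<lambda>w. u j (\<psi> w)) w v = y j" if w: "w \<in> push A" for w y
      proof -
        have wW: "w \<in> W" using w push_sub by blast
        obtain v where v: "v \<in> coords S" "\<forall>j\<in>insert i Q. deriv_at (u j) (\<psi> w) v = (y(i := 0)) j"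
          using insert.prems(9)[OF pushD[OF w], of "y(i := 0)"] by blast
        let ?v = "v - (v \<bullet> c) *\<^sub>R c"
        have "deriv_at \<psi> w ?v = v" by (rule deriv_psi_tangent[OF wW]) (use v(2) in simp)
        moreover have "deriv_at (u j) (\<psi> w) v = y j" if "j \<in> Q" for j
          using v(2) that insert.hyps(2) by auto
        ultimately have "\<forall>j\<in>Q. deriv_at (\<lambda>w. u j (\<psi> w)) w ?v = y j"
          using deriv_comp[OF Cu wW] by auto
        moreover have "?v \<in> coords (S - {c})"
          using v(1) c(2) by (auto simp: coords_def inner_diff_left inner_Basis)
        ultimately show ?thesis by blast
      qed
      show "\<exists>\<mu>. \<mu> \<noteq> 0 \<and> (\<forall>v\<in>coords (S - {c}). (\<forall>j\<in>Q. deriv_at (\<lambda>w. u j (\<psi> w)) w v = 0) \<longrightarrow>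
          deriv_at (\<lambda>w. f (\<psi> w)) w v \<bullet> \<mu> = 0)" if w: "w \<in> push A" for w
      proof -
        have wW: "w \<in> W" using w push_sub by blast
        obtain \<mu> where \<mu>: "\<mu> \<noteq> 0"
          "\<And>v. v \<in> coords S \<Longrightarrow> \<forall>j\<in>insert i Q. deriv_at (u j) (\<psi> w) v = 0 \<Longrightarrow> deriv_at f (\<psi> w) v \<bullet> \<mu> = 0"
          using insert.prems(10)[OF pushD[OF w]] by blast
        have "deriv_at (\<lambda>w. f (\<psi> w)) w v \<bullet> \<mu> = 0"
          if v: "v \<in> coords (S - {c})" "\<forall>j\<in>Q. deriv_at (\<lambda>w. u j (\<psi> w)) w v = 0" for v
        proof -
          have vS: "v \<in> coords S" and vc: "v \<bullet> c = 0" using v(1) c by (auto simp: coords_def)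
          have "\<forall>j\<in>insert i Q. deriv_at (u j) (\<psi> w) (deriv_at \<psi> w v) = 0"
            using v(2) deriv_comp[OF Cu wW] deriv_u_psi[OF wW] vc by auto
          then show ?thesis
            using \<mu>(2)[OF deriv_psi_coords[OF wW vS c(1)]] deriv_comp[OF Cf wW] by simp
        qed
        then show ?thesis using \<mu>(1) by blast
      qed
    qed (use open_W insert.prems(3) SB in auto)
    then have "hnull ?s (f ` (A \<inter> V))" unfolding im using card by (simp add: of_nat_diff)
    then show "\<exists>V. open V \<and> a \<in> V \<and> hnull ?s (f ` (A \<inter> V))" using open_V aV by blast
  qed
qed

section \<open>Perturbing finitely many branches\<close>

lemma Ck_vec_nth: "open U \<Longrightarrow> Ck k U f \<Longrightarrow> Ck k U (\<lambda>x. f x $ j)" for f :: "'a::real_normed_vector \<Rightarrow> real^'l"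
  by (rule Ck_bounded_linear[OF _ bounded_linear_vec_nth])

lemma bounded_bilinear_matrix_vector: "bounded_bilinear (\<lambda>(P::real^'m^'l) x. P *v x)"
  unfolding bilinear_conv_bounded_bilinear[symmetric]
  by (auto simp: bilinear_def linear_iff matrix_vector_mult_add_rdistrib matrix_vector_right_distrib
      scaleR_matrix_vector_assoc matrix_vector_mult_scaleR)

text \<open>The space of \<open>d\<close> points of \<open>R^n\<close> and a matrix, of dimension \<open>d n + m l\<close>, as a coordinate subspace of
  a space with a fixed index type. Points of it vanish at the indices that number none of the \<open>d\<close>
  points.\<close>

lemma config_coordinates:
  fixes \<iota> :: "nat \<Rightarrow> 'i::finite"
  assumes "inj_on \<iota> {1..d}"
  obtains S :: "(((real^'n)^'i) \<times> (real^'m^'l)) set" where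
    "S \<subseteq> Basis" "card S = d * CARD('n) + CARD('m) * CARD('l)"
    "\<And>x P. (\<And>j. j \<notin> \<iota> ` {1..d} \<Longrightarrow> x $ j = 0) \<Longrightarrow> (x, P) \<in> coords S"
proof -
  define S1 :: "(((real^'n)^'i) \<times> (real^'m^'l)) set" where "S1 = (\<lambda>(i, u). (axis (\<iota> i) u, 0)) ` ({1..d} \<times> (Basis :: (real^'n) set))"
  define S2 :: "(((real^'n)^'i) \<times> (real^'m^'l)) set" where "S2 = (\<lambda>P. (0, P)) ` (Basis :: (real^'m^'l) set)"
  define S :: "(((real^'n)^'i) \<times> (real^'m^'l)) set" where "S = S1 \<union> S2"
  have B: "(Basis :: (((real^'n)^'i) \<times> (real^'m^'l)) set) = (\<lambda>x. (x, 0)) ` Basis \<union> (\<lambda>P. (0, P)) ` Basis"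
    by (rule Basis_prod_def)
  have "S \<subseteq> Basis"
    unfolding S_def S1_def S2_def B by (auto simp: Basis_vec_def)
  moreover have "card S = d * CARD('n) + CARD('m) * CARD('l)"
  proof -
    have "inj_on (\<lambda>(i, u). (axis (\<iota> i) u, 0::real^'m^'l)) ({1..d} \<times> (Basis :: (real^'n) set))"
    proof (rule inj_onI)
      fix p q :: "nat \<times> (real^'n)"
      assume p: "p \<in> {1..d} \<times> Basis" and q: "q \<in> {1..d} \<times> Basis"
        and eq: "(case p of (i, u) \<Rightarrow> (axis (\<iota> i) u, 0::real^'m^'l)) = (case q of (i, u) \<Rightarrow> (axis (\<iota> i) u, 0))"
      have "axis (\<iota> (fst p)) (snd p) = axis (\<iota> (fst q)) (snd q)" using eq by (simp add: case_prod_beta)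
      moreover have "snd p \<noteq> 0" using p by (auto simp: nonzero_Basis)
      ultimately have "\<iota> (fst p) = \<iota> (fst q)" "snd p = snd q" by (auto simp: axis_eq_axis)
      moreover have "fst p \<in> {1..d}" "fst q \<in> {1..d}" using p q by auto
      ultimately show "p = q" using inj_onD[OF assms] by (metis prod.expand)
    qed
    then have "card S1 = d * CARD('n)" unfolding S1_def
      by (subst card_image) (auto simp: card_cartesian_product)
    moreover have "card S2 = CARD('m) * CARD('l)" unfolding S2_def
      by (subst card_image) (auto simp: inj_on_def)
    moreover have "S1 \<inter> S2 = {}"
      unfolding S1_def S2_def by auto
    moreover have "finite S1" "finite S2" unfolding S1_def S2_def by auto
    ultimately show ?thesis unfolding S_def by (simp add: card_Un_disjoint)
  qed
  moreover have "(x, P) \<in> coords S" if x: "\<And>j. j \<notin> \<iota> ` {1..d} \<Longrightarrow> x $ j = 0" for x P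
  proof -
    have "(x, P) \<bullet> b = 0" if b: "b \<in> Basis - S" for b
    proof -
      have "b \<notin> (\<lambda>P. (0, P)) ` Basis" using b unfolding S_def S2_def by blast
      then obtain y where y: "y \<in> Basis" "b = (y, 0)" using b unfolding B by blast
      then obtain j u where ju: "y = axis j u" "u \<in> Basis" by (auto simp: Basis_vec_def)
      have "j \<notin> \<iota> ` {1..d}"
      proof
        assume "j \<in> \<iota> ` {1..d}"
        then have "b \<in> S1" unfolding S1_def using y ju by force
        then show False using b unfolding S_def by blast
      qed
      then show ?thesis using x y ju by (simp add: inner_axis)
    qed
    then show ?thesis by (simp add: coords_def)
  qed
  ultimately show thesis using that by blast
qed

text \<open>The mapping \<open>(g + P) \<circ> f\<close> in a chart; \<open>F\<close> is \<open>f\<close> in the chart.\<close>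

definition branch :: "(real^'m \<Rightarrow> real^'l) \<Rightarrow> (real^'n \<Rightarrow> real^'m) \<Rightarrow> real^'m^'l \<Rightarrow> real^'n \<Rightarrow> real^'l"
  where "branch g F P x = g (F x) + P *v F x"

text \<open>The product of the mappings \<open>L i\<close> is onto modulo the diagonal.\<close>

definition differences_onto :: "nat \<Rightarrow> (nat \<Rightarrow> 'e \<Rightarrow> 'f::ab_group_add) \<Rightarrow> bool"
  where "differences_onto d L \<longleftrightarrow> (\<forall>z. \<exists>w. \<forall>i\<in>{2..d}. L i (w i) - L 1 (w 1) = z i)"

text \<open>The set consists of the matrices \<open>P\<close> such that \<open>d\<close> branches have a common value at points in general
  position, where the differences of their derivatives fail to be onto. It is the image under the
  projection \<open>(x, P) \<mapsto> P\<close> of a set \<open>A\<close> of zeros of the functions \<open>u (i, j)\<close>, the components of the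
  differences of the branches. These are independent on \<open>A\<close>: by general position their derivatives
  in \<open>P\<close> alone are onto. If the projection had onto derivative at a point of \<open>A\<close>, restricted to
  the tangent space of the zero set, then every \<open>P\<close>-variation \<open>R\<close> could be compensated by a variation
  of \<open>x\<close>; choosing \<open>R\<close> to move the differences by \<open>- z\<close> shows that the derivatives in \<open>x\<close> reach every
  \<open>z\<close>, contrary to the assumption. The type \<open>'m option\<close> serves as index type for the points since it
  has \<open>m + 1 \<ge> d\<close> elements.\<close>

theorem degenerate_crossings_null:
  fixes D :: "nat \<Rightarrow> (real^'n) set" and F :: "nat \<Rightarrow> real^'n \<Rightarrow> real^'m" and g :: "real^'m \<Rightarrow> real^'l"
  assumes d: "1 \<le> d" "d \<le> CARD('m) + 1" and r: "1 \<le> r" and ln: "CARD('l) \<le> CARD('n)"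
    and D: "\<And>i. i \<in> {1..d} \<Longrightarrow> open (D i)" and F: "\<And>i. i \<in> {1..d} \<Longrightarrow> Ck r (D i) (F i)"
    and FV: "\<And>i. i \<in> {1..d} \<Longrightarrow> F i ` D i \<subseteq> V" and V: "open V" and g: "Ck r V g"
  shows "hnull (real CARD('m) * real CARD('l) - 1 +
      (real d * (real CARD('n) - real CARD('l)) + real CARD('l) + 1) / real r)
    {P. \<exists>x. (\<forall>i\<in>{1..d}. x i \<in> D i) \<and>
       (\<forall>y. \<exists>R::real^'m^'l. \<forall>i\<in>{2..d}. R *v (F i (x i) - F 1 (x 1)) = y i) \<and>
       (\<forall>i\<in>{2..d}. branch g (F i) P (x i) = branch g (F 1) P (x 1)) \<and>
       \<not> differences_onto d (\<lambda>i. deriv_at (branch g (F i) P) (x i))}"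
    (is "hnull ?s ?B")
proof -
  have "card {1..d} \<le> card (UNIV :: 'm option set)" using d by (simp add: card_UNIV_option)
  then obtain \<iota> :: "nat \<Rightarrow> 'm option" where \<iota>: "inj_on \<iota> {1..d}"
    using card_le_inj[of "{1..d}" "UNIV :: 'm option set"] by auto
  obtain S :: "(((real^'n)^('m option)) \<times> (real^'m^'l)) set" where S: "S \<subseteq> Basis"
    "card S = d * CARD('n) + CARD('m) * CARD('l)"
    "\<And>x P. (\<And>j. j \<notin> \<iota> ` {1..d} \<Longrightarrow> x $ j = 0) \<Longrightarrow> (x, P) \<in> coords S"
    using config_coordinates[OF \<iota>] by blast
  define U :: "(((real^'n)^('m option)) \<times> (real^'m^'l)) set"
    where "U = (\<Inter>i\<in>{1..d}. {p. fst p $ \<iota> i \<in> D i})"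
  have at: "bounded_linear (\<lambda>p::((real^'n)^('m option)) \<times> (real^'m^'l). fst p $ \<iota> i)" for i
    using bounded_linear_compose[OF bounded_linear_vec_nth bounded_linear_fst] .
  have oU: "open U" unfolding U_def
  proof (intro open_INT ballI)
    fix i assume i: "i \<in> {1..d}"
    have "continuous_on UNIV (\<lambda>p::((real^'n)^('m option)) \<times> (real^'m^'l). fst p $ \<iota> i)"
      using at by (rule linear_continuous_on)
    then show "open {p::((real^'n)^('m option)) \<times> (real^'m^'l). fst p $ \<iota> i \<in> D i}"
      using open_vimage[OF D[OF i]] by (simp add: vimage_def)
  qed simp
  have UO: "fst p $ \<iota> i \<in> D i" if "p \<in> U" "i \<in> {1..d}" for p i using that by (auto simp: U_def)
  define H where "H i p = branch g (F i) (snd p) (fst p $ \<iota> i)" for i p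
  have Fp: "Ck r U (\<lambda>p. F i (fst p $ \<iota> i))" if i: "i \<in> {1..d}" for i
    by (rule Ck_compose[OF oU D[OF i] Ck_bounded_linear[OF oU at Ck_ident[OF oU]] F[OF i]]) (use UO i in auto)
  have Csnd: "Ck r U snd" by (rule Ck_bounded_linear[OF oU bounded_linear_snd Ck_ident[OF oU], simplified])
  have CH: "Ck r U (H i)" if i: "i \<in> {1..d}" for i
    unfolding H_def branch_def
  proof (rule Ck_add[OF oU])
    show "Ck r U (\<lambda>p. g (F i (fst p $ \<iota> i)))"
      by (rule Ck_compose[OF oU V Fp[OF i] g]) (use UO i FV in blast)
    show "Ck r U (\<lambda>p. snd p *v F i (fst p $ \<iota> i))"
      by (rule Ck_bilinear[OF bounded_bilinear_matrix_vector oU Csnd Fp[OF i]])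
  qed
  have gF: "Ck r (D i) (\<lambda>y. g (F i y))" if i: "i \<in> {1..d}" for i
    by (rule Ck_compose[OF D[OF i] V F[OF i] g FV[OF i]])
  have Cb: "Ck r (D i) (branch g (F i) P)" if i: "i \<in> {1..d}" for i P
    unfolding branch_def[abs_def]
    by (intro Ck_add D[OF i] gF[OF i] Ck_bilinear[OF bounded_bilinear_matrix_vector] Ck_const F[OF i])
  have dH: "deriv_at (H i) p v = deriv_at (branch g (F i) (snd p)) (fst p $ \<iota> i) (fst v $ \<iota> i) + snd v *v F i (fst p $ \<iota> i)"
    if i: "i \<in> {1..d}" and p: "p \<in> U" for i p v
  proof -
    let ?x = "fst p $ \<iota> i"
    have xO: "?x \<in> D i" using UO p i by blast
    note dF = Ck_has_derivative[OF D[OF i] F[OF i] r xO]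
    note dgF = Ck_has_derivative[OF D[OF i] gF[OF i] r xO]
    have dl: "((\<lambda>p. fst p $ \<iota> i) has_derivative (\<lambda>v. fst v $ \<iota> i)) (at p)"
      using at by (rule bounded_linear_imp_has_derivative)
    have ds: "(snd has_derivative snd) (at p)"
      using bounded_linear_snd by (rule bounded_linear_imp_has_derivative)
    have b: "(branch g (F i) (snd p) has_derivative
        (\<lambda>v. deriv_at (\<lambda>y. g (F i y)) ?x v + (snd p *v deriv_at (F i) ?x v + 0 *v F i ?x))) (at ?x)"
      unfolding branch_def[abs_def]
      by (intro has_derivative_add dgF bounded_bilinear.FDERIV[OF bounded_bilinear_matrix_vector] dF has_derivative_const)
    have h: "(H i has_derivative
       (\<lambda>v. deriv_at (\<lambda>y. g (F i y)) ?x (fst v $ \<iota> i) +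
          (snd p *v deriv_at (F i) ?x (fst v $ \<iota> i) + snd v *v F i ?x))) (at p)"
      unfolding H_def[abs_def] branch_def
      by (intro has_derivative_add bounded_bilinear.FDERIV[OF bounded_bilinear_matrix_vector]
          has_derivative_compose[OF dl dgF] has_derivative_compose[OF dl dF] ds)
    show ?thesis
      unfolding frechet_derivative_at[OF h, symmetric] frechet_derivative_at[OF b, symmetric] by simp
  qed
  define Q where "Q = {2..d} \<times> (UNIV :: 'l set)"
  define u where "u = (\<lambda>(i, j) p. (H i p - H 1 p) $ j)"
  have one: "1 \<in> {1..d}" using d by simp
  have i1: "i \<in> {1..d}" if "i \<in> {2..d}" for i using that by auto
  have Cu: "Ck r U (u q)" if "q \<in> Q" for q
    using that unfolding Q_def u_def
    by (auto intro!: Ck_vec_nth Ck_diff oU CH simp: one[simplified])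
  have du: "deriv_at (u (i, j)) p v = (deriv_at (H i) p v - deriv_at (H 1) p v) $ j"
    if i: "i \<in> {2..d}" and p: "p \<in> U" for i j p v
  proof -
    have "(u (i, j) has_derivative (\<lambda>v. (deriv_at (H i) p v - deriv_at (H 1) p v) $ j)) (at p)"
      unfolding u_def prod.case
      by (intro bounded_linear.has_derivative[OF bounded_linear_vec_nth] has_derivative_diff
          Ck_has_derivative[OF oU CH r p] i1[OF i] one)
    from frechet_derivative_at[OF this, symmetric] show ?thesis by (rule fun_cong)
  qed
  define A where "A = {p \<in> U \<inter> coords S. (\<forall>q\<in>Q. u q p = 0) \<and>
     (\<forall>y. \<exists>R::real^'m^'l. \<forall>i\<in>{2..d}. R *v (F i (fst p $ \<iota> i) - F 1 (fst p $ \<iota> 1)) = y i) \<and>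
     \<not> differences_onto d (\<lambda>i. deriv_at (branch g (F i) (snd p)) (fst p $ \<iota> i))}"
  have cQ: "card Q = (d - 1) * CARD('l)" by (simp add: Q_def card_cartesian_product)
  have Bsub: "?B \<subseteq> snd ` A"
  proof
    fix P assume "P \<in> ?B"
    then obtain x where x: "\<forall>i\<in>{1..d}. x i \<in> D i"
      "\<forall>y. \<exists>R::real^'m^'l. \<forall>i\<in>{2..d}. R *v (F i (x i) - F 1 (x 1)) = y i"
      "\<forall>i\<in>{2..d}. branch g (F i) P (x i) = branch g (F 1) P (x 1)"
      "\<not> differences_onto d (\<lambda>i. deriv_at (branch g (F i) P) (x i))" by blast
    define X :: "(real^'n)^('m option)"
      where "X = (\<chi> j. if j \<in> \<iota> ` {1..d} then x (inv_into {1..d} \<iota> j) else 0)"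
    have X: "X $ \<iota> i = x i" if "i \<in> {1..d}" for i
      using that \<iota> by (simp add: X_def)
    have X': "X $ \<iota> i = x i" if "i \<in> {2..d}" for i using X[OF i1[OF that]] .
    have X1: "X $ \<iota> 1 = x 1" using X[OF one] .
    have XS: "(X, P) \<in> coords S" by (rule S(3)) (simp add: X_def)
    have XU: "(X, P) \<in> U" using x(1) X by (simp add: U_def)
    have "u q (X, P) = 0" if "q \<in> Q" for q
      using that x(3) X' X1 by (auto simp: Q_def u_def H_def)
    then have "(X, P) \<in> A" unfolding A_def using XS XU x(2,4) by (simp add: X' X1[simplified] differences_onto_def)
    then show "P \<in> snd ` A" by force
  qed
  have "hnull (real DIM(real^'m^'l) - 1 + (real (card S) - real (card Q) - real DIM(real^'m^'l) + 1) / real r) (snd ` A)"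
  proof (rule sard_constrained[OF _ oU Csnd r Cu S(1)])
    show "finite Q" by (simp add: Q_def)
    have "DIM(real^'m^'l) + card Q \<le> CARD('m) * CARD('l) + d * CARD('l)"
      unfolding cQ by (simp add: mult.commute)
    also have "\<dots> \<le> card S" unfolding S(2) using ln by (simp add: mult_le_mono)
    finally show "DIM(real^'m^'l) + card Q \<le> card S" .
    show "A \<subseteq> U \<inter> coords S" by (auto simp: A_def)
    show "u q p = 0" if "p \<in> A" "q \<in> Q" for p q using that by (auto simp: A_def)
    fix p assume pA: "p \<in> A"
    let ?L = "\<lambda>i. deriv_at (branch g (F i) (snd p)) (fst p $ \<iota> i)"
    let ?w = "\<lambda>i. F i (fst p $ \<iota> i) - F 1 (fst p $ \<iota> 1)"
    have pU: "p \<in> U" using pA by (simp add: A_def)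
    have dup: "deriv_at (u (i, j)) p v =
       (?L i (fst v $ \<iota> i) -
        ?L 1 (fst v $ \<iota> 1) +
        snd v *v ?w i) $ j" if i: "i \<in> {2..d}" for i j v
      unfolding du[OF i pU] dH[OF i1[OF i] pU] dH[OF one pU]
      by (simp add: matrix_vector_mult_diff_distrib)
    have lin: "linear (deriv_at (u q) p)" if "q \<in> Q" for q
      using has_derivative_linear[OF Ck_has_derivative[OF oU Cu[OF that] r pU]] .
    have dlin: "linear (?L i)" if "i \<in> {1..d}" for i
      using has_derivative_linear[OF Ck_has_derivative[OF D[OF that] Cb[OF that] r UO[OF pU that]]] .
    have solve: "\<exists>R::real^'m^'l. \<forall>i\<in>{2..d}. R *v ?w i = y i" for y
      using pA by (simp add: A_def)
    show "\<exists>v\<in>coords S. \<forall>q\<in>Q. deriv_at (u q) p v = y q" for y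
    proof -
      obtain R :: "real^'m^'l" where R: "\<forall>i\<in>{2..d}. R *v ?w i = (\<chi> j. y (i, j))"
        using solve[of "\<lambda>i. \<chi> j. y (i, j)"] by blast
      have "deriv_at (u q) p (0, R) = y q" if "q \<in> Q" for q
      proof -
        obtain i j where q: "q = (i, j)" "i \<in> {2..d}" using \<open>q \<in> Q\<close> by (auto simp: Q_def)
        show ?thesis
          unfolding q(1) dup[OF q(2)]
          using R q(2) linear_0[OF dlin[OF i1[OF q(2)]]] linear_0[OF dlin[OF one]] by simp
      qed
      moreover have "(0, R) \<in> coords S" by (rule S(3)) simp
      ultimately show ?thesis by blast
    qed
    define Z where "Z = {snd v | v. v \<in> coords S \<and> (\<forall>q\<in>Q. deriv_at (u q) p v = 0)}"
    have subZ: "subspace Z"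
    proof -
      have "subspace {v. v \<in> coords S \<and> (\<forall>q\<in>Q. deriv_at (u q) p v = 0)}"
        using lin by (auto simp: subspace_def coords_def inner_add_left linear_0 linear_add linear_scale)
      then have "subspace (snd ` {v. v \<in> coords S \<and> (\<forall>q\<in>Q. deriv_at (u q) p v = 0)})"
        by (rule linear_subspace_image[OF linear_snd])
      moreover have "Z = snd ` {v. v \<in> coords S \<and> (\<forall>q\<in>Q. deriv_at (u q) p v = 0)}"
        unfolding Z_def by blast
      ultimately show ?thesis by simp
    qed
    have "Z \<noteq> UNIV"
    proof
      assume Z: "Z = UNIV"
      obtain z where z: "\<forall>w. \<exists>i\<in>{2..d}. ?L i (w i) -
          ?L 1 (w 1) \<noteq> z i"
        using pA by (auto simp: A_def differences_onto_def)
      obtain R :: "real^'m^'l" where R: "\<forall>i\<in>{2..d}. R *v ?w i = - z i"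
        using solve[of "\<lambda>i. - z i"] by blast
      have "R \<in> Z" using Z by simp
      then obtain v where v: "R = snd v" "\<forall>q\<in>Q. deriv_at (u q) p v = 0" unfolding Z_def by blast
      obtain i where i: "i \<in> {2..d}" "?L i (fst v $ \<iota> i) -
          ?L 1 (fst v $ \<iota> 1) \<noteq> z i"
        using z[rule_format, of "\<lambda>i. fst v $ \<iota> i"] by blast
      have "?L i (fst v $ \<iota> i) -
          ?L 1 (fst v $ \<iota> 1) + - z i = 0"
      proof (rule vec_eq_iff[THEN iffD2], intro allI)
        fix j
        have "deriv_at (u (i, j)) p v = 0" using v(2) i(1) by (simp add: Q_def)
        then show "(?L i (fst v $ \<iota> i) -
          ?L 1 (fst v $ \<iota> 1) + - z i) $ j = 0 $ j"
          unfolding dup[OF i(1)] v(1)[symmetric] using R i(1) by simp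
      qed
      then show False using i(2) by simp
    qed
    then have "dim Z < DIM(real^'m^'l)"
      using subZ by (metis dim_eq_full dim_subset_UNIV le_neq_implies_less span_eq_iff)
    then obtain \<mu> where \<mu>: "\<mu> \<noteq> 0" "\<And>y. y \<in> span Z \<Longrightarrow> orthogonal \<mu> y"
      using orthogonal_to_subspace_exists[of Z] by blast
    have dsnd: "deriv_at snd p v = snd v" for v :: "((real^'n)^('m option)) \<times> (real^'m^'l)"
      using frechet_derivative_at[OF bounded_linear_imp_has_derivative[OF bounded_linear_snd, of "at p"]] by metis
    have "deriv_at snd p v \<bullet> \<mu> = 0" if "v \<in> coords S" "\<forall>q\<in>Q. deriv_at (u q) p v = 0" for v
    proof -
      have "snd v \<in> Z" using that unfolding Z_def by blast
      from \<mu>(2)[OF span_base[OF this]] show ?thesis by (simp add: dsnd orthogonal_def inner_commute)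
    qed
    then show "\<exists>\<mu>. \<mu> \<noteq> 0 \<and> (\<forall>v\<in>coords S. (\<forall>q\<in>Q. deriv_at (u q) p v = 0) \<longrightarrow> deriv_at snd p v \<bullet> \<mu> = 0)"
      using \<mu>(1) by blast
  qed
  moreover have "real DIM(real^'m^'l) - 1 + (real (card S) - real (card Q) - real DIM(real^'m^'l) + 1) / real r = ?s"
    using d by (simp add: S(2) cQ of_nat_diff algebra_simps)
  ultimately have "hnull ?s (snd ` A)" by (simp only:)
  then show ?thesis using Bsub by (rule hnull_subset)
qed

section \<open>Tuples\<close>

lemma bounded_linear_apply_bcontfun:
  "bounded_linear (\<lambda>p :: nat \<Rightarrow>\<^sub>C 'e::real_normed_vector. apply_bcontfun p i)"
  by (rule bounded_linear_intro[of _ 1]) (auto simp: norm_bounded)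

lemma tuple_eq_iff: "tuple d x = tuple d y \<longleftrightarrow> (\<forall>i\<in>{1..d}. x i = y i)"
proof
  assume "tuple d x = tuple d y"
  then show "\<forall>i\<in>{1..d}. x i = y i" by (metis apply_tuple)
next
  assume "\<forall>i\<in>{1..d}. x i = y i"
  then show "tuple d x = tuple d y" by (intro bcontfun_eqI) (simp add: apply_tuple)
qed

lemma tuple_add: "tuple d x + tuple d y = tuple d (\<lambda>i. x i + y i)"
  by (rule bcontfun_eqI) (simp add: apply_tuple)

lemma tuple_scaleR: "r *\<^sub>R tuple d x = tuple d (\<lambda>i. r *\<^sub>R x i)"
  by (rule bcontfun_eqI) (simp add: apply_tuple)

lemma mem_tuple_space_UNIV:
  "p \<in> tuple_space d UNIV \<longleftrightarrow> (\<forall>i. i \<notin> {1..d} \<longrightarrow> apply_bcontfun p i = 0)"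
proof
  assume "p \<in> tuple_space d UNIV"
  then show "\<forall>i. i \<notin> {1..d} \<longrightarrow> apply_bcontfun p i = 0"
    unfolding tuple_space_def by (auto simp: apply_tuple)
next
  assume *: "\<forall>i. i \<notin> {1..d} \<longrightarrow> apply_bcontfun p i = 0"
  have "p = tuple d (apply_bcontfun p)"
    by (rule bcontfun_eqI) (use * in \<open>simp add: apply_tuple\<close>)
  then show "p \<in> tuple_space d UNIV" unfolding tuple_space_def by blast
qed

lemma tuple_in_tuple_space: "tuple d x \<in> tuple_space d UNIV"
  by (simp add: mem_tuple_space_UNIV apply_tuple)

lemma bounded_linear_tuple_single:
  "bounded_linear (\<lambda>y :: 'e::real_normed_vector. tuple d (\<lambda>k. if k = i then y else 0))"
proof (rule bounded_linear_intro[of _ 1])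
  fix y z :: 'e and r :: real
  show "tuple d (\<lambda>k. if k = i then y + z else 0) = tuple d (\<lambda>k. if k = i then y else 0) + tuple d (\<lambda>k. if k = i then z else 0)"
    unfolding tuple_add tuple_eq_iff by simp
  show "tuple d (\<lambda>k. if k = i then r *\<^sub>R y else 0) = r *\<^sub>R tuple d (\<lambda>k. if k = i then y else 0)"
    unfolding tuple_scaleR tuple_eq_iff by simp
  show "norm (tuple d (\<lambda>k. if k = i then y else 0)) \<le> norm y * 1"
    by (rule norm_bound) (simp add: apply_tuple)
qed

text \<open>A tuple is the sum of its entries, placed by bounded linear maps; this reduces the claim to the
  chain rule.\<close>

lemma has_derivative_tuple:
  fixes G :: "nat \<Rightarrow> 'e::real_normed_vector \<Rightarrow> 'f::real_normed_vector"
  assumes "\<And>i. i \<in> {1..d} \<Longrightarrow> (G i has_derivative G' i) (at (apply_bcontfun p i))"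
  shows "((\<lambda>p. tuple d (\<lambda>i. G i (apply_bcontfun p i))) has_derivative
    (\<lambda>v. tuple d (\<lambda>i. G' i (apply_bcontfun v i)))) (at p)"
proof -
  have split: "tuple d x = (\<Sum>i\<in>{1..d}. tuple d (\<lambda>k. if k = i then x i else 0))" for x :: "nat \<Rightarrow> 'f"
  proof (rule bcontfun_eqI)
    fix k
    have "apply_bcontfun (\<Sum>i\<in>{1..d}. tuple d (\<lambda>k. if k = i then x i else 0)) k =
        (\<Sum>i\<in>{1..d}. apply_bcontfun (tuple d (\<lambda>k. if k = i then x i else 0)) k)"
      by (rule linear_sum[OF bounded_linear.linear[OF bounded_linear_apply_bcontfun]])
    also have "\<dots> = apply_bcontfun (tuple d x) k"
    proof (cases "k \<in> {1..d}")
      case False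
      then show ?thesis by (auto simp: apply_tuple intro!: sum.neutral)
    qed (simp add: apply_tuple)
    finally show "apply_bcontfun (tuple d x) k = apply_bcontfun (\<Sum>i\<in>{1..d}. tuple d (\<lambda>k. if k = i then x i else 0)) k" ..
  qed
  have 1: "(\<lambda>p. tuple d (\<lambda>i. G i (apply_bcontfun p i))) =
      (\<lambda>p. \<Sum>i\<in>{1..d}. tuple d (\<lambda>k. if k = i then G i (apply_bcontfun p i) else 0))"
    by (rule ext) (rule split)
  have 2: "(\<lambda>v. tuple d (\<lambda>i. G' i (apply_bcontfun v i))) =
      (\<lambda>v. \<Sum>i\<in>{1..d}. tuple d (\<lambda>k. if k = i then G' i (apply_bcontfun v i) else 0))"
    by (rule ext) (rule split)
  show ?thesis
    unfolding 1 2
    by (intro has_derivative_sum bounded_linear.has_derivative[OF bounded_linear_tuple_single]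
        has_derivative_compose[OF bounded_linear_imp_has_derivative[OF bounded_linear_apply_bcontfun] assms])
qed

text \<open>The derivative within a set that is not open need not be unique as a linear map. Its values are
  determined in those directions in which a segment stays inside the set.\<close>

lemma derivative_within_unique_direction:
  assumes "(f has_derivative f1) (at p within S)" "(f has_derivative f2) (at p within S)"
    and "0 < e" "\<And>t::real. 0 \<le> t \<Longrightarrow> t < e \<Longrightarrow> p + t *\<^sub>R v \<in> S"
  shows "f1 v = f2 v"
proof -
  let ?I = "{0..e/2}"
  have c: "((\<lambda>t. p + t *\<^sub>R v) has_derivative (\<lambda>t. t *\<^sub>R v)) (at 0 within ?I)"
    by (auto intro!: derivative_eq_intros)
  have im: "(\<lambda>t. p + t *\<^sub>R v) ` ?I \<subseteq> S" using assms(3,4) by auto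
  have d: "((\<lambda>t. f (p + t *\<^sub>R v)) has_derivative (\<lambda>t. t *\<^sub>R f' v)) (at 0 within ?I)"
    if "(f has_derivative f') (at p within S)" for f'
  proof -
    have "(f has_derivative f') (at (p + 0 *\<^sub>R v) within (\<lambda>t. p + t *\<^sub>R v) ` ?I)"
      using has_derivative_subset[OF that im] by simp
    from has_derivative_in_compose[OF c this]
    have "((\<lambda>t. f (p + t *\<^sub>R v)) has_derivative (\<lambda>t. f' (t *\<^sub>R v))) (at 0 within ?I)" .
    moreover have "f' (t *\<^sub>R v) = t *\<^sub>R f' v" for t
      using has_derivative_linear[OF that] by (simp add: linear_scale)
    ultimately show ?thesis by simp
  qed
  have "((\<lambda>t. f (p + t *\<^sub>R v)) has_vector_derivative f1 v) (at 0 within ?I)"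
    "((\<lambda>t. f (p + t *\<^sub>R v)) has_vector_derivative f2 v) (at 0 within ?I)"
    using d[OF assms(1)] d[OF assms(2)] unfolding has_vector_derivative_def by auto
  moreover have "at 0 within ?I \<noteq> bot"
    using assms(3) by (simp add: trivial_limit_within islimpt_Icc)
  ultimately show ?thesis using vector_derivative_unique_within by blast
qed

section \<open>Configuration spaces in charts\<close>

lemma chart_facts:
  assumes "Ck_manifold r X" "model X = UNIV" "(U, \<phi>) \<in> atlas X"
  shows "U \<subseteq> points X" "inj_on \<phi> U" "open (\<phi> ` U)"
proof -
  have *: "openin (mtop X) U" "openin (top_of_set (model X)) (\<phi> ` U)"
    "homeomorphic_map (subtopology (mtop X) U) (top_of_set (\<phi> ` U)) \<phi>"
  proof -
    have "\<forall>(U, \<phi>)\<in>atlas X. openin (mtop X) U \<and> openin (top_of_set (model X)) (\<phi> ` U) \<and>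
        homeomorphic_map (subtopology (mtop X) U) (top_of_set (\<phi> ` U)) \<phi>"
      using assms(1) unfolding Ck_manifold_def by (elim conjE)
    from bspec[OF this assms(3)] show "openin (mtop X) U" "openin (top_of_set (model X)) (\<phi> ` U)"
      "homeomorphic_map (subtopology (mtop X) U) (top_of_set (\<phi> ` U)) \<phi>"
      by simp_all
  qed
  show "U \<subseteq> points X" using openin_subset[OF *(1)] .
  then show "inj_on \<phi> U" using homeomorphic_imp_injective_map[OF *(3)] by (simp only: topspace_subtopology_subset)
  show "open (\<phi> ` U)" using *(2) unfolding assms(2) by simp
qed

lemma Ck_map_chart:
  assumes "Ck_map r X h" "model X = UNIV" "(U, \<phi>) \<in> atlas X"
  shows "Ck r (\<phi> ` U) (h \<circ> inv_into U \<phi>)"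
  using assms unfolding Ck_map_def by auto

lemma points_config: "points (config d X) = {q \<in> ({1..d} \<rightarrow>\<^sub>E points X). inj_on q {1..d}}"
  by (auto simp: config_def)

abbreviation chart_deriv :: "('a set \<times> ('a \<Rightarrow> 'e::real_normed_vector)) \<Rightarrow> ('a \<Rightarrow> 'f::real_normed_vector) \<Rightarrow> 'a \<Rightarrow> 'e \<Rightarrow> 'f"
  where "chart_deriv c h x \<equiv> deriv_at (h \<circ> inv_into (fst c) (snd c)) (snd c x)"

text \<open>On the image of a chart of the configuration space the mapping \<open>h^(d)\<close> acts entry by entry, so its
  derivative does, too. The image is open only relative to the tuples of length \<open>d\<close>, hence the
  restriction on \<open>v\<close>. Moving slightly in the direction \<open>v\<close> keeps the points distinct because their
  images under the continuous injection \<open>f\<close> stay distinct.\<close>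

lemma config_derivative:
  fixes X :: "('a, real^'n) manifold" and f :: "'a \<Rightarrow> real^'m" and h :: "'a \<Rightarrow> real^'l"
  assumes man: "Ck_manifold r X" "model X = UNIV"
    and f: "inj_on f (points X)" "Ck_map 1 X f" and h: "Ck_map 1 X h"
    and c: "\<And>i. i \<in> {1..d} \<Longrightarrow> c i \<in> atlas X"
    and q: "q \<in> points (config d X)" "\<And>i. i \<in> {1..d} \<Longrightarrow> q i \<in> fst (c i)"
    and v: "v \<in> tuple_space d UNIV"
    and U: "U = {q \<in> (\<Pi>\<^sub>E i\<in>{1..d}. fst (c i)). inj_on q {1..d}}"
    and \<phi>: "\<phi> = (\<lambda>q. tuple d (\<lambda>i. snd (c i) (q i)))"
  shows "frechet_derivative (multi d h \<circ> inv_into U \<phi>) (at (\<phi> q) within \<phi> ` U) v =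
    tuple d (\<lambda>i. chart_deriv (c i) h (q i) (apply_bcontfun v i))"
proof -
  let ?H = "multi d h \<circ> inv_into U \<phi>" and ?at = "at (\<phi> q) within \<phi> ` U"
  let ?L = "\<lambda>v. tuple d (\<lambda>i. chart_deriv (c i) h (q i) (apply_bcontfun v i))"
  define \<xi> where "\<xi> i = inv_into (fst (c i)) (snd (c i))" for i
  define D where "D i = snd (c i) ` fst (c i)" for i
  have ch: "fst (c i) \<subseteq> points X" "inj_on (snd (c i)) (fst (c i))" "open (D i)" if "i \<in> {1..d}" for i
    using chart_facts[OF man, of "fst (c i)" "snd (c i)"] c[OF that] by (auto simp: D_def)
  have \<xi>: "\<xi> i (snd (c i) x) = x" if "i \<in> {1..d}" "x \<in> fst (c i)" for i x
    unfolding \<xi>_def using inv_into_f_f[OF ch(2)[OF that(1)] that(2)] .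
  have \<xi>': "\<xi> i y \<in> fst (c i)" "snd (c i) (\<xi> i y) = y" if "i \<in> {1..d}" "y \<in> D i" for i y
    using that(2) unfolding D_def \<xi>_def by (auto intro: inv_into_into f_inv_into_f)
  have qU: "q \<in> U"
    using q unfolding U points_config by (auto simp: PiE_iff extensional_def)
  have inj: "inj_on \<phi> U"
  proof (rule inj_onI)
    fix a b assume a: "a \<in> U" and b: "b \<in> U" and eq: "\<phi> a = \<phi> b"
    have "a i = b i" if "i \<in> {1..d}" for i
    proof -
      have "snd (c i) (a i) = snd (c i) (b i)" using eq that unfolding \<phi> tuple_eq_iff by blast
      moreover have "a i \<in> fst (c i)" "b i \<in> fst (c i)" using a b that unfolding U by auto
      ultimately show ?thesis using ch(2)[OF that] by (meson inj_onD)
    qed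
    then show "a = b" using a b unfolding U by (intro PiE_ext[of a "{1..d}" "\<lambda>i. fst (c i)" b]) auto
  qed
  let ?T = "\<lambda>p. tuple d (\<lambda>i. (h \<circ> \<xi> i) (apply_bcontfun p i))"
  have T: "?H p = ?T p" if "p \<in> \<phi> ` U" for p
  proof -
    obtain a where a: "a \<in> U" "p = \<phi> a" using \<open>p \<in> \<phi> ` U\<close> by blast
    have "inv_into U \<phi> p = a" using a inj by simp
    moreover have "h (a i) = h (\<xi> i (apply_bcontfun p i))" if "i \<in> {1..d}" for i
    proof -
      have "a i \<in> fst (c i)" using a(1) that unfolding U by auto
      then show ?thesis using \<xi>[OF that] that unfolding a(2) \<phi> by (simp add: apply_tuple)
    qed
    ultimately show ?thesis by (simp add: multi_def tuple_eq_iff)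
  qed
  have pq: "apply_bcontfun (\<phi> q) i = snd (c i) (q i)" if "i \<in> {1..d}" for i
    using that by (simp add: \<phi> apply_tuple)
  have Ckh: "Ck 1 (D i) (h \<circ> \<xi> i)" if "i \<in> {1..d}" for i
    using Ck_map_chart[OF h man(2), of "fst (c i)" "snd (c i)"] c[OF that] by (simp add: D_def \<xi>_def)
  have qD: "snd (c i) (q i) \<in> D i" if "i \<in> {1..d}" for i using q(2)[OF that] by (simp add: D_def)
  have "(?T has_derivative ?L) (at (\<phi> q))"
  proof (rule has_derivative_tuple[of d "\<lambda>i. h \<circ> \<xi> i" "\<lambda>i. chart_deriv (c i) h (q i)" "\<phi> q"])
    fix i assume i: "i \<in> {1..d}"
    show "(h \<circ> \<xi> i has_derivative chart_deriv (c i) h (q i)) (at (apply_bcontfun (\<phi> q) i))"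
      unfolding pq[OF i] \<xi>_def[symmetric]
      using Ck_has_derivative[OF ch(3)[OF i] Ckh[OF i] _ qD[OF i]] by simp
  qed
  then have "(?T has_derivative ?L) ?at"
    by (rule has_derivative_at_withinI)
  then have der: "(?H has_derivative ?L) ?at"
    by (rule has_derivative_transform[rotated 2]) (use T qU in auto)
  then have der': "(?H has_derivative frechet_derivative ?H ?at) ?at"
    using differentiable_def frechet_derivative_works by blast
  define y where "y i t = snd (c i) (q i) + t *\<^sub>R apply_bcontfun v i" for i and t :: real
  have ycont: "isCont (y i) 0" for i unfolding y_def by (intro continuous_intros)
  have y0: "y i 0 = snd (c i) (q i)" for i by (simp add: y_def)
  have evD: "\<forall>\<^sub>F t in nhds 0. y i t \<in> D i" if "i \<in> {1..d}" for i
    using topological_tendstoD[OF ycont[of i, unfolded isCont_def, THEN tendsto_at_iff_tendsto_nhds[THEN iffD1]] ch(3)[OF that]]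
      qD[OF that] by (simp add: y0)
  have evinj: "\<forall>\<^sub>F t in nhds 0. i \<noteq> j \<longrightarrow> f (\<xi> i (y i t)) \<noteq> f (\<xi> j (y j t))"
    if "i \<in> {1..d}" "j \<in> {1..d}" for i j
  proof (cases "i = j")
    case False
    have fc: "(\<lambda>t. f (\<xi> k (y k t))) \<midarrow>0\<rightarrow> f (q k)" if k: "k \<in> {1..d}" for k
    proof -
      have "Ck 1 (D k) (f \<circ> \<xi> k)"
        using Ck_map_chart[OF f(2) man(2), of "fst (c k)" "snd (c k)"] c[OF k] by (simp add: D_def \<xi>_def)
      then have "continuous_on (D k) (f \<circ> \<xi> k)" using Ck_imp_continuous_on[OF ch(3)[OF k]] by blast
      then have "isCont (f \<circ> \<xi> k) (y k 0)"
        unfolding y0 using ch(3)[OF k] qD[OF k] continuous_on_eq_continuous_at by blast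
      from isCont_o2[OF ycont[of k] this] have "isCont (\<lambda>t. f (\<xi> k (y k t))) 0" by (simp add: o_def)
      then have "(\<lambda>t. f (\<xi> k (y k t))) \<midarrow>0\<rightarrow> f (\<xi> k (y k 0))" by (simp add: isCont_def)
      then show ?thesis using \<xi>[OF k q(2)[OF k]] by (simp add: y0)
    qed
    have "f (q i) \<noteq> f (q j)"
    proof
      assume "f (q i) = f (q j)"
      moreover have "q i \<in> points X" "q j \<in> points X" using ch(1) q(2) that by blast+
      ultimately have "q i = q j" using f(1) by (simp add: inj_on_eq_iff)
      moreover have "inj_on q {1..d}" using qU by (simp add: U)
      ultimately show False using that False by (simp add: inj_on_eq_iff)
    qed
    then have "(\<lambda>t. f (\<xi> i (y i t)) - f (\<xi> j (y j t))) \<midarrow>0\<rightarrow> f (q i) - f (q j)" "f (q i) - f (q j) \<noteq> 0"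
      using tendsto_diff[OF fc[OF that(1)] fc[OF that(2)]] by auto
    then have "\<forall>\<^sub>F t in at 0. f (\<xi> i (y i t)) - f (\<xi> j (y j t)) \<noteq> 0"
      by (rule tendsto_imp_eventually_ne)
    then have "\<forall>\<^sub>F t in nhds 0. t \<noteq> 0 \<longrightarrow> f (\<xi> i (y i t)) \<noteq> f (\<xi> j (y j t))"
      by (simp add: eventually_at_filter)
    then show ?thesis
      by (rule eventually_mono) (use \<open>f (q i) \<noteq> f (q j)\<close> \<xi> q(2) that y0 in metis)
  qed simp
  have "\<forall>\<^sub>F t in nhds 0. (\<forall>i\<in>{1..d}. y i t \<in> D i) \<and>
      (\<forall>i\<in>{1..d}. \<forall>j\<in>{1..d}. i \<noteq> j \<longrightarrow> f (\<xi> i (y i t)) \<noteq> f (\<xi> j (y j t)))"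
    by (intro eventually_conj eventually_ball_finite ballI evD evinj) auto
  then obtain e where e: "0 < e" "\<And>t. dist t 0 < e \<Longrightarrow> (\<forall>i\<in>{1..d}. y i t \<in> D i) \<and>
      (\<forall>i\<in>{1..d}. \<forall>j\<in>{1..d}. i \<noteq> j \<longrightarrow> f (\<xi> i (y i t)) \<noteq> f (\<xi> j (y j t)))"
    unfolding eventually_nhds_metric by blast
  show ?thesis
  proof (rule derivative_within_unique_direction[OF der' der e(1)])
    fix t :: real assume t: "0 \<le> t" "t < e"
    then have et: "\<And>i. i \<in> {1..d} \<Longrightarrow> y i t \<in> D i"
      "\<And>i j. i \<in> {1..d} \<Longrightarrow> j \<in> {1..d} \<Longrightarrow> i \<noteq> j \<Longrightarrow> f (\<xi> i (y i t)) \<noteq> f (\<xi> j (y j t))"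
      using e(2)[of t] by auto
    define a where "a = (\<lambda>i\<in>{1..d}. \<xi> i (y i t))"
    have "inj_on a {1..d}"
    proof (rule inj_onI, rule ccontr)
      fix i j assume "i \<in> {1..d}" "j \<in> {1..d}" "a i = a j" "i \<noteq> j"
      then show False using et(2)[of i j] by (simp add: a_def)
    qed
    moreover have "a \<in> (\<Pi>\<^sub>E i\<in>{1..d}. fst (c i))"
      unfolding a_def using \<xi>'(1) et(1) by (auto intro!: restrict_PiE_iff[THEN iffD2])
    ultimately have "a \<in> U" unfolding U by simp
    moreover have "\<phi> a = \<phi> q + t *\<^sub>R v"
    proof (rule bcontfun_eqI)
      fix i
      show "apply_bcontfun (\<phi> a) i = apply_bcontfun (\<phi> q + t *\<^sub>R v) i"
      proof (cases "i \<in> {1..d}")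
        case True
        then show ?thesis using \<xi>'(2)[OF True et(1)[OF True]]
          by (simp add: \<phi> apply_tuple a_def y_def)
      next
        case False
        then show ?thesis using v
          by (auto simp: \<phi> apply_tuple mem_tuple_space_UNIV)
      qed
    qed
    ultimately show "\<phi> q + t *\<^sub>R v \<in> \<phi> ` U" by (metis imageI)
  qed
qed

section \<open>Transversality to the diagonal\<close>

lemma tangent_vectors_sub_tuple_space:
  assumes "Z \<subseteq> tuple_space d UNIV"
  shows "tangent_vectors Z z \<subseteq> tuple_space d UNIV"
proof
  fix v assume "v \<in> tangent_vectors Z z"
  then obtain \<gamma> \<epsilon> where \<gamma>: "0 < \<epsilon>" "\<gamma> ` {-\<epsilon><..<\<epsilon>} \<subseteq> Z" "(\<gamma> has_vector_derivative v) (at (0::real))"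
    unfolding tangent_vectors_def by blast
  have "apply_bcontfun v i = 0" if i: "i \<notin> {1..d}" for i
  proof -
    have "((\<lambda>t. apply_bcontfun (\<gamma> t) i) has_vector_derivative apply_bcontfun v i) (at 0)"
      by (rule bounded_linear.has_vector_derivative[OF bounded_linear_apply_bcontfun \<gamma>(3)])
    moreover have "((\<lambda>t. apply_bcontfun (\<gamma> t) i) has_vector_derivative 0) (at 0)"
    proof (rule has_vector_derivative_transform_within_open[of "\<lambda>_. 0" _ _ "{-\<epsilon><..<\<epsilon>}"])
      fix t :: real assume "t \<in> {-\<epsilon><..<\<epsilon>}"
      then have "\<gamma> t \<in> tuple_space d UNIV" using \<gamma>(2) assms by blast
      then show "0 = apply_bcontfun (\<gamma> t) i" using i by (simp add: mem_tuple_space_UNIV)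
    qed (use \<gamma>(1) in auto)
    ultimately show ?thesis by (rule vector_derivative_unique_at)
  qed
  then show "v \<in> tuple_space d UNIV" by (simp add: mem_tuple_space_UNIV)
qed

lemma line_in_tangent_vectors:
  assumes "\<And>t::real. z + t *\<^sub>R v \<in> Z"
  shows "v \<in> tangent_vectors Z z"
proof -
  have "((\<lambda>t. z + t *\<^sub>R v) has_vector_derivative v) (at 0)"
    by (auto intro!: derivative_eq_intros)
  moreover have "(\<lambda>t. z + t *\<^sub>R v) ` {-1<..<1} \<subseteq> Z" using assms by blast
  ultimately show ?thesis unfolding tangent_vectors_def
    by (intro CollectI exI[of _ "\<lambda>t. z + t *\<^sub>R v"] exI[of _ 1]) auto
qed

lemma diagonal_sub_tuple_space: "diagonal d \<subseteq> tuple_space d UNIV"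
  unfolding diagonal_def using tuple_in_tuple_space by blast

text \<open>The derivatives are those of \<open>h\<close> in the charts \<open>c\<close>. Solving for the differences to the first entry
  is enough, as the tangent vectors of the diagonal supply the constant tuples. Since
  \<open>differential_image\<close> collects the values in all charts, one good choice of charts gives everything,
  and the other charts only contribute further tuples of length \<open>d\<close>.\<close>

lemma multi_transverseI:
  fixes X :: "('a, real^'n) manifold" and f :: "'a \<Rightarrow> real^'m" and h :: "'a \<Rightarrow> real^'l"
  assumes man: "Ck_manifold r X" "model X = UNIV" and "1 \<le> d"
    and f: "inj_on f (points X)" "Ck_map 1 X f" and h: "Ck_map 1 X h"
    and solve: "\<And>q. q \<in> points (config d X) \<Longrightarrow> \<forall>i\<in>{1..d}. h (q i) = h (q 1) \<Longrightarrow>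
      \<exists>c. (\<forall>i\<in>{1..d}. c i \<in> atlas X \<and> q i \<in> fst (c i)) \<and>
        differences_onto d (\<lambda>i. chart_deriv (c i) h (q i))"
  shows "multi_transverse d X h"
  unfolding multi_transverse_def transverse_def
proof (intro ballI)
  fix q assume q: "q \<in> points (config d X)"
  let ?z = "multi d h q"
  let ?E = "{u + w | u w. u \<in> differential_image (config d X) (multi d h) q \<and> w \<in> tangent_vectors (diagonal d) ?z}"
  have "?E = tangent_vectors (tuple_space d UNIV) ?z" if zd: "?z \<in> diagonal d"
  proof
    have imgd: "differential_image (config d X) (multi d h) q \<subseteq> tuple_space d UNIV"
    proof
      fix u assume "u \<in> differential_image (config d X) (multi d h) q"
      then obtain U \<phi> v where u: "u = frechet_derivative (multi d h \<circ> inv_into U \<phi>) (at (\<phi> q) within \<phi> ` U) v"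
        "(U, \<phi>) \<in> atlas (config d X)" "q \<in> U" "v \<in> model (config d X)"
        unfolding differential_image_def by blast
      obtain c where c: "\<forall>i\<in>{1..d}. c i \<in> atlas X"
        "U = {q \<in> (\<Pi>\<^sub>E i\<in>{1..d}. fst (c i)). inj_on q {1..d}}" "\<phi> = (\<lambda>q. tuple d (\<lambda>i. snd (c i) (q i)))"
        using u(2) unfolding config_def by auto
      have "q i \<in> fst (c i)" if "i \<in> {1..d}" for i using u(3) that unfolding c(2) by auto
      moreover have "v \<in> tuple_space d UNIV" using u(4) man(2) by (simp add: config_def)
      ultimately have "u = tuple d (\<lambda>i. chart_deriv (c i) h (q i) (apply_bcontfun v i))"
        unfolding u(1) using config_derivative[OF man f h _ q _ _ c(2,3)] c(1) by blast
      then show "u \<in> tuple_space d UNIV" using tuple_in_tuple_space by blast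
    qed
    have add: "a + b \<in> tuple_space d UNIV" if "a \<in> tuple_space d UNIV" "b \<in> tuple_space d UNIV"
      for a b :: "nat \<Rightarrow>\<^sub>C (real^'l)"
      using that by (simp add: mem_tuple_space_UNIV)
    have scale: "t *\<^sub>R a \<in> tuple_space d UNIV" if "a \<in> tuple_space d UNIV" for t and a :: "nat \<Rightarrow>\<^sub>C (real^'l)"
      using that by (simp add: mem_tuple_space_UNIV)
    show "?E \<subseteq> tangent_vectors (tuple_space d UNIV) ?z"
    proof
      fix e assume "e \<in> ?E"
      then have "e \<in> tuple_space d UNIV"
        using add imgd tangent_vectors_sub_tuple_space[OF diagonal_sub_tuple_space] by blast
      then show "e \<in> tangent_vectors (tuple_space d UNIV) ?z"
        by (intro line_in_tangent_vectors add scale) (simp_all add: multi_def tuple_in_tuple_space)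
    qed
    show "tangent_vectors (tuple_space d UNIV) ?z \<subseteq> ?E"
    proof
      fix e assume "e \<in> tangent_vectors (tuple_space d UNIV) ?z"
      then have "e \<in> tuple_space d UNIV" using tangent_vectors_sub_tuple_space by blast
      then obtain y where e: "e = tuple d y" unfolding tuple_space_def by blast
      obtain y0 where "?z = tuple d (\<lambda>i. y0)" using zd unfolding diagonal_def by blast
      then have hq: "\<forall>i\<in>{1..d}. h (q i) = y0" unfolding multi_def tuple_eq_iff .
      then have "\<forall>i\<in>{1..d}. h (q i) = h (q 1)" using \<open>1 \<le> d\<close> by simp
      from solve[OF q this] obtain c where c: "\<forall>i\<in>{1..d}. c i \<in> atlas X \<and> q i \<in> fst (c i)"
        "\<forall>z. \<exists>w. \<forall>i\<in>{2..d}. chart_deriv (c i) h (q i) (w i) - chart_deriv (c 1) h (q 1) (w 1) = z i"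
        unfolding differences_onto_def by blast
      obtain w where w: "\<forall>i\<in>{2..d}. chart_deriv (c i) h (q i) (w i) - chart_deriv (c 1) h (q 1) (w 1) = y i - y 1"
        using c(2)[rule_format, of "\<lambda>i. y i - y 1"] by blast
      define U where "U = {q \<in> (\<Pi>\<^sub>E i\<in>{1..d}. fst (c i)). inj_on q {1..d}}"
      define \<phi> where "\<phi> = (\<lambda>q. tuple d (\<lambda>i. snd (c i) (q i)))"
      define u where "u = tuple d (\<lambda>i. chart_deriv (c i) h (q i) (w i))"
      define k where "k = y 1 - chart_deriv (c 1) h (q 1) (w 1)"
      have "frechet_derivative (multi d h \<circ> inv_into U \<phi>) (at (\<phi> q) within \<phi> ` U) (tuple d w) =
          tuple d (\<lambda>i. chart_deriv (c i) h (q i) (apply_bcontfun (tuple d w) i))"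
        using config_derivative[OF man f h _ q _ tuple_in_tuple_space U_def \<phi>_def] c(1) by blast
      also have "\<dots> = u" unfolding u_def tuple_eq_iff by (simp add: apply_tuple)
      finally have u: "frechet_derivative (multi d h \<circ> inv_into U \<phi>) (at (\<phi> q) within \<phi> ` U) (tuple d w) = u" .
      have "(U, \<phi>) \<in> atlas (config d X)" unfolding config_def U_def \<phi>_def using c(1) by auto
      moreover have "q \<in> U" using q c(1) unfolding U_def points_config by (auto simp: PiE_iff)
      moreover have "tuple d w \<in> model (config d X)"
        using man(2) by (simp add: config_def tuple_in_tuple_space)
      ultimately have "u \<in> differential_image (config d X) (multi d h) q"
        unfolding differential_image_def using u by blast
      moreover have "tuple d (\<lambda>i. k) \<in> tangent_vectors (diagonal d) ?z"
      proof (rule line_in_tangent_vectors)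
        fix t :: real
        have "?z + t *\<^sub>R tuple d (\<lambda>i. k) = tuple d (\<lambda>i. y0 + t *\<^sub>R k)"
          unfolding multi_def tuple_scaleR tuple_add tuple_eq_iff using hq by simp
        then show "?z + t *\<^sub>R tuple d (\<lambda>i. k) \<in> diagonal d" unfolding diagonal_def by blast
      qed
      moreover have "e = u + tuple d (\<lambda>i. k)"
        unfolding e u_def tuple_add tuple_eq_iff
      proof
        fix i assume i: "i \<in> {1..d}"
        show "y i = chart_deriv (c i) h (q i) (w i) + k"
        proof (cases "i = 1")
          case False
          then have "chart_deriv (c i) h (q i) (w i) - chart_deriv (c 1) h (q 1) (w 1) = y i - y 1"
            using w i by simp
          then show ?thesis by (simp add: k_def algebra_simps)
        qed (simp add: k_def)
      qed
      ultimately show "e \<in> ?E" by blast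
    qed
  qed
  then show "?z \<notin> diagonal d \<or> ?z \<in> diagonal d \<and> ?E = tangent_vectors (tuple_space d UNIV) ?z"
    by blast
qed

section \<open>General position\<close>

text \<open>If there were only finitely many points then there would be no configurations of more points than
  that, and every large \<open>d\<close> would satisfy the condition in \<open>general_position_degrees\<close> vacuously.\<close>

lemma infinite_points:
  assumes "finite (general_position_degrees X f)"
  shows "infinite (points X)"
proof
  assume fin: "finite (points X)"
  have "d \<in> general_position_degrees X f" if "card (points X) < d" for d
  proof -
    have "points (config d X) = {}"
    proof (rule ccontr)
      assume "points (config d X) \<noteq> {}"
      then obtain q where "q ` {1..d} \<subseteq> points X" "inj_on q {1..d}" unfolding points_config by auto
      then have "card {1..d} \<le> card (points X)" using fin card_inj_on_le by blast
      then show False using that by simp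
    qed
    then show ?thesis using that by (simp add: general_position_degrees_def)
  qed
  then have "{card (points X)<..} \<subseteq> general_position_degrees X f" by auto
  then show False using assms infinite_Ioi finite_subset by blast
qed

lemma extend_configuration:
  assumes "infinite (points X)" "q \<in> points (config d X)" "d \<le> D"
  obtains q' where "q' \<in> points (config D X)" "\<And>i. i \<in> {1..d} \<Longrightarrow> q' i = q i"
proof -
  have q: "q ` {1..d} \<subseteq> points X" "inj_on q {1..d}" using assms(2) unfolding points_config by auto
  have "infinite (points X - q ` {1..d})" using assms(1) by simp
  then obtain T where T: "finite T" "card T = card {d<..D}" "T \<subseteq> points X - q ` {1..d}"
    using infinite_arbitrarily_large by blast
  obtain b where b: "bij_betw b {d<..D} T" using finite_same_card_bij[of "{d<..D}" T] T by auto
  define q' where "q' i = (if i \<in> {1..d} then q i else if i \<in> {d<..D} then b i else undefined)" for i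
  have bT: "b i \<in> T" if "i \<in> {d<..D}" for i using b that by (auto simp: bij_betw_def)
  have "q' \<in> {1..D} \<rightarrow>\<^sub>E points X"
  proof (rule PiE_I)
    fix i assume "i \<in> {1..D}"
    then show "q' i \<in> points X" using q(1) bT[of i] T(3) by (auto simp: q'_def)
  qed (use assms(3) in \<open>auto simp: q'_def\<close>)
  moreover have "inj_on q' {1..D}"
  proof (rule inj_onI)
    fix i j assume ij: "i \<in> {1..D}" "j \<in> {1..D}" "q' i = q' j"
    have dj: "q i \<noteq> b j" if "i \<in> {1..d}" "j \<in> {d<..D}" for i j
    proof
      assume "q i = b j"
      then have "b j \<in> q ` {1..d}" using that(1) by (metis imageI)
      then show False using T(3) bT[OF that(2)] by blast
    qed
    consider "i \<in> {1..d}" "j \<in> {1..d}" | "i \<in> {1..d}" "j \<in> {d<..D}" | "i \<in> {d<..D}" "j \<in> {1..d}" | "i \<in> {d<..D}" "j \<in> {d<..D}"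
      using ij by force
    then show "i = j"
    proof cases
      case 1
      then show ?thesis using ij(3) q(2) by (simp add: q'_def inj_on_eq_iff)
    next
      case 2
      then show ?thesis using ij(3) dj[OF 2] by (simp add: q'_def)
    next
      case 3
      then show ?thesis using ij(3) dj[OF 3(2,1)] by (simp add: q'_def)
    next
      case 4
      then show ?thesis using ij(3) inj_onD[OF bij_betw_imp_inj_on[OF b], of i j] by (simp add: q'_def)
    qed
  qed
  ultimately have "q' \<in> points (config D X)" unfolding points_config by simp
  then show thesis using that by (simp add: q'_def)
qed

lemma df_in_degrees:
  assumes "finite (general_position_degrees X f)"
  shows "df X f \<in> general_position_degrees X f"
proof -
  have "1 \<in> general_position_degrees X f" by (simp add: general_position_degrees_def)
  then show ?thesis unfolding df_def using assms by (intro Max_in) auto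
qed

text \<open>The maximal \<open>d\<close> is attained by actual configurations, as there are infinitely many points; their
  \<open>d - 1\<close> independent vectors lie in a space of dimension \<open>m\<close>.\<close>

lemma df_le:
  fixes X :: "('a, 'e::real_normed_vector) manifold" and f :: "'a \<Rightarrow> real^'m"
  assumes "finite (general_position_degrees X f)"
  shows "df X f \<le> CARD('m) + 1"
proof -
  obtain q0 where "q0 \<in> points (config 0 X)" by (simp add: points_config)
  then obtain q where q: "q \<in> points (config (df X f) X)"
    using extend_configuration[OF infinite_points[OF assms]] by blast
  then have "dim (span ((\<lambda>i. f (q i) - f (q 1)) ` {2..df X f})) = df X f - 1"
    using df_in_degrees[OF assms] by (simp add: general_position_degrees_def)
  moreover have "dim (span ((\<lambda>i. f (q i) - f (q 1)) ` {2..df X f})) \<le> CARD('m)"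
    using dim_subset_UNIV[of "span ((\<lambda>i. f (q i) - f (q 1)) ` {2..df X f})"] by simp
  ultimately show ?thesis by linarith
qed

lemma matrix_apply:
  fixes \<pi> :: "real^'m \<Rightarrow> real^'l"
  assumes "linear \<pi>"
  shows "matrix \<pi> *v x = \<pi> x"
  using fun_cong[OF matrix_vector_mul(2)[OF assms], of x] by simp

text \<open>A configuration of \<open>d\<close> points extends to one of \<open>df X f\<close> points, whose difference vectors are
  linearly independent; so a linear map may be prescribed on them.\<close>

lemma general_position_solvable:
  fixes X :: "('a, 'e::real_normed_vector) manifold" and f :: "'a \<Rightarrow> real^'m" and y :: "nat \<Rightarrow> real^'l"
  assumes fin: "finite (general_position_degrees X f)" and q: "q \<in> points (config d X)"
    and d: "1 \<le> d" "d \<le> df X f"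
  shows "\<exists>R::real^'m^'l. \<forall>i\<in>{2..d}. R *v (f (q i) - f (q 1)) = y i"
proof -
  let ?D = "df X f"
  obtain q' where q': "q' \<in> points (config ?D X)" "\<And>i. i \<in> {1..d} \<Longrightarrow> q' i = q i"
    using extend_configuration[OF infinite_points[OF fin] q d(2)] by blast
  define w where "w i = f (q' i) - f (q' 1)" for i
  have dim: "dim (w ` {2..?D}) = ?D - 1"
    using df_in_degrees[OF fin] q'(1) unfolding general_position_degrees_def w_def by (simp add: dim_span)
  have "card (w ` {2..?D}) \<le> card {2..?D}" by (rule card_image_le) simp
  moreover have "dim (w ` {2..?D}) \<le> card (w ` {2..?D})" by (rule dim_le_card') simp
  ultimately have card: "card (w ` {2..?D}) = ?D - 1" "card (w ` {2..?D}) = card {2..?D}" using dim by simp_all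
  have inj: "inj_on w {2..?D}" by (rule eq_card_imp_inj_on[OF _ card(2)]) simp
  have indep: "independent (w ` {2..?D})"
    by (rule card_le_dim_spanning[of _ "span (w ` {2..?D})"]) (use dim card in \<open>auto intro: span_base\<close>)
  obtain g where g: "linear g" "\<forall>x\<in>w ` {2..?D}. g x = y (inv_into {2..?D} w x)"
    using linear_independent_extend[OF indep, of "\<lambda>x. y (inv_into {2..?D} w x)"] by blast
  have "matrix g *v (f (q i) - f (q 1)) = y i" if i: "i \<in> {2..d}" for i
  proof -
    have "i \<in> {2..?D}" "q' i = q i" "q' 1 = q 1" using i d q'(2) by auto
    then have "f (q i) - f (q 1) = w i" by (simp add: w_def)
    moreover have "g (w i) = y i"
      using g(2) inv_into_f_f[OF inj] \<open>i \<in> {2..?D}\<close> by simp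
    ultimately show ?thesis using matrix_apply[OF g(1)] by simp
  qed
  then show ?thesis by blast
qed

section \<open>The set of bad perturbations\<close>

lemma Ck_map_perturb:
  fixes X :: "('a, real^'n) manifold" and f :: "'a \<Rightarrow> real^'m" and g :: "real^'m \<Rightarrow> real^'l"
  assumes man: "Ck_manifold r X" "model X = UNIV" and V: "open V" "f ` points X \<subseteq> V"
    and f: "Ck_map r X f" and g: "Ck r V g" and \<pi>: "linear \<pi>"
  shows "Ck_map r X ((\<lambda>x. g x + \<pi> x) \<circ> f)"
  unfolding Ck_map_def man(2)
proof (intro ballI, clarify)
  fix U \<phi> assume c: "(U, \<phi>) \<in> atlas X"
  note ch = chart_facts[OF man c]
  have bl: "bounded_linear \<pi>" using \<pi> by (simp add: linear_conv_bounded_linear)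
  have *: "Ck r V (\<lambda>x. g x + \<pi> x)"
    by (intro Ck_add V(1) g Ck_bounded_linear[OF V(1) bl Ck_ident[OF V(1)]])
  have "(f \<circ> inv_into U \<phi>) ` \<phi> ` U \<subseteq> V" using V(2) ch(1,2) by (auto simp: image_subset_iff subset_iff)
  from Ck_compose[OF ch(3) V(1) Ck_map_chart[OF f man(2) c] * this]
  show "Ck r (\<phi> ` U) ((\<lambda>x. g x + \<pi> x) \<circ> f \<circ> inv_into U \<phi>)" by (simp add: o_def)
qed

lemma Ck_map_mono:
  assumes "Ck_manifold r X" "model X = UNIV" "Ck_map r X h" "j \<le> r"
  shows "Ck_map j X h"
  unfolding Ck_map_def assms(2)
proof (intro ballI, clarify)
  fix U \<phi> assume c: "(U, \<phi>) \<in> atlas X"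
  show "Ck j (\<phi> ` U) (h \<circ> inv_into U \<phi>)"
    using Ck_mono[OF chart_facts(3)[OF assms(1,2) c] Ck_map_chart[OF assms(3,2) c] assms(4)] .
qed

lemma countable_subatlas:
  assumes "Ck_manifold r X"
  obtains \<C> where "countable \<C>" "\<C> \<subseteq> atlas X" "\<And>x. x \<in> points X \<Longrightarrow> \<exists>c\<in>\<C>. x \<in> fst c"
proof -
  note M = assms[unfolded Ck_manifold_def, THEN conjunct2]
  note man = M[THEN conjunct1] M[THEN conjunct2, THEN conjunct2, THEN conjunct1]
    M[THEN conjunct2, THEN conjunct2, THEN conjunct2, THEN conjunct1]
  have "Lindelof_space (mtop X)" using man(1) by (rule second_countable_imp_Lindelof_space)
  moreover have "openin (mtop X) U" if "U \<in> fst ` atlas X" for U using man(3) that by auto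
  moreover have "\<Union>(fst ` atlas X) = points X" unfolding man(2) by auto
  ultimately obtain \<V> where \<V>: "countable \<V>" "\<V> \<subseteq> fst ` atlas X" "\<Union>\<V> = points X"
    unfolding Lindelof_space_def by meson
  obtain \<C> where \<C>: "countable \<C>" "\<C> \<subseteq> atlas X" "\<V> = fst ` \<C>"
    using countable_subset_image[of \<V> fst "atlas X"] \<V>(1,2) by auto
  show thesis
  proof (rule that[OF \<C>(1,2)])
    fix x assume "x \<in> points X"
    then show "\<exists>c\<in>\<C>. x \<in> fst c" using \<V>(3) \<C>(3) by auto
  qed
qed

lemma exponent_pos:
  fixes m l n r d :: nat
  assumes "1 \<le> m" "1 \<le> l" "l \<le> n" "1 \<le> r"
  shows "0 < real m * real l - 1 + (real d * (real n - real l) + real l + 1) / real r"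
proof -
  have "1 * 1 \<le> real m * real l" using assms by (intro mult_mono) auto
  moreover have "0 \<le> real d * (real n - real l)" using assms(3) by simp
  then have "0 < (real d * (real n - real l) + real l + 1) / real r"
    using assms(4) by (intro divide_pos_pos) auto
  ultimately show ?thesis by linarith
qed

text \<open>A bad perturbation fails the criterion of \<open>multi_transverseI\<close> for every choice of charts around some
  configuration, in particular for charts from a countable atlas. For each of the countably many
  choices of \<open>d\<close> and such charts, \<open>degenerate_crossings_null\<close> applies.\<close>

lemma bad_perturbations_null:
  fixes X :: "('a, real^'n) manifold" and f :: "'a \<Rightarrow> real^'m" and g :: "real^'m \<Rightarrow> real^'l"
  assumes r: "1 \<le> r" and man: "Ck_manifold r X" "model X = UNIV" and ln: "CARD('l) \<le> CARD('n)"
    and V: "open V" "f ` points X \<subseteq> V" and inj: "inj_on f (points X)" and f: "Ck_map r X f"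
    and g: "Ck r V g" and fin: "finite (general_position_degrees X f)"
  shows "hnull (real CARD('m) * real CARD('l) - 1 +
      (real (df X f) * (real CARD('n) - real CARD('l)) + real CARD('l) + 1) / real r)
      (matrix ` bad_perturbations X f g)"
proof -
  let ?e = "\<lambda>d. real CARD('m) * real CARD('l) - 1 +
      (real d * (real CARD('n) - real CARD('l)) + real CARD('l) + 1) / real r"
  obtain \<C> where \<C>: "countable \<C>" "\<C> \<subseteq> atlas X" "\<And>x. x \<in> points X \<Longrightarrow> \<exists>c\<in>\<C>. x \<in> fst c"
    using countable_subatlas[OF man(1)] by blast
  define F where "F c i = f \<circ> inv_into (fst (c i)) (snd (c i))" for c :: "nat \<Rightarrow> 'a set \<times> ('a \<Rightarrow> real^'n)" and i
  define D where "D c i = snd (c i) ` fst (c i)" for c :: "nat \<Rightarrow> 'a set \<times> ('a \<Rightarrow> real^'n)" and i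
  define B where "B d c = {P. \<exists>x. (\<forall>i\<in>{1..d}. x i \<in> D c i) \<and>
       (\<forall>y. \<exists>R::real^'m^'l. \<forall>i\<in>{2..d}. R *v (F c i (x i) - F c 1 (x 1)) = y i) \<and>
       (\<forall>i\<in>{2..d}. branch g (F c i) P (x i) = branch g (F c 1) P (x 1)) \<and>
       \<not> differences_onto d (\<lambda>i. deriv_at (branch g (F c i) P) (x i))}" for d c
  have null: "hnull (?e (df X f)) (B d c)" if d: "d \<in> {2..df X f}" and c: "c \<in> {1..d} \<rightarrow>\<^sub>E \<C>" for d c
  proof -
    have cA: "(fst (c i), snd (c i)) \<in> atlas X" if "i \<in> {1..d}" for i using c \<C>(2) that by auto
    have "hnull (?e d) (B d c)"
      unfolding B_def
    proof (rule degenerate_crossings_null[OF _ _ r ln _ _ _ V(1) g])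
      show "1 \<le> d" "d \<le> CARD('m) + 1" using d df_le[OF fin] by auto
      fix i assume i: "i \<in> {1..d}"
      note ch = chart_facts[OF man cA[OF i]]
      show "open (D c i)" unfolding D_def by (rule ch(3))
      show "Ck r (D c i) (F c i)" unfolding D_def F_def by (rule Ck_map_chart[OF f man(2) cA[OF i]])
      show "F c i ` D c i \<subseteq> V" unfolding D_def F_def using V(2) ch(1,2) by (auto simp: image_subset_iff subset_iff)
    qed
    then show ?thesis
    proof (rule hnull_mono_exponent)
      show "0 < ?e d" by (rule exponent_pos[OF _ _ ln r]) (simp_all add: Suc_leI)
      have "real d * (real CARD('n) - real CARD('l)) \<le> real (df X f) * (real CARD('n) - real CARD('l))"
        using d ln by (intro mult_right_mono) auto
      then show "?e d \<le> ?e (df X f)" using r by (intro add_left_mono divide_right_mono) auto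
    qed
  qed
  have "matrix ` bad_perturbations X f g \<subseteq> (\<Union>d\<in>{2..df X f}. \<Union>c\<in>{1..d} \<rightarrow>\<^sub>E \<C>. B d c)"
  proof
    fix P assume "P \<in> matrix ` bad_perturbations X f g"
    then obtain \<pi> d where \<pi>: "P = matrix \<pi>" "linear \<pi>" and d: "2 \<le> d" "d \<le> df X f"
      and bad: "\<not> multi_transverse d X ((\<lambda>x. g x + \<pi> x) \<circ> f)"
      unfolding bad_perturbations_def by blast
    define h where "h = (\<lambda>x. g x + \<pi> x) \<circ> f"
    have Pv: "P *v x = \<pi> x" for x unfolding \<pi>(1) by (rule matrix_apply[OF \<pi>(2)])
    have "Ck_map r X h" unfolding h_def by (rule Ck_map_perturb[OF man V f g \<pi>(2)])
    then have h1: "Ck_map 1 X h" using Ck_map_mono[OF man] r by blast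
    have f1: "Ck_map 1 X f" using Ck_map_mono[OF man f r] .
    have "1 \<le> d" using d by simp
    have "\<not> (\<forall>q. q \<in> points (config d X) \<longrightarrow> (\<forall>i\<in>{1..d}. h (q i) = h (q 1)) \<longrightarrow>
      (\<exists>c. (\<forall>i\<in>{1..d}. c i \<in> atlas X \<and> q i \<in> fst (c i)) \<and>
        differences_onto d (\<lambda>i. chart_deriv (c i) h (q i))))"
      using multi_transverseI[OF man \<open>1 \<le> d\<close> inj f1 h1] bad unfolding h_def[symmetric] by blast
    then obtain q where q: "q \<in> points (config d X)" "\<forall>i\<in>{1..d}. h (q i) = h (q 1)"
      and no: "\<And>c. \<forall>i\<in>{1..d}. c i \<in> atlas X \<and> q i \<in> fst (c i) \<Longrightarrow>
        \<not> differences_onto d (\<lambda>i. chart_deriv (c i) h (q i))"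
      by blast
    have "\<forall>i\<in>{1..d}. \<exists>c\<in>\<C>. q i \<in> fst c" using \<C>(3) q(1) unfolding points_config by auto
    then obtain c0 where c0: "\<forall>i\<in>{1..d}. c0 i \<in> \<C> \<and> q i \<in> fst (c0 i)" by metis
    define c where "c = restrict c0 {1..d}"
    have c: "c i \<in> \<C>" "q i \<in> fst (c i)" if "i \<in> {1..d}" for i using c0 that by (auto simp: c_def)
    have cA: "(fst (c i), snd (c i)) \<in> atlas X" if "i \<in> {1..d}" for i using c(1)[OF that] \<C>(2) by auto
    have cE: "c \<in> {1..d} \<rightarrow>\<^sub>E \<C>" using c0 by (auto simp: c_def)
    define x where "x i = snd (c i) (q i)" for i
    have Fx: "F c i (x i) = f (q i)" if "i \<in> {1..d}" for i
      unfolding F_def x_def using c(2)[OF that] chart_facts(2)[OF man cA[OF that]] by simp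
    have br: "branch g (F c i) P = h \<circ> inv_into (fst (c i)) (snd (c i))" for i
      by (rule ext) (simp add: branch_def F_def h_def Pv)
    have one: "1 \<in> {1..d}" using d by simp
    have i1: "i \<in> {1..d}" if "i \<in> {2..d}" for i using that by auto
    have "P \<in> B d c"
      unfolding B_def
    proof (intro CollectI exI[of _ x] conjI)
      show "\<forall>i\<in>{1..d}. x i \<in> D c i" using c(2) by (simp add: x_def D_def)
      show "\<forall>y. \<exists>R::real^'m^'l. \<forall>i\<in>{2..d}. R *v (F c i (x i) - F c 1 (x 1)) = y i"
      proof
        fix y :: "nat \<Rightarrow> real^'l"
        obtain R :: "real^'m^'l" where "\<forall>i\<in>{2..d}. R *v (f (q i) - f (q 1)) = y i"
          using general_position_solvable[OF fin q(1) \<open>1 \<le> d\<close> d(2)] by blast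
        then show "\<exists>R::real^'m^'l. \<forall>i\<in>{2..d}. R *v (F c i (x i) - F c 1 (x 1)) = y i"
          using Fx i1 Fx[OF one] by (intro exI[of _ R]) auto
      qed
      have "branch g (F c i) P (x i) = h (q i)" if "i \<in> {1..d}" for i
        unfolding branch_def Fx[OF that] by (simp add: h_def Pv)
      then show "\<forall>i\<in>{2..d}. branch g (F c i) P (x i) = branch g (F c 1) P (x 1)"
        using q(2) i1 one by metis
      have "\<forall>i\<in>{1..d}. c i \<in> atlas X \<and> q i \<in> fst (c i)" using c \<C>(2) by blast
      from no[OF this]
      show "\<not> differences_onto d (\<lambda>i. deriv_at (branch g (F c i) P) (x i))"
        unfolding br x_def .
    qed
    then show "P \<in> (\<Union>d\<in>{2..df X f}. \<Union>c\<in>{1..d} \<rightarrow>\<^sub>E \<C>. B d c)" using d cE by auto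
  qed
  moreover have "hnull (?e (df X f)) (\<Union>d\<in>{2..df X f}. \<Union>c\<in>{1..d} \<rightarrow>\<^sub>E \<C>. B d c)"
    using null \<C>(1) by (intro hnull_UN countable_PiE) auto
  ultimately show ?thesis using hnull_subset by blast
qed

lemma multi_transverse_if_few_preimages:
  assumes "\<And>y. finite {x \<in> points X. h x = y} \<and> card {x \<in> points X. h x = y} < d" "1 \<le> d"
  shows "multi_transverse d X h"
  unfolding multi_transverse_def transverse_def
proof (intro ballI disjI1 notI)
  fix q assume q: "q \<in> points (config d X)" and "multi d h q \<in> diagonal d"
  then obtain y where "multi d h q = tuple d (\<lambda>i. y)" unfolding diagonal_def by blast
  then have "\<forall>i\<in>{1..d}. h (q i) = y" unfolding multi_def tuple_eq_iff .
  then have "q ` {1..d} \<subseteq> {x \<in> points X. h x = y}" "inj_on q {1..d}"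
    using q unfolding points_config by auto
  then have "card {1..d} \<le> card {x \<in> points X. h x = y}" using assms(1) card_inj_on_le by blast
  then show False using assms(1)[of y] by simp
qed

theorem theorem5p2:
  fixes X :: "('a, real^'n) manifold"
    and V :: "(real^'m) set"
    and f :: "'a \<Rightarrow> real^'m"
    and g :: "real^'m \<Rightarrow> real^'l"
    and r :: nat
  assumes "1 \<le> r"
    and "Ck_manifold r X" and "model X = UNIV"
    and "CARD('l) \<le> CARD('n)"
    and "open V"
    and "f ` points X \<subseteq> V" and "inj_on f (points X)" and "Ck_map r X f"
    and "Ck_on r UNIV V g"
    and df_exists: "finite (general_position_degrees X f)"
  shows "(\<forall>s::real.
            s \<ge> real CARD('m) * real CARD('l) - 1
                + (real (df X f) * (real CARD('n) - real CARD('l)) + real CARD('l) + 1) / real r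
            \<longrightarrow> hausdorff_null s (bad_perturbations X f g)) \<and>
         (\<forall>\<pi>. linear \<pi> \<and> \<pi> \<notin> bad_perturbations X f g \<and>
              (\<forall>y. finite {x \<in> points X. ((\<lambda>x. g x + \<pi> x) \<circ> f) x = y} \<and>
                   card {x \<in> points X. ((\<lambda>x. g x + \<pi> x) \<circ> f) x = y} \<le> df X f)
            \<longrightarrow> Ck_map r X ((\<lambda>x. g x + \<pi> x) \<circ> f) \<and>
                normal_crossings X ((\<lambda>x. g x + \<pi> x) \<circ> f))"
proof (intro conjI allI impI)
  fix s :: real
  let ?e = "real CARD('m) * real CARD('l) - 1
                + (real (df X f) * (real CARD('n) - real CARD('l)) + real CARD('l) + 1) / real r"
  assume s: "?e \<le> s"
  have e: "0 < ?e" by (rule exponent_pos[OF _ _ assms(4,1)]) (simp_all add: Suc_leI)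
  have "hnull s (matrix ` bad_perturbations X f g)"
    using bad_perturbations_null[OF assms] e s by (rule hnull_mono_exponent)
  then show "hausdorff_null s (bad_perturbations X f g)"
    unfolding hausdorff_null_def using e s by (intro hnull_imp_hausdorff_outer) auto
next
  fix \<pi> :: "real^'m \<Rightarrow> real^'l"
  let ?h = "(\<lambda>x. g x + \<pi> x) \<circ> f"
  assume \<pi>: "linear \<pi> \<and> \<pi> \<notin> bad_perturbations X f g \<and>
      (\<forall>y. finite {x \<in> points X. ?h x = y} \<and> card {x \<in> points X. ?h x = y} \<le> df X f)"
  show C: "Ck_map r X ?h"
    by (rule Ck_map_perturb[OF assms(2,3,5,6,8,9)]) (use \<pi> in blast)
  show "normal_crossings X ?h"
    unfolding normal_crossings_def
  proof (intro conjI allI impI)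
    show "Ck_map 1 X ?h" using Ck_map_mono[OF assms(2,3) C assms(1)] .
    fix d :: nat assume d: "2 \<le> d"
    show "multi_transverse d X ?h"
    proof (cases "d \<le> df X f")
      case True
      then show ?thesis using \<pi> d unfolding bad_perturbations_def by blast
    next
      case False
      show ?thesis
      proof (rule multi_transverse_if_few_preimages)
        fix y
        show "finite {x \<in> points X. ?h x = y} \<and> card {x \<in> points X. ?h x = y} < d"
          using \<pi> False by (meson not_le order_le_less_trans)
      qed (use d in simp)
    qed
  qed
qed

end
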